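(* Let $n\geqslant 2$ and let $(x_i)_{i\in\mathbb{Z}}$ be a sequence of points on the unit sphere $\Sigma^n\subseteq\mathbb{R}^{n+1}$. If $$\sup_{\ell\in\mathbb{Z}}\operatorname{dist}(x_\ell,x_{\ell+1})<0.6,$$ then the Riemannian analogue $T$ on $\Sigma^n$ of the linear cubic Lane-Riesenfeld scheme $$(Sx)_{2i}=\tfrac18 x_{i-1}+\tfrac68 x_i+\tfrac18 x_{i+1},\qquad (Sx)_{2i+1}=\tfrac12 x_i+\tfrac12 x_{i+1}\qquad(i\in\mathbb{Z})$$ converges, for the input data $(x_i)_{i\in\mathbb{Z}}$, to a continuous, even $C^2$, limit function on the unit sphere.
   Context: $\Sigma^n$ carries its standard Riemannian metric, with distance $\operatorname{dist}(p,q)=\arccos\langle p,q\rangle$. $B_\rho(p)=\{y\in\Sigma^n\mid \operatorname{dist}(p,y)<\rho\}$. Riemannian analogue: for a linear binary subdivision rule $(Sx)_i=\sum_{j\in\mathbb{Z}}a_{i-2j}x_j$ with finitely supported real mask $(a_i)$ satisfying $\sum_j a_{2j}=\sum_j a_{2j+1}=1$, its Riemannian analogue $T$ is $$Tx_i=\operatorname{arg\,min}_{x\in\Sigma^n}\sum_{j\in\mathbb{Z}}a_{i-2j}\operatorname{dist}(x,x_j)^2 .$$ The minimiser is understood locally. If the points $x_j$ contributing to $Tx_i$ (those with $a_{i-2j}\neq0$) lie in a ball $B_\rho(p)$ and, with $\alpha_-$ denoting the sum of the absolute values of the negative coefficients among the $a_{i-2j}$, there is $\rho^*>\rho$ with $(1+2\alpha_-)\rho<\rho^*<\frac{\pi}{4}\left(1+(1+\frac{\pi}{2})\alpha_-\right)^{-1}$,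 then the function being minimised has a unique minimiser in $B_{\rho^*}(p)$ (a known result), and $Tx_i$ is that minimiser. For nonnegative coefficients $\alpha_-=0$, so the condition is $\rho<\rho^*<\frac{\pi}{4}$. Convergence: $T$ converges for input data $x$ if the iterates $x,Tx,T^2x,\dots$ are defined and the functions $f_k$ with $f_k\left(\frac{i}{2^k}\right)=T^kx_i$ for all $i\in\mathbb{Z}$, obtained by piecewise linear interpolation in coordinate charts, converge as $k\to\infty$, uniformly on compact sets, to a continuous limit function $\mathbb{R}\to\Sigma^n$. *)

theory Defs
  imports "HOL-Analysis.Analysis"
begin

definition sdist :: "'a::real_inner \<Rightarrow> 'a \<Rightarrow> real" where
  "sdist p q = arccos (p \<bullet> q)"

definition sball :: "'a::real_inner \<Rightarrow> real \<Rightarrow> 'a set" where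
  "sball p r = {y \<in> sphere 0 1. sdist p y < r}"


(* The mask is a finitely supported function a on the integers. *)

definition linear_rule :: "(int \<Rightarrow> real) \<Rightarrow> (int \<Rightarrow> 'a::real_vector) \<Rightarrow> int \<Rightarrow> 'a" where
  "linear_rule a x i = (\<Sum>j | a (i - 2 * j) \<noteq> 0. a (i - 2 * j) *\<^sub>R x j)"

definition energy :: "(int \<Rightarrow> real) \<Rightarrow> (int \<Rightarrow> 'a::real_inner) \<Rightarrow> int \<Rightarrow> 'a \<Rightarrow> real" where
  "energy a x i y = (\<Sum>j | a (i - 2 * j) \<noteq> 0. a (i - 2 * j) * (sdist y (x j))\<^sup>2)"

definition neg_weight :: "(int \<Rightarrow> real) \<Rightarrow> int \<Rightarrow> real" where
  "neg_weight a i = (\<Sum>j | a (i - 2 * j) < 0. \<bar>a (i - 2 * j)\<bar>)"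

definition admissible ::
  "(int \<Rightarrow> real) \<Rightarrow> (int \<Rightarrow> 'a::real_inner) \<Rightarrow> int \<Rightarrow> 'a \<Rightarrow> real \<Rightarrow> real \<Rightarrow> bool" where
  "admissible a x i p r r' \<longleftrightarrow>
     p \<in> sphere 0 1 \<and>
     (\<forall>j. a (i - 2 * j) \<noteq> 0 \<longrightarrow> x j \<in> sball p r) \<and>
     r < r' \<and>
     (1 + 2 * neg_weight a i) * r < r' \<and>
     r' < pi / 4 * inverse (1 + (1 + pi / 2) * neg_weight a i)"

(* The value of the Riemannian analogue does not depend on the ball used to localise the
   minimisation: y has to be the unique minimiser for every admissible ball. *)

definition riem_value ::
  "(int \<Rightarrow> real) \<Rightarrow> (int \<Rightarrow> 'a::real_inner) \<Rightarrow> int \<Rightarrow> 'a \<Rightarrow> bool" where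
  "riem_value a x i y \<longleftrightarrow>
     (\<exists>p r r'. admissible a x i p r r') \<and>
     (\<forall>p r r'. admissible a x i p r r' \<longrightarrow>
        (\<forall>z. is_arg_min (energy a x i) (\<lambda>w. w \<in> sball p r') z \<longleftrightarrow> z = y))"

definition riem_defined :: "(int \<Rightarrow> real) \<Rightarrow> (int \<Rightarrow> 'a::real_inner) \<Rightarrow> bool" where
  "riem_defined a x \<longleftrightarrow> (\<forall>i. \<exists>y. riem_value a x i y)"

definition riem_analogue ::
  "(int \<Rightarrow> real) \<Rightarrow> (int \<Rightarrow> 'a::real_inner) \<Rightarrow> int \<Rightarrow> 'a" where
  "riem_analogue a x i = (THE y. riem_value a x i y)"


(* k-fold continuous differentiability on an open set S. For finite-dimensional domains,
   continuity of all iterated directional derivatives is continuity of the derivatives. *)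

primrec Ck_on ::
  "nat \<Rightarrow> 'a::euclidean_space set \<Rightarrow> ('a \<Rightarrow> 'b::real_normed_vector) \<Rightarrow> bool" where
  "Ck_on 0 S f \<longleftrightarrow> continuous_on S f"
| "Ck_on (Suc k) S f \<longleftrightarrow>
     (\<exists>f'. (\<forall>x\<in>S. (f has_derivative f' x) (at x)) \<and> (\<forall>v. Ck_on k S (\<lambda>x. f' x v)))"

(* \<phi> is a smooth chart of the unit sphere with domain U, and \<psi> is its inverse. Smooth
   compatibility with the sphere as a submanifold of the ambient space is expressed by
   \<psi> being a smooth immersion. *)

definition sphere_chart ::
  "(real^('n::finite option)) set \<Rightarrow> (real^('n option) \<Rightarrow> real^'n) \<Rightarrow>
   (real^'n \<Rightarrow> real^('n option)) \<Rightarrow> bool" where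
  "sphere_chart U \<phi> \<psi> \<longleftrightarrow>
     openin (top_of_set (sphere 0 1)) U \<and> open (\<phi> ` U) \<and>
     homeomorphism U (\<phi> ` U) \<phi> \<psi> \<and>
     (\<forall>k. Ck_on k (\<phi> ` U) \<psi>) \<and>
     (\<forall>v \<in> \<phi> ` U. inj (frechet_derivative \<psi> (at v)))"

definition chart_interpolant ::
  "nat \<Rightarrow> (int \<Rightarrow> real^('n::finite option)) \<Rightarrow> (real \<Rightarrow> real^('n option)) \<Rightarrow> bool" where
  "chart_interpolant k y g \<longleftrightarrow>
     (\<forall>i. \<exists>U \<phi> \<psi>. sphere_chart U \<phi> \<psi> \<and> y i \<in> U \<and> y (i + 1) \<in> U \<and>
        (\<forall>s\<in>{0..1}.
           (1 - s) *\<^sub>R \<phi> (y i) + s *\<^sub>R \<phi> (y (i + 1)) \<in> \<phi> ` U \<and>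
           g ((of_int i + s) / 2 ^ k) = \<psi> ((1 - s) *\<^sub>R \<phi> (y i) + s *\<^sub>R \<phi> (y (i + 1)))))"

(* The charts of the interpolants F k are not prescribed. This does not weaken convergence:
   if F k tends to f locally uniformly, then the data at the points i / 2^k do so, and since f
   is continuous, the linear interpolants in any fixed chart around a point f t then tend to
   f near t. On the sphere, the ambient distance (used in uniform_limit) and sdist are
   uniformly equivalent. *)

definition converges_to ::
  "(int \<Rightarrow> real) \<Rightarrow> (int \<Rightarrow> real^('n::finite option)) \<Rightarrow> (real \<Rightarrow> real^('n option)) \<Rightarrow> bool" where
  "converges_to a x f \<longleftrightarrow>
     (\<forall>k. riem_defined a ((riem_analogue a ^^ k) x)) \<and>
     continuous_on UNIV f \<and> range f \<subseteq> sphere 0 1 \<and>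
     (\<exists>F. (\<forall>k. chart_interpolant k ((riem_analogue a ^^ k) x) (F k)) \<and>
          (\<forall>K. compact K \<longrightarrow> uniform_limit K F f sequentially))"


definition cubic_mask :: "int \<Rightarrow> real" where
  "cubic_mask m =
     (if m = 0 then 6 / 8 else if \<bar>m\<bar> = 1 then 1 / 2 else if \<bar>m\<bar> = 2 then 1 / 8 else 0)"

lemma cubic_mask_even_support: "{j. cubic_mask (2 * i - 2 * j) \<noteq> 0} = {i - 1, i, i + 1}"
  by (auto simp: cubic_mask_def split: if_splits)

lemma cubic_mask_odd_support: "{j. cubic_mask (2 * i + 1 - 2 * j) \<noteq> 0} = {i, i + 1}"
  unfolding cubic_mask_def by (auto split: if_splits; presburger)

lemma linear_rule_cubic_mask_even:
  "linear_rule cubic_mask x (2 * i) =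
     (1 / 8) *\<^sub>R x (i - 1) + (6 / 8) *\<^sub>R x i + (1 / 8) *\<^sub>R x (i + 1)"
  unfolding linear_rule_def cubic_mask_even_support by (simp add: cubic_mask_def)

lemma linear_rule_cubic_mask_odd:
  "linear_rule cubic_mask x (2 * i + 1) = (1 / 2) *\<^sub>R x i + (1 / 2) *\<^sub>R x (i + 1)"
  unfolding linear_rule_def cubic_mask_odd_support by (simp add: cubic_mask_def)

end

theory Submission
  imports Defs
begin

text \<open>
  Everything is measured by chords in the ambient space. Write $\Delta$ for the forward difference
  of a sequence, $S$ for the linear cubic scheme and $T$ for its analogue on the sphere.

  \<^emph>\<open>One step.\<close> On points that lie in a ball of radius less than $\pi/4$ the squared distances
  are strictly midpoint convex, and pulling a point back into a smaller ball that contains the data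
  increases no distance to them; so there is exactly one minimiser. The vanishing of the gradient says that
  the minimiser is the radial projection of a convex combination of the data. The weights of this
  combination are proportional to the mask coefficients times $\theta/\sin\theta$, where $\theta$
  is the distance from the minimiser (lemma mean_in_eq_sgn). Consequently the minimiser lies in every
  admissible ball, which makes it independent of the ball. Since
  $\theta/\sin\theta = 1 + O(\theta^2)$, the weights differ from those of $S$ by $O(d^2)$, where $d$
  bounds the chords between consecutive points.

  \<^emph>\<open>Two estimates.\<close> As long as $d \le 0.6$, one step of $T$ multiplies $d$ at most by $5/6$
  (lemma riem_cubic_contraction). Moreover $Tx - Sx$ agrees near $x_i$, both at even and at odd
  indices, with $|\Delta x_i|^2/8 \cdot x_i$ up to higher order. This common term cancels in
  $\Delta(Tx - Sx)$, which is therefore bounded by $8d(d^2+s)$, where $s$ bounds the second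
  differences (lemma riem_cubic_proximity).

  \<^emph>\<open>Smoothness.\<close> The linear scheme multiplies the bounds on first, second and third
  differences by $1/2$, $1/4$ and $1/8$. A discrete Gronwall argument shows that the perturbation
  does not destroy these rates: after $k$ steps the first two are $O(2^{-k})$ and $O(4^{-k})$, and
  the third, multiplied by $4^k$, is summable. Hence the data, $2^k$ times their first and $4^k$
  times their second differences all converge uniformly, and each of the limits is the derivative
  of the one before it (lemmas grid_limit_exists and grid_limit_derivative).

  \<^emph>\<open>Charts.\<close> Stereographic projection from the antipode of $y_i$ gives a chart that contains
  $y_{i+1}$ and in which the linear interpolant from $y_i$ to $y_{i+1}$ moves away from $y_i$
  monotonically. So the interpolants stay as close to the data as consecutive data points are to
  each other.
\<close>

section \<open>Distances on the sphere\<close>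

lemma abs_inner_unit_le:
  assumes "norm x = 1" "norm y = 1"
  shows "\<bar>x \<bullet> y\<bar> \<le> 1"
  using Cauchy_Schwarz_ineq2[of x y] assms by simp

lemma norm_tangential_part:
  assumes "norm z = 1" "norm p = 1"
  shows "norm (z - (z \<bullet> p) *\<^sub>R p) = sqrt (1 - (z \<bullet> p)\<^sup>2)"
proof -
  have "z \<bullet> z = 1" "p \<bullet> p = 1" using assms by (simp_all add: norm_eq_1)
  then have "(z - (z \<bullet> p) *\<^sub>R p) \<bullet> (z - (z \<bullet> p) *\<^sub>R p) = 1 - (z \<bullet> p)\<^sup>2"
    by (simp add: inner_diff_left inner_diff_right inner_commute power2_eq_square)
  then show ?thesis by (simp add: norm_eq_sqrt_inner)
qed

text \<open>
  The difference is the inner product of the components of x and y orthogonal to p. For points at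
  distances $s$ and $t$ from p the bound is $\sin s \sin t$, so this is the spherical triangle
  inequality in a form that avoids angles.
\<close>
lemma unit_inner_near_product:
  assumes "norm x = 1" "norm y = 1" "norm p = 1"
  shows "\<bar>x \<bullet> y - (x \<bullet> p) * (y \<bullet> p)\<bar> \<le> sqrt (1 - (x \<bullet> p)\<^sup>2) * sqrt (1 - (y \<bullet> p)\<^sup>2)"
proof -
  have p: "p \<bullet> p = 1" using assms(3) by (simp add: dot_square_norm)
  have "x \<bullet> y - (x \<bullet> p) * (y \<bullet> p) = (x - (x \<bullet> p) *\<^sub>R p) \<bullet> (y - (y \<bullet> p) *\<^sub>R p)"
    using p by (simp add: inner_diff_left inner_diff_right inner_commute)
  then show ?thesis
    using Cauchy_Schwarz_ineq2[of "x - (x \<bullet> p) *\<^sub>R p" "y - (y \<bullet> p) *\<^sub>R p"] assms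
    by (simp add: norm_tangential_part)
qed

lemma mem_sball_iff:
  assumes "norm p = 1" "0 < r" "r \<le> pi"
  shows "y \<in> sball p r \<longleftrightarrow> norm y = 1 \<and> cos r < p \<bullet> y"
proof -
  have "arccos (p \<bullet> y) < r \<longleftrightarrow> cos r < p \<bullet> y" if "norm y = 1"
    using arccos_less_mono[of "p \<bullet> y" "cos r"] abs_inner_unit_le[OF assms(1) that]
      arccos_cos[of r] assms by simp
  then show ?thesis by (auto simp: sball_def sdist_def)
qed

lemma sball_radius_pos:
  assumes "norm p = 1" "y \<in> sball p r"
  shows "0 < r"
  using assms arccos_lbound[of "p \<bullet> y"] abs_inner_unit_le[of p y]
  by (auto simp: sball_def sdist_def abs_le_iff)

text \<open>
  The ball has diameter at most $\pi/2$.
\<close>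
lemma inner_pos_in_small_ball:
  assumes "norm p = 1" "r \<le> pi / 4" "x \<in> sball p r" "y \<in> sball p r"
  shows "0 < x \<bullet> y"
proof -
  have r: "0 < r" using sball_radius_pos assms by blast
  have "r \<le> pi" using assms(2) pi_gt_zero by linarith
  note m = mem_sball_iff[OF assms(1) r this]
  have "cos (pi / 4) \<le> cos r" using cos_monotone_0_pi_le[of r "pi / 4"] r assms by auto
  then have c: "sqrt 2 / 2 \<le> cos r" by (simp add: cos_45)
  have half: "1 / 2 < (z \<bullet> p)\<^sup>2" "norm z = 1" "0 < z \<bullet> p" if "z \<in> sball p r" for z
  proof -
    have "sqrt 2 / 2 < z \<bullet> p" using m[of z] that c by (auto simp: inner_commute)
    then show "0 < z \<bullet> p" using real_sqrt_gt_zero[of 2] by linarith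
    have "(sqrt 2 / 2)\<^sup>2 < (z \<bullet> p)\<^sup>2"
      using \<open>sqrt 2 / 2 < z \<bullet> p\<close> by (intro power_strict_mono) auto
    then show "1 / 2 < (z \<bullet> p)\<^sup>2" by (simp add: power_divide)
    show "norm z = 1" using m[of z] that by auto
  qed
  note X = half[OF assms(3)] and Y = half[OF assms(4)]
  have "sqrt (1 - (x \<bullet> p)\<^sup>2) * sqrt (1 - (y \<bullet> p)\<^sup>2) = sqrt ((1 - (x \<bullet> p)\<^sup>2) * (1 - (y \<bullet> p)\<^sup>2))"
    by (simp add: real_sqrt_mult)
  also have "\<dots> < sqrt ((x \<bullet> p)\<^sup>2 * (y \<bullet> p)\<^sup>2)"
  proof (rule real_sqrt_less_mono)
    have "(1 - (x \<bullet> p)\<^sup>2) * (1 - (y \<bullet> p)\<^sup>2) = 1 - (x \<bullet> p)\<^sup>2 - (y \<bullet> p)\<^sup>2 + (x \<bullet> p)\<^sup>2 * (y \<bullet> p)\<^sup>2"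
      by (simp add: algebra_simps)
    then show "(1 - (x \<bullet> p)\<^sup>2) * (1 - (y \<bullet> p)\<^sup>2) < (x \<bullet> p)\<^sup>2 * (y \<bullet> p)\<^sup>2"
      using X(1) Y(1) by linarith
  qed
  also have "\<dots> = (x \<bullet> p) * (y \<bullet> p)"
    using X(3) Y(3) by (simp add: real_sqrt_mult)
  finally show ?thesis
    using unit_inner_near_product[OF X(2) Y(2) assms(1)] by linarith
qed

text \<open>
  Let $A$ and $B$ be half the sum and half the difference of the distances of y and y' to x, and
  $\alpha$ half the distance from y to y'. The midpoint has distance $m$ from x with
  $\cos m = \cos A \cos B / \cos\alpha$. By the triangle inequality $|B| \le \alpha$, so $m \le A$,
  and the mean of the two squared distances is $A^2 + B^2$. One of the two estimates is strict.
\<close>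
lemma arccos_sq_midpoint_less:
  assumes "norm y = 1" "norm y' = 1" "norm x = 1" "y \<noteq> y'"
    and pos: "0 < y \<bullet> x" "0 < y' \<bullet> x" "0 < y \<bullet> y'"
  shows "(sdist (sgn (y + y')) x)\<^sup>2 < ((sdist y x)\<^sup>2 + (sdist y' x)\<^sup>2) / 2"
proof -
  define s t where "s = sdist y x" and "t = sdist y' x"
  define A B where "A = (s + t) / 2" and "B = (s - t) / 2"
  define n where "n = norm (y + y')"
  have c1: "\<bar>y \<bullet> x\<bar> \<le> 1" "\<bar>y' \<bullet> x\<bar> \<le> 1" "\<bar>y \<bullet> y'\<bar> \<le> 1"
    using assms abs_inner_unit_le by blast+
  have st: "cos s = y \<bullet> x" "cos t = y' \<bullet> x"
    using c1 by (simp_all add: s_def t_def sdist_def)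
  have range: "0 \<le> s" "s < pi / 2" "0 \<le> t" "t < pi / 2"
    using c1 pos arccos_less_mono[of "y \<bullet> x" 0] arccos_less_mono[of "y' \<bullet> x" 0]
    by (auto simp: s_def t_def sdist_def intro!: arccos_lbound)
  have "y \<bullet> y = 1" "y' \<bullet> y' = 1" using assms(1,2) by (simp_all add: dot_square_norm)
  then have n2: "n\<^sup>2 = 2 + 2 * (y \<bullet> y')"
    by (simp add: n_def power2_norm_eq_inner inner_add_left inner_add_right inner_commute)
  have npos: "0 < n" 
  proof -
    have "n \<noteq> 0" using n2 pos(3) by auto
    then show ?thesis by (simp add: n_def)
  qed
  have "y \<bullet> y' < 1"
  proof -
    have "0 < (norm (y - y'))\<^sup>2" using assms(4) by simp
    also have "(norm (y - y'))\<^sup>2 = 2 - 2 * (y \<bullet> y')"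
      using \<open>y \<bullet> y = 1\<close> \<open>y' \<bullet> y' = 1\<close>
      by (simp add: power2_norm_eq_inner inner_diff_left inner_diff_right inner_commute)
    finally show ?thesis by simp
  qed
  \<comment> \<open>The distance between y and y' is at least the difference of their distances to x.\<close>
  have "sin s = sqrt (1 - (y \<bullet> x)\<^sup>2)" "sin t = sqrt (1 - (y' \<bullet> x)\<^sup>2)"
    using c1 by (simp_all add: s_def t_def sdist_def sin_arccos_abs)
  then have "y \<bullet> y' \<le> cos s * cos t + sin s * sin t"
    using unit_inner_near_product[OF assms(1,2,3)] st by (simp add: abs_le_iff)
  also have "\<dots> = cos (s - t)" by (simp add: cos_diff)
  also have "s - t = 2 * B" by (simp add: B_def)
  also have "cos (2 * B) = 2 * (cos B)\<^sup>2 - 1" by (rule cos_double_cos)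
  finally have "n\<^sup>2 \<le> (2 * cos B)\<^sup>2" using n2 by (simp add: power_mult_distrib)
  moreover have "0 < cos B" using range by (intro cos_gt_zero_pi) (auto simp: B_def)
  ultimately have nB: "n \<le> 2 * cos B" by (intro power2_le_imp_le[of n]) auto
  have Apos: "0 < cos A" using range by (intro cos_gt_zero_pi) (auto simp: A_def)
  have A: "0 \<le> A" "A \<le> pi" using range by (auto simp: A_def)
  have "sgn (y + y') \<bullet> x = (cos s + cos t) / n"
    using st by (simp add: sgn_div_norm n_def inner_add_left divide_inverse)
  also have "cos s + cos t = cos A * (2 * cos B)"
    by (simp add: cos_plus_cos A_def B_def)
  finally have m: "sgn (y + y') \<bullet> x = cos A * (2 * cos B / n)" by simp
  have "norm (sgn (y + y')) = 1" using npos by (simp add: norm_sgn n_def)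
  then have m1: "\<bar>sgn (y + y') \<bullet> x\<bar> \<le> 1" using assms(3) by (rule abs_inner_unit_le)
  have ge: "cos A \<le> sgn (y + y') \<bullet> x"
    using mult_left_mono[of 1 "2 * cos B / n" "cos A"] nB npos Apos by (simp add: m)
  have d: "sdist (sgn (y + y')) x \<le> A" "0 \<le> sdist (sgn (y + y')) x"
    using arccos_le_arccos[OF _ ge] arccos_cos[OF A] m1 arccos_lbound
    by (auto simp: sdist_def abs_le_iff)
  have AB: "((sdist y x)\<^sup>2 + (sdist y' x)\<^sup>2) / 2 = A\<^sup>2 + B\<^sup>2"
    by (simp add: A_def B_def s_def t_def power2_eq_square field_simps)
  show ?thesis
  proof (cases "B = 0")
    case False
    then have "0 < B\<^sup>2" by simp
    then show ?thesis using power_mono[OF d(1) d(2), of 2] AB by linarith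
  next
    case True
    have "n\<^sup>2 < 2\<^sup>2" using n2 \<open>y \<bullet> y' < 1\<close> by simp
    then have "n < 2" by (rule power_less_imp_less_base) simp
    then have "cos A < sgn (y + y') \<bullet> x"
      using mult_strict_left_mono[of 1 "2 / n" "cos A"] npos Apos True by (simp add: m)
    then have "sdist (sgn (y + y')) x < A"
      using arccos_less_arccos[of "cos A" "sgn (y + y') \<bullet> x"] arccos_cos[OF A] m1
      by (simp add: sdist_def)
    then have "(sdist (sgn (y + y')) x)\<^sup>2 < A\<^sup>2" using d(2) by (intro power_strict_mono) auto
    then show ?thesis using AB True by simp
  qed
qed

section \<open>Geodesic means of finitely many points in a small ball\<close>

text \<open>
  The vector $\theta/\sin\theta \cdot (x - \cos\theta \cdot y)$ is the inverse exponential map at y of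
  a point x at distance $\theta$. The value at 0 is the limit.
\<close>
definition arc_weight :: "real \<Rightarrow> real" where
  "arc_weight t = (if t = 0 then 1 else t / sin t)"

lemma sin_ge_cubic:
  fixes t :: real
  assumes "0 \<le> t"
  shows "t - t ^ 3 / 6 \<le> sin t"
proof -
  have "\<bar>sin t - (\<Sum>m<3. sin_coeff m * t ^ m)\<bar> \<le> inverse (fact 3) * \<bar>t\<bar> ^ 3"
    by (rule Maclaurin_sin_bound)
  moreover have "(\<Sum>m<3. sin_coeff m * t ^ m) = t"
    by (simp add: sin_coeff_def numeral_3_eq_3)
  moreover have "inverse (fact 3) * \<bar>t\<bar> ^ 3 = t ^ 3 / 6"
    using assms by (simp add: fact_numeral)
  ultimately show ?thesis by linarith
qed

text \<open>
  Jordan's inequality with a worse constant, which is enough here.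
\<close>
lemma half_le_sin:
  fixes t :: real
  assumes "0 \<le> t" "t \<le> pi / 2"
  shows "t / 2 \<le> sin t"
proof -
  have "t \<le> 1.6" using assms pi_less_4 pi_approx by simp
  then have "t * t \<le> 1.6 * 1.6" using assms by (intro mult_mono) auto
  then have "t * (t * t) \<le> t * 2.56" using assms by (intro mult_left_mono) auto
  then show ?thesis using sin_ge_cubic[OF assms(1)] assms by (simp add: power3_eq_cube)
qed

lemma arc_weight_bounds:
  assumes "0 \<le> t" "t < pi / 2"
  shows "1 \<le> arc_weight t" "arc_weight t \<le> 2" "arc_weight t \<le> 1 + t\<^sup>2"
proof -
  have *: "1 \<le> t / sin t \<and> t / sin t \<le> 2 \<and> t / sin t \<le> 1 + t\<^sup>2" if "0 < t"
  proof -
    have s: "0 < sin t" using that assms by (intro sin_gt_zero) auto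
    have "t \<le> 1.6" using assms pi_less_4 pi_approx by simp
    then have t2: "t\<^sup>2 \<le> 5" using power_mono[of t "1.6" 2] that by (simp add: power2_eq_square)
    have "t * 1 \<le> t * ((1 - t\<^sup>2 / 6) * (1 + t\<^sup>2))"
    proof (intro mult_left_mono)
      have "0 \<le> t\<^sup>2 * (5 - t\<^sup>2)" using t2 by simp
      then show "1 \<le> (1 - t\<^sup>2 / 6) * (1 + t\<^sup>2)" by (simp add: algebra_simps)
    qed (use that in auto)
    also have "\<dots> = (t - t ^ 3 / 6) * (1 + t\<^sup>2)" by (simp add: power2_eq_square power3_eq_cube algebra_simps)
    also have "\<dots> \<le> sin t * (1 + t\<^sup>2)"
      using sin_ge_cubic[of t] that by (intro mult_right_mono) auto
    finally show ?thesis
      using s half_le_sin[of t] assms sin_x_le_x[of t] that by (simp add: field_simps)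
  qed
  then show "1 \<le> arc_weight t" "arc_weight t \<le> 2" "arc_weight t \<le> 1 + t\<^sup>2"
    using assms by (auto simp: arc_weight_def)
qed

lemma norm_great_circle:
  assumes "norm y = 1" "norm v = 1" "y \<bullet> v = 0"
  shows "norm (cos t *\<^sub>R y + sin t *\<^sub>R v) = 1"
  using assms sin_cos_squared_add3[of t]
  by (simp add: norm_eq_1 inner_add_left inner_add_right inner_commute)

text \<open>
  The minimisation problem that defines one new point. The index set stands for the finitely many
  data points with a nonzero coefficient.
\<close>
locale weighted_points =
  fixes J :: "'i set" and a :: "'i \<Rightarrow> real" and x :: "'i \<Rightarrow> 'a::euclidean_space"
  assumes fin: "finite J" and nonempty: "J \<noteq> {}" and pos: "\<And>j. j \<in> J \<Longrightarrow> 0 < a j"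
begin

definition spread :: "'a \<Rightarrow> real" where
  "spread y = (\<Sum>j\<in>J. a j * (sdist y (x j))\<^sup>2)"

definition mean_in :: "'a \<Rightarrow> real \<Rightarrow> 'a \<Rightarrow> bool" where
  "mean_in p r y \<longleftrightarrow> is_arg_min spread (\<lambda>w. w \<in> sball p r) y"

definition inside :: "'a \<Rightarrow> real \<Rightarrow> real \<Rightarrow> bool" where
  "inside p r r' \<longleftrightarrow> norm p = 1 \<and> (\<forall>j\<in>J. x j \<in> sball p r) \<and> r < r' \<and> r' \<le> pi / 4"

lemma insideD:
  assumes "inside p r r'"
  shows "norm p = 1" "0 < r" "r < r'" "r' \<le> pi / 4" "r \<le> pi" "r' \<le> pi" "0 < r'"
    and "\<And>j. j \<in> J \<Longrightarrow> norm (x j) = 1 \<and> cos r < p \<bullet> x j \<and> x j \<in> sball p r'"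
    and "\<And>y. y \<in> sball p r \<longleftrightarrow> norm y = 1 \<and> cos r < p \<bullet> y"
    and "\<And>y. y \<in> sball p r' \<longleftrightarrow> norm y = 1 \<and> cos r' < p \<bullet> y"
proof -
  obtain j where "j \<in> J" using nonempty by blast
  then show r: "norm p = 1" "0 < r" "r < r'" "r' \<le> pi / 4"
    using assms sball_radius_pos by (auto simp: inside_def)
  then show "r \<le> pi" "r' \<le> pi" "0 < r'" using pi_gt_zero by linarith+
  then show b: "\<And>y. y \<in> sball p r \<longleftrightarrow> norm y = 1 \<and> cos r < p \<bullet> y"
    "\<And>y. y \<in> sball p r' \<longleftrightarrow> norm y = 1 \<and> cos r' < p \<bullet> y"
    using mem_sball_iff r by blast+
  show "norm (x j) = 1 \<and> cos r < p \<bullet> x j \<and> x j \<in> sball p r'" if "j \<in> J" for j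
  proof -
    have "x j \<in> sball p r" using assms that by (simp add: inside_def)
    moreover have "x j \<in> sball p r'" using calculation r(3) by (simp add: sball_def)
    ultimately show ?thesis using b by blast
  qed
qed

text \<open>
  On the closed ball of radius r a minimiser exists by compactness. The larger open ball offers no
  smaller value: replacing a point outside the closed ball by the nearest point of that ball takes
  it no farther from any data point.
\<close>
lemma ex_mean_in:
  assumes "inside p r r'"
  shows "\<exists>y. mean_in p r' y"
proof -
  note D = insideD[OF assms]
  define K where "K = {y \<in> sphere 0 1. cos r \<le> p \<bullet> y}"
  have cr: "cos r' < cos r" using cos_monotone_0_pi[of r r'] D by simp
  have "closed {y. cos r \<le> p \<bullet> y}" by (rule closed_halfspace_ge)
  then have "compact K"
    unfolding K_def using compact_Int_closed[OF compact_sphere, of "{y. cos r \<le> p \<bullet> y}" 0 1]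
    by (simp add: Int_def)
  moreover have "K \<noteq> {}" using D(1) by (auto simp: K_def dot_square_norm intro!: exI[of _ p])
  moreover have "continuous_on K spread"
    unfolding spread_def sdist_def
    using D(8) abs_inner_unit_le
    by (intro continuous_intros) (fastforce simp: K_def abs_le_iff)
  ultimately obtain y where y: "y \<in> K" "\<And>z. z \<in> K \<Longrightarrow> spread y \<le> spread z"
    using continuous_attains_inf[of K spread] by blast
  \<comment> \<open>Pulling a point outside the closed ball towards its centre until it reaches the ball
    does not increase any of the distances.\<close>
  have "spread y \<le> spread z" if "z \<in> sball p r'" "z \<notin> K" for z
  proof -
    have z: "norm z = 1" "cos r' < p \<bullet> z" "p \<bullet> z < cos r" using that D by (auto simp: K_def)
    define f where "f = arccos (p \<bullet> z)"
    have pz: "\<bar>p \<bullet> z\<bar> \<le> 1" using abs_inner_unit_le D(1) z(1) by blast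
    have f: "cos f = p \<bullet> z" "sin f = sqrt (1 - (p \<bullet> z)\<^sup>2)" "r < f" "f < r'"
      using pz arccos_less_mono[of "cos r" "p \<bullet> z"] arccos_less_mono[of "p \<bullet> z" "cos r'"] z D
      by (auto simp: f_def sin_arccos_abs arccos_cos)
    have sf: "0 < sin f" using f D by (intro sin_gt_zero) auto
    \<comment> \<open>The point w below is at distance r from p on the geodesic from p to z, with initial direction e.\<close>
    define e where "e = (z - cos f *\<^sub>R p) /\<^sub>R sin f"
    have pp: "p \<bullet> p = 1" "z \<bullet> z = 1" using D(1) z(1) by (simp_all add: dot_square_norm)
    have pe: "p \<bullet> e = 0" by (simp add: e_def inner_diff_right f pp)
    have "(z - cos f *\<^sub>R p) \<bullet> (z - cos f *\<^sub>R p) = (sin f)\<^sup>2"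
      using pp f(1) sin_cos_squared_add3[of f] by (simp add: sin_squared_eq inner_diff_left inner_diff_right inner_commute
          power2_eq_square)
    then have "norm (z - cos f *\<^sub>R p) = sin f" using sf by (simp add: norm_eq_sqrt_inner)
    then have e1: "norm e = 1" using sf by (simp add: e_def)
    define w where "w = cos r *\<^sub>R p + sin r *\<^sub>R e"
    have "norm w = 1" unfolding w_def by (rule norm_great_circle[OF D(1) e1 pe])
    moreover have "p \<bullet> w = cos r" using pp pe by (simp add: w_def inner_add_right)
    ultimately have "w \<in> K" by (simp add: K_def)
    have ze: "z = cos f *\<^sub>R p + sin f *\<^sub>R e" using sf by (simp add: e_def)
    have "spread w \<le> spread z"
      unfolding spread_def
    proof (intro sum_mono mult_left_mono)
      fix j assume j: "j \<in> J"
      then have xj: "norm (x j) = 1" "cos r < p \<bullet> x j" using D(8) by auto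
      have Q: "e \<bullet> x j \<le> sin r"
      proof -
        have "\<bar>x j \<bullet> e - (x j \<bullet> p) * (e \<bullet> p)\<bar> \<le> sqrt (1 - (x j \<bullet> p)\<^sup>2) * sqrt (1 - (e \<bullet> p)\<^sup>2)"
          using unit_inner_near_product xj(1) e1 D(1) by blast
        then have "\<bar>e \<bullet> x j\<bar> \<le> sqrt (1 - (p \<bullet> x j)\<^sup>2)" using pe by (simp add: inner_commute)
        also have "\<dots> \<le> sqrt (1 - (cos r)\<^sup>2)"
        proof -
          have "0 \<le> cos r" using D by (intro cos_ge_zero) auto
          then show ?thesis using xj(2) by (intro real_sqrt_le_mono diff_left_mono power_mono) auto
        qed
        also have "\<dots> = \<bar>sin r\<bar>" by (simp add: sin_squared_eq[symmetric])
        also have "\<dots> = sin r" using D by (simp add: sin_ge_zero)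
        finally show ?thesis by simp
      qed
      have sr: "sin r \<le> sin f" using f D by (intro sin_monotone_2pi_le) auto
      have cf: "cos f \<le> cos r" using f z by simp
      have "(w - z) \<bullet> x j = (p \<bullet> x j) * (cos r - cos f) + (e \<bullet> x j) * (sin r - sin f)"
        by (simp add: w_def ze inner_diff_left inner_add_left algebra_simps)
      also have "\<dots> \<ge> cos r * (cos r - cos f) + sin r * (sin r - sin f)"
        using xj(2) Q sr cf by (intro add_mono mult_right_mono mult_right_mono_neg) auto
      moreover have "cos r * (cos r - cos f) + sin r * (sin r - sin f) = 1 - cos (f - r)"
        using sin_cos_squared_add3[of r] by (simp add: cos_diff algebra_simps)
      ultimately have "z \<bullet> x j \<le> w \<bullet> x j" using cos_le_one[of "f - r"]
        unfolding inner_diff_left by linarith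
      moreover have "\<bar>z \<bullet> x j\<bar> \<le> 1" "\<bar>w \<bullet> x j\<bar> \<le> 1"
        using abs_inner_unit_le z(1) xj(1) \<open>norm w = 1\<close> by blast+
      ultimately show "(sdist w (x j))\<^sup>2 \<le> (sdist z (x j))\<^sup>2"
        unfolding sdist_def by (intro power_mono arccos_le_arccos arccos_lbound) auto
    qed (use pos in \<open>auto intro: less_imp_le\<close>)
    then show ?thesis using y(2)[OF \<open>w \<in> K\<close>] by simp
  qed
  moreover have "y \<in> sball p r'" using y(1) cr D by (auto simp: K_def)
  ultimately show ?thesis
    using y(2) by (intro exI[of _ y]) (fastforce simp: mean_in_def is_arg_min_linorder)
qed

text \<open>
  The midpoint of two distinct minimisers would do better than both.
\<close>
lemma mean_in_unique:
  assumes "inside p r r'" "mean_in p r' y" "mean_in p r' y'"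
  shows "y = y'"
proof (rule ccontr)
  assume ne: "y \<noteq> y'"
  note D = insideD[OF assms(1)]
  have y: "y \<in> sball p r'" "y' \<in> sball p r'" "spread y = spread y'"
    and min: "\<And>z. z \<in> sball p r' \<Longrightarrow> spread y \<le> spread z"
    using assms(2,3) by (auto simp: mean_in_def is_arg_min_linorder order_antisym)
  have n: "norm y = 1" "norm y' = 1" "cos r' < p \<bullet> y" "cos r' < p \<bullet> y'" using y D by auto
  have c: "0 < cos r'" using D by (intro cos_gt_zero_pi) auto
  have yy: "0 < y \<bullet> y'" using inner_pos_in_small_ball[OF D(1,4)] y by blast
  \<comment> \<open>The midpoint stays in the ball: its inner product with p is at least the mean of the two.\<close>
  define m where "m = sgn (y + y')"
  have "p \<bullet> (y + y') > 2 * cos r'" using n by (simp add: inner_add_right)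
  then have "y + y' \<noteq> 0" using c by auto
  have "norm (y + y') \<le> 2" using norm_triangle_ineq[of y y'] n by simp
  moreover have "p \<bullet> m * norm (y + y') = p \<bullet> (y + y')"
  proof -
    have "y + y' = norm (y + y') *\<^sub>R m" using \<open>y + y' \<noteq> 0\<close> by (simp add: m_def sgn_div_norm)
    then have "p \<bullet> (y + y') = p \<bullet> (norm (y + y') *\<^sub>R m)" by simp
    then show ?thesis by simp
  qed
  moreover have "p \<bullet> m \<ge> 0"
    using \<open>p \<bullet> (y + y') > _\<close> c unfolding m_def sgn_div_norm inner_scaleR_right by simp
  ultimately have "2 * cos r' < p \<bullet> m * 2" 
    using mult_left_mono[of "norm (y + y')" 2 "p \<bullet> m"] by - (use \<open>p \<bullet> (y + y') > _\<close> in linarith)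
  then have m: "m \<in> sball p r'"
    using D \<open>y + y' \<noteq> 0\<close> by (simp add: m_def norm_sgn)
  have "spread m < (\<Sum>j\<in>J. a j * (((sdist y (x j))\<^sup>2 + (sdist y' (x j))\<^sup>2) / 2))"
    unfolding spread_def m_def
  proof (intro sum_strict_mono fin nonempty mult_strict_left_mono pos)
    fix j assume "j \<in> J"
    then have "norm (x j) = 1" "0 < y \<bullet> x j" "0 < y' \<bullet> x j"
      using inner_pos_in_small_ball[OF D(1,4)] y D(8) by auto
    then show "(sdist (sgn (y + y')) (x j))\<^sup>2 < ((sdist y (x j))\<^sup>2 + (sdist y' (x j))\<^sup>2) / 2"
      using arccos_sq_midpoint_less n ne yy by blast
  qed
  also have "\<dots> = (spread y + spread y') / 2"
    by (simp add: spread_def sum.distrib[symmetric] sum_divide_distrib algebra_simps)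
  finally show False using min[OF m] y(3) by simp
qed

end

text \<open>
  The inverse cosine is not differentiable at 1, but its square along a great circle through x is just
  $s^2$ there. This is why x = y is treated separately.
\<close>
lemma DERIV_sdist_sq_along_great_circle:
  assumes "norm y = 1" "norm x = 1" "norm v = 1" "y \<bullet> v = 0" "0 < y \<bullet> x"
  shows "((\<lambda>s. (sdist (cos s *\<^sub>R y + sin s *\<^sub>R v) x)\<^sup>2) has_real_derivative
           - 2 * arc_weight (sdist y x) * (v \<bullet> x)) (at 0)"
proof (cases "y \<bullet> x = 1")
  case True
  have "(norm (y - x))\<^sup>2 = 0" 
    using assms(1,2) True 
    by (simp add: power2_norm_eq_inner inner_diff_left inner_diff_right inner_commute
        norm_eq_1)
  then have x: "x = y" by simp
  have eq: "s\<^sup>2 = (sdist (cos s *\<^sub>R y + sin s *\<^sub>R v) x)\<^sup>2" if "s \<in> {-pi<..<pi}" for s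
  proof -
    have "v \<bullet> y = 0" "y \<bullet> y = 1" using assms by (simp_all add: inner_commute norm_eq_1)
    then have "(cos s *\<^sub>R y + sin s *\<^sub>R v) \<bullet> y = cos s" by (simp add: inner_add_left)
    then show ?thesis using that arccos_cos_eq_abs[of s] by (simp add: sdist_def x abs_le_iff)
  qed
  have "((\<lambda>s::real. s\<^sup>2) has_real_derivative 0) (at 0)"
    by (auto intro!: derivative_eq_intros)
  then have "((\<lambda>s. (sdist (cos s *\<^sub>R y + sin s *\<^sub>R v) x)\<^sup>2) has_real_derivative 0) (at 0)"
    by (rule has_field_derivative_transform_within_open[where S = "{-pi<..<pi}"]) (use eq in auto)
  then show ?thesis using x assms(4) by (simp add: inner_commute)
next
  case False
  then have t: "-1 < y \<bullet> x" "y \<bullet> x < 1"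
    using abs_inner_unit_le[OF assms(1,2)] assms(5) by auto
  define w where "w = arccos (y \<bullet> x)"
  have w: "sin w = sqrt (1 - (y \<bullet> x)\<^sup>2)" "w \<noteq> 0"
    using t sin_arccos[of "y \<bullet> x"] arccos_lt_bounded[of "y \<bullet> x"] by (auto simp: w_def)
  have g: "((\<lambda>s. cos s * (y \<bullet> x) + sin s * (v \<bullet> x)) has_real_derivative v \<bullet> x) (at 0)"
    by (auto intro!: derivative_eq_intros)
  have "DERIV arccos (cos 0 * (y \<bullet> x) + sin 0 * (v \<bullet> x)) :> inverse (- sqrt (1 - (y \<bullet> x)\<^sup>2))"
    using DERIV_arccos[of "y \<bullet> x"] t by simp
  from DERIV_power[OF DERIV_chain2[OF this g], of 2]
  show ?thesis using w
    by (simp add: sdist_def inner_add_left w_def[symmetric] arc_weight_def field_simps)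
qed

context weighted_points
begin

lemma mean_in_inner_pos:
  assumes "inside p r r'" "mean_in p r' y" "j \<in> J"
  shows "0 < y \<bullet> x j"
  using assms insideD[OF assms(1)] inner_pos_in_small_ball[of p r' y "x j"]
  by (auto simp: mean_in_def is_arg_min_def)

lemma mean_in_norm:
  assumes "inside p r r'" "mean_in p r' y"
  shows "norm y = 1" "y \<in> sball p r'"
  using assms insideD[OF assms(1)] by (auto simp: mean_in_def is_arg_min_def)

lemma mean_in_sdist_range:
  assumes "inside p r r'" "mean_in p r' y" "j \<in> J"
  shows "0 \<le> sdist y (x j)" "sdist y (x j) < pi / 2"
  using arccos_less_mono[of "y \<bullet> x j" 0] mean_in_inner_pos[OF assms]
    abs_inner_unit_le[of y "x j"] arccos_lbound mean_in_norm[OF assms(1,2)]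
    insideD(8)[OF assms(1,3)]
  by (auto simp: sdist_def abs_le_iff)

abbreviation "weight y j \<equiv> a j * arc_weight (sdist y (x j))"

text \<open>
  The sum is half the negative gradient. It is tangent to the sphere at y, so if it did not vanish,
  moving along it inside the open ball would decrease the function.
\<close>
lemma mean_in_critical:
  assumes "inside p r r'" "mean_in p r' y"
  shows "(\<Sum>j\<in>J. weight y j *\<^sub>R (x j - (y \<bullet> x j) *\<^sub>R y)) = 0" (is "?q = 0")
proof (rule ccontr)
  assume q: "?q \<noteq> 0"
  note D = insideD[OF assms(1)]
  note y = mean_in_norm[OF assms]
  have yy: "y \<bullet> y = 1" using y by (simp add: dot_square_norm)
  \<comment> \<open>The direction of steepest descent.\<close>
  define v where "v = sgn ?q"
  have yq: "y \<bullet> ?q = 0"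
    using yy by (auto simp: inner_sum_right inner_diff_right intro!: sum.neutral)
  have v: "norm v = 1" "y \<bullet> v = 0" using q yq by (simp_all add: v_def norm_sgn sgn_div_norm)
  define c where "c s = cos s *\<^sub>R y + sin s *\<^sub>R v" for s :: real
  define l where "l = (\<Sum>j\<in>J. a j * (- 2 * arc_weight (sdist y (x j)) * (v \<bullet> x j)))"
  have "((\<lambda>s. spread (c s)) has_real_derivative l) (at 0)"
    unfolding spread_def c_def l_def
    using y(1) v D(8) mean_in_inner_pos[OF assms]
    by (intro DERIV_sum DERIV_cmult DERIV_sdist_sq_along_great_circle) auto
  moreover have "\<exists>d>0. \<forall>s. \<bar>0 - s\<bar> < d \<longrightarrow> spread (c 0) \<le> spread (c s)"
  proof -
    have "((\<lambda>s. p \<bullet> c s) \<longlongrightarrow> p \<bullet> c 0) (at 0)"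
      unfolding c_def by (intro tendsto_intros)
    moreover have "cos r' < p \<bullet> c 0" using y D by (simp add: c_def)
    ultimately have "\<forall>\<^sub>F s in at 0. cos r' < p \<bullet> c s" by (rule order_tendstoD)
    then obtain d where d: "d > 0" "\<And>s. s \<noteq> 0 \<Longrightarrow> \<bar>s\<bar> < d \<Longrightarrow> cos r' < p \<bullet> c s"
      by (auto simp: eventually_at dist_real_def)
    have "norm (c s) = 1" for s
      unfolding c_def by (rule norm_great_circle[OF y(1) v])
    then have "c s \<in> sball p r'" if "\<bar>s\<bar> < d" for s
      using d(2)[of s] that \<open>cos r' < p \<bullet> c 0\<close> D by (cases "s = 0") auto
    moreover have "c 0 = y" by (simp add: c_def)
    ultimately show ?thesis
      using assms(2) d(1) by (auto simp: mean_in_def is_arg_min_linorder)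
  qed
  ultimately have "l = 0" using DERIV_local_min by blast
  moreover have "l = - 2 * (v \<bullet> ?q)"
    using v(2) by (simp add: l_def inner_sum_right inner_diff_right sum_distrib_left
        inner_commute algebra_simps)
  ultimately have "v \<bullet> ?q = 0" by simp
  then show False using q by (simp add: v_def sgn_div_norm)
qed

text \<open>
  Solving the critical equation for y: since all distances are less than $\pi/2$, the coefficient of y
  in it is positive.
\<close>
lemma mean_in_eq_sgn:
  assumes "inside p r r'" "mean_in p r' y"
  defines "W \<equiv> \<Sum>j\<in>J. weight y j"
  shows "0 < W" "y = sgn (\<Sum>j\<in>J. (weight y j / W) *\<^sub>R x j)"
proof -
  note D = insideD[OF assms(1)]
  note y = mean_in_norm[OF assms(1,2)]
  have w: "0 < weight y j" if "j \<in> J" for j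
  proof -
    have "1 \<le> arc_weight (sdist y (x j))"
      by (rule arc_weight_bounds(1)[OF mean_in_sdist_range[OF assms(1,2) that]])
    then show ?thesis using pos[OF that] by simp
  qed
  then show W: "0 < W" unfolding W_def by (intro sum_pos fin nonempty)
  define s where "s = (\<Sum>j\<in>J. weight y j * (y \<bullet> x j))"
  have s: "0 < s" unfolding s_def
    using w mean_in_inner_pos[OF assms(1,2)] by (intro sum_pos fin nonempty mult_pos_pos[OF w]) auto
  have "(\<Sum>j\<in>J. weight y j *\<^sub>R x j) = s *\<^sub>R y"
    using mean_in_critical[OF assms(1,2)]
    by (simp add: scaleR_diff_right sum_subtractf s_def scaleR_sum_left)
  then have "(\<Sum>j\<in>J. (weight y j / W) *\<^sub>R x j) = (s / W) *\<^sub>R y"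
    by (simp add: divide_inverse_commute scaleR_sum_right[symmetric] scaleR_scaleR[symmetric]
        del: scaleR_scaleR)
  moreover have "sgn ((s / W) *\<^sub>R y) = y"
    using s W y(1) by (simp add: sgn_scaleR sgn_div_norm)
  ultimately show "y = sgn (\<Sum>j\<in>J. (weight y j / W) *\<^sub>R x j)" by simp
qed

text \<open>
  A ball of radius less than $\pi/2$ is the trace of a convex cone on the sphere, and the minimiser is
  in the convex cone spanned by the data.
\<close>
lemma mean_in_other_ball:
  assumes "inside p r r'" "mean_in p r' y" "inside q s s'"
  shows "y \<in> sball q s'"
proof -
  note D = insideD[OF assms(3)]
  note y = mean_in_norm[OF assms(1,2)]
  define W where "W = (\<Sum>j\<in>J. weight y j)"
  define b where "b j = weight y j / W" for j
  define z where "z = (\<Sum>j\<in>J. b j *\<^sub>R x j)"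
  have W: "0 < W" and yz: "y = sgn z"
    unfolding z_def b_def W_def using mean_in_eq_sgn[OF assms(1,2)] by auto
  have b0: "0 \<le> b j" if "j \<in> J" for j
  proof -
    have "1 \<le> arc_weight (sdist y (x j))"
      by (rule arc_weight_bounds(1)[OF mean_in_sdist_range[OF assms(1,2) that]])
    then show ?thesis using pos[OF that] W by (simp add: b_def)
  qed
  have b1: "sum b J = 1" using W by (simp add: b_def W_def sum_divide_distrib[symmetric])
  have "cos s' < cos s" using cos_monotone_0_pi[of s s'] D by simp
  have "0 < cos s" using D by (intro cos_gt_zero_pi) auto
  have "cos s = (\<Sum>j\<in>J. b j * cos s)" using b1 by (simp add: sum_distrib_right[symmetric])
  also have "\<dots> \<le> (\<Sum>j\<in>J. b j * (q \<bullet> x j))"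
    using b0 D(8) by (intro sum_mono mult_left_mono) (auto intro: less_imp_le)
  also have "\<dots> = q \<bullet> z" by (simp add: z_def inner_sum_right)
  finally have qz: "cos s \<le> q \<bullet> z" .
  have "norm z \<le> (\<Sum>j\<in>J. b j)"
    unfolding z_def using b0 D(8) by (intro sum_norm_le) auto
  then have "norm z \<le> 1" using b1 by simp
  moreover have "0 < norm z" using qz \<open>0 < cos s\<close> by auto
  ultimately have "q \<bullet> z \<le> q \<bullet> z / norm z" using qz \<open>0 < cos s\<close>
    by (simp add: pos_le_divide_eq mult_left_le)
  also have "\<dots> = q \<bullet> y" by (simp add: yz sgn_div_norm divide_inverse_commute)
  finally show ?thesis using qz \<open>cos s' < cos s\<close> D(10) y(1) by auto
qed

text \<open>
  The minimisers belonging to two balls lie in both balls, so they compete with each other.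
\<close>
lemma mean_in_independent:
  assumes "inside p r r'" "mean_in p r' y" "inside q s s'"
  shows "mean_in q s' y"
proof -
  obtain z where z: "mean_in q s' z" using ex_mean_in[OF assms(3)] by blast
  have "z \<in> sball p r'" "y \<in> sball q s'" using mean_in_other_ball assms z by blast+
  moreover have "spread y \<le> spread z"
    using assms(2) \<open>z \<in> sball p r'\<close> by (simp add: mean_in_def is_arg_min_linorder)
  ultimately show ?thesis using z by (auto simp: mean_in_def is_arg_min_linorder)
qed

end

section \<open>Radial projection of convex combinations\<close>

text \<open>
  Radial projection onto the unit sphere, restricted to the complement of a ball of radius
  $\rho$, is Lipschitz with constant $1/\rho$.
\<close>
lemma norm_sgn_diff_le:
  fixes a b :: "'a::real_inner"
  assumes "\<rho> \<le> norm a" "\<rho> \<le> norm b" "0 < \<rho>"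
  shows "norm (sgn a - sgn b) \<le> norm (a - b) / \<rho>"
proof -
  define k where "k = sgn a \<bullet> sgn b"
  have pos: "0 < norm a" "0 < norm b" using assms by linarith+
  have n: "norm (sgn a) = 1" "norm (sgn b) = 1" using pos by (auto simp: norm_sgn)
  then have k1: "k \<le> 1" using Cauchy_Schwarz_ineq2[of "sgn a" "sgn b"] by (simp add: k_def)
  have s: "(norm (sgn a - sgn b))\<^sup>2 = 2 - 2 * k"
    using n by (simp add: power2_norm_eq_inner norm_eq_1 inner_diff_left inner_diff_right
        inner_commute k_def)
  have ab: "a \<bullet> b = norm a * norm b * k"
    using pos by (simp add: k_def sgn_div_norm field_simps)
  have "(norm (a - b))\<^sup>2 = (norm a)\<^sup>2 + (norm b)\<^sup>2 - 2 * (a \<bullet> b)"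
    by (simp add: power2_norm_eq_inner inner_diff_left inner_diff_right inner_commute)
  also have "\<dots> = (norm a - norm b)\<^sup>2 + norm a * norm b * (2 - 2 * k)"
    by (simp add: ab power2_eq_square algebra_simps)
  also have "\<dots> \<ge> \<rho> * \<rho> * (2 - 2 * k)"
    using mult_mono[of \<rho> "norm a" \<rho> "norm b"] assms k1
      mult_right_mono[of "\<rho> * \<rho>" "norm a * norm b" "2 - 2 * k"]
      zero_le_power2[of "norm a - norm b"] by linarith
  finally have "(\<rho> * norm (sgn a - sgn b))\<^sup>2 \<le> (norm (a - b))\<^sup>2"
    by (simp add: power_mult_distrib s power2_eq_square[of \<rho>])
  then have "\<rho> * norm (sgn a - sgn b) \<le> norm (a - b)" by (rule power2_le_imp_le) simp
  then show ?thesis using assms(3) by (simp add: field_simps)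
qed

text \<open>
  The middle coefficient is determined by the outer two, as the coefficients sum to 1.
\<close>
definition comb3 :: "real \<Rightarrow> real \<Rightarrow> 'a::real_vector \<Rightarrow> 'a \<Rightarrow> 'a \<Rightarrow> 'a" where
  "comb3 b c u v w = b *\<^sub>R u + (1 - b - c) *\<^sub>R v + c *\<^sub>R w"

lemma comb3_commute: "comb3 b c u v w = comb3 c b w v u"
  by (simp add: comb3_def algebra_simps)

lemma comb3_eq_offset: "comb3 b c u v w = v + b *\<^sub>R (u - v) + c *\<^sub>R (w - v)"
  by (simp add: comb3_def algebra_simps)

text \<open>
  For a convex combination of unit vectors the defect of the squared norm from 1 is the weighted
  variance of the points.
\<close>
lemma norm_sq_comb3:
  fixes u v w :: "'a::real_inner"
  assumes "norm u = 1" "norm v = 1" "norm w = 1"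
  shows "(norm (comb3 b c u v w))\<^sup>2 =
    1 - (b * (1 - b - c) * (norm (u - v))\<^sup>2 + c * (1 - b - c) * (norm (v - w))\<^sup>2
         + b * c * (norm (u - w))\<^sup>2)"
  using assms
  by (simp add: comb3_def norm_eq_1 power2_norm_eq_inner inner_add_left inner_add_right
      inner_diff_left inner_diff_right inner_commute) (simp add: algebra_simps)

text \<open>
  Three consecutive data points, in the role of those that determine a new point of even index.
\<close>
locale unit_triple =
  fixes u v w :: "'a::real_inner" and d :: real
  assumes unit: "norm u = 1" "norm v = 1" "norm w = 1"
    and close: "norm (u - v) \<le> d" "norm (v - w) \<le> d" and d: "d \<le> 0.6"
begin

lemma swap: "unit_triple w v u d"
  using unit close d by unfold_locales (simp_all add: norm_minus_commute)

lemma d_nonneg: "0 \<le> d"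
  using close(1) norm_ge_zero order_trans by blast

lemma far: "norm (u - w) \<le> 2 * d"
  using norm_triangle_ineq[of "u - v" "v - w"] close by simp

lemma sq_close: "(norm (u - v))\<^sup>2 \<le> d\<^sup>2" "(norm (v - w))\<^sup>2 \<le> d\<^sup>2" "(norm (u - w))\<^sup>2 \<le> 4 * d\<^sup>2"
  using power_mono[OF close(1), of 2] power_mono[OF close(2), of 2] power_mono[OF far, of 2]
  by (simp_all add: power_mult_distrib)

lemma comb3_norm:
  assumes "0 \<le> b" "b \<le> 1 / 4" "0 \<le> c" "c \<le> 1 / 4"
  shows "1 - d\<^sup>2 / 2 \<le> norm (comb3 b c u v w)" "norm (comb3 b c u v w) \<le> 1"
    "9 / 10 \<le> norm (comb3 b c u v w)"
proof -
  define n where "n = norm (comb3 b c u v w)"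
  define N where "N = b * (1 - b - c) * (norm (u - v))\<^sup>2 + c * (1 - b - c) * (norm (v - w))\<^sup>2
         + b * c * (norm (u - w))\<^sup>2"
  have n2: "n\<^sup>2 = 1 - N" using norm_sq_comb3[OF unit] by (simp add: n_def N_def)
  have N0: "0 \<le> N" using assms by (simp add: N_def)
  have "N \<le> b * (1 - b - c) * d\<^sup>2 + c * (1 - b - c) * d\<^sup>2 + b * c * (4 * d\<^sup>2)"
    unfolding N_def using assms sq_close by (intro add_mono mult_left_mono) auto
  also have "\<dots> = (b + c - (b - c)\<^sup>2) * d\<^sup>2" by (simp add: algebra_simps power2_eq_square)
  also have "\<dots> \<le> (1 / 2) * d\<^sup>2"
  proof (rule mult_right_mono)
    show "b + c - (b - c)\<^sup>2 \<le> 1 / 2"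
      using assms zero_le_power2[of "b - c"] by linarith
  qed simp
  finally have N: "N \<le> d\<^sup>2 / 2" by simp
  have "n \<le> 1" using n2 N0 by (intro power2_le_imp_le[of n]) auto
  moreover have "n\<^sup>2 \<le> n" using \<open>n \<le> 1\<close> by (simp add: power2_eq_square mult_left_le n_def)
  moreover have "9 / 10 \<le> n"
  proof (rule power2_le_imp_le)
    have "d\<^sup>2 \<le> 0.36" using power_mono[OF d d_nonneg, of 2] by (simp add: power2_eq_square)
    then show "(9 / 10)\<^sup>2 \<le> n\<^sup>2" using n2 N by (simp add: power2_eq_square)
  qed (simp add: n_def)
  ultimately show "1 - d\<^sup>2 / 2 \<le> norm (comb3 b c u v w)" "norm (comb3 b c u v w) \<le> 1"
    "9 / 10 \<le> norm (comb3 b c u v w)"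
    using n2 N by (auto simp: n_def)
qed

lemma sgn_comb3_near:
  assumes "0 \<le> b" "b \<le> 1 / 4" "0 \<le> c" "c \<le> 1 / 4"
  shows "sgn (comb3 b c u v w) - comb3 b c u v w
      = (1 - norm (comb3 b c u v w)) *\<^sub>R sgn (comb3 b c u v w)"
    and "norm (sgn (comb3 b c u v w) - v) \<le> d"
proof -
  define z where "z = comb3 b c u v w"
  note n = comb3_norm[OF assms, folded z_def]
  have "z = norm z *\<^sub>R sgn z" by (cases "z = 0") (simp_all add: sgn_div_norm)
  then have 1: "sgn z - z = (1 - norm z) *\<^sub>R sgn z" by (metis scaleR_left_diff_distrib scaleR_one)
  then show "sgn (comb3 b c u v w) - comb3 b c u v w
      = (1 - norm (comb3 b c u v w)) *\<^sub>R sgn (comb3 b c u v w)" by (simp add: z_def)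
  have "norm (sgn z) = 1" using n by (auto simp: norm_sgn)
  then have "norm (sgn z - z) \<le> d\<^sup>2 / 2" using n unfolding 1 by simp
  moreover have "d\<^sup>2 \<le> 0.6 * d" using mult_right_mono[OF d d_nonneg] by (simp add: power2_eq_square)
  moreover have "norm (z - v) \<le> d / 2"
  proof -
    have "z - v = b *\<^sub>R (u - v) + c *\<^sub>R (w - v)" by (simp add: z_def comb3_def algebra_simps)
    also have "norm \<dots> \<le> b * norm (u - v) + c * norm (w - v)"
      using norm_triangle_ineq[of "b *\<^sub>R (u - v)" "c *\<^sub>R (w - v)"] assms by simp
    also have "\<dots> \<le> 1 / 4 * d + 1 / 4 * d"
      using assms close by (intro add_mono mult_mono) (auto simp: norm_minus_commute)
    finally show ?thesis by simp
  qed
  ultimately show "norm (sgn (comb3 b c u v w) - v) \<le> d"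
    using norm_triangle_ineq[of "sgn z - z" "z - v"] d_nonneg by (simp add: z_def)
qed

text \<open>
  The two convex combinations differ by at most $3d/4$, and radial projection of points of norm at
  least $9/10$ stretches this by at most $10/9$.
\<close>
lemma sgn_comb3_midpoint_contraction:
  assumes "0 \<le> b" "b \<le> 1 / 4" "0 \<le> c" "c \<le> 1 / 4"
  shows "norm (sgn (v + w) - sgn (comb3 b c u v w)) \<le> 5 / 6 * d"
proof -
  define m where "m = (1 / 2) *\<^sub>R (v + w)"
  define z where "z = comb3 b c u v w"
  have mz: "m - z = b *\<^sub>R (v - u) + (1 / 2 - c) *\<^sub>R (w - v)"
  proof -
    have "m - z - (b *\<^sub>R (v - u) + (1 / 2 - c) *\<^sub>R (w - v)) = (1 / 2) *\<^sub>R (v + w - w + v) - v"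
      by (simp add: m_def z_def comb3_def algebra_simps)
    also have "\<dots> = 0" by (simp add: scaleR_2[symmetric])
    finally show ?thesis by simp
  qed
  also have "norm \<dots> \<le> b * norm (v - u) + (1 / 2 - c) * norm (w - v)"
    using norm_triangle_ineq[of "b *\<^sub>R (v - u)" "(1 / 2 - c) *\<^sub>R (w - v)"] assms by simp
  also have "\<dots> \<le> 1 / 4 * d + 1 / 2 * d"
    using assms close by (intro add_mono mult_mono) (auto simp: norm_minus_commute)
  finally have "norm (m - z) \<le> 3 / 4 * d" by simp
  moreover have "9 / 10 \<le> norm m"
  proof (rule power2_le_imp_le)
    have "(norm (v + w))\<^sup>2 = 4 - (norm (v - w))\<^sup>2"
      using unit by (simp add: norm_eq_1 power2_norm_eq_inner inner_add_left inner_add_right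
          inner_diff_left inner_diff_right inner_commute)
    moreover have "d\<^sup>2 \<le> 0.36" using power_mono[OF d d_nonneg, of 2] by (simp add: power2_eq_square)
    moreover have "(norm m)\<^sup>2 = (norm (v + w))\<^sup>2 / 4"
      by (simp add: m_def power_mult_distrib power_divide)
    ultimately show "(9 / 10)\<^sup>2 \<le> (norm m)\<^sup>2"
      using sq_close(2) by (simp add: power2_eq_square)
  qed simp
  ultimately have "norm (sgn m - sgn z) \<le> (3 / 4 * d) / (9 / 10)"
    using norm_sgn_diff_le[of "9 / 10" m z] comb3_norm(3)[OF assms]
    by (simp add: z_def field_simps)
  then show ?thesis by (simp add: m_def z_def sgn_scaleR)
qed

text \<open>
  The projection moves the combination by $1 - n$ in the radial direction, where $n$ is its norm.
  To leading order $1 - n$ is half the weighted variance of the points with weights $1/8, 6/8, 1/8$.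
  By the parallelogram law this variance is $|u-v|^2/8 + |v-w|^2/8 - |u-2v+w|^2/64$, so
  half of it is $|v-w|^2/8$ up to an error $ds$. Replacing the radial direction by v, and the weights
  b and c by $1/8$, costs $O(d^3)$.
\<close>
lemma sgn_comb3_defect:
  assumes "0 \<le> b" "b \<le> 1 / 4" "0 \<le> c" "c \<le> 1 / 4"
    and "\<bar>b - 1 / 8\<bar> \<le> 2 * d\<^sup>2" "\<bar>c - 1 / 8\<bar> \<le> 2 * d\<^sup>2"
    and s: "norm (u - 2 *\<^sub>R v + w) \<le> s"
  shows "norm (sgn (comb3 b c u v w) - comb3 (1 / 8) (1 / 8) u v w
               - ((norm (v - w))\<^sup>2 / 8) *\<^sub>R v) \<le> 7 * d ^ 3 + d * s"
proof -
  define z where "z = comb3 b c u v w"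
  define n where "n = norm z"
  define A B C S where "A = (norm (u - v))\<^sup>2" and "B = (norm (v - w))\<^sup>2"
    and "C = (norm (u - w))\<^sup>2" and "S = norm (u - 2 *\<^sub>R v + w)"
  define \<beta> \<gamma> where "\<beta> = b - 1 / 8" and "\<gamma> = c - 1 / 8"
  note n = comb3_norm[OF assms(1-4), folded z_def, folded n_def]
  have ABC: "0 \<le> A" "0 \<le> B" "0 \<le> C" "A \<le> d\<^sup>2" "B \<le> d\<^sup>2" "C \<le> 4 * d\<^sup>2"
    using sq_close by (auto simp: A_def B_def C_def)
  have S: "0 \<le> S" "S \<le> s" "S \<le> 2 * d"
  proof -
    have "u - 2 *\<^sub>R v + w = (u - v) - (v - w)" by (simp add: scaleR_2)
    then have "S = norm ((u - v) - (v - w))" by (simp only: S_def)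
    then show "S \<le> 2 * d"
      using norm_triangle_ineq4[of "u - v" "v - w"] close by linarith
  qed (use s in \<open>auto simp: S_def\<close>)
  have d4: "d\<^sup>2 * d\<^sup>2 \<le> 0.6 * d ^ 3"
  proof -
    have "d * d ^ 3 \<le> 0.6 * d ^ 3" using d d_nonneg by (intro mult_right_mono) auto
    then show ?thesis by (simp add: power2_eq_square power3_eq_cube mult.assoc)
  qed
  have d3: "0 \<le> d ^ 3" using d_nonneg by simp
  have parallelogram: "C = 2 * A + 2 * B - S\<^sup>2"
    by (simp add: A_def B_def C_def S_def power2_norm_eq_inner inner_add_left inner_add_right
          inner_diff_left inner_diff_right inner_commute)
  have "\<bar>A - B\<bar> \<le> 2 * (d * S)"
  proof -
    have "A - B = (norm (u - v) + norm (v - w)) * (norm (u - v) - norm (v - w))"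
      by (simp add: A_def B_def power2_eq_square algebra_simps)
    moreover have "\<bar>norm (u - v) - norm (v - w)\<bar> \<le> S"
      using norm_triangle_ineq3[of "u - v" "v - w"] by (simp add: S_def scaleR_2 algebra_simps)
    moreover have "norm (u - v) + norm (v - w) \<le> 2 * d" using close by simp
    ultimately have "\<bar>A - B\<bar> \<le> (2 * d) * S"
      using d_nonneg by (simp only: abs_mult) (intro mult_mono, auto)
    then show ?thesis by simp
  qed
  moreover have "S\<^sup>2 \<le> 2 * (d * S)" using mult_right_mono[OF S(3,1)] by (simp add: power2_eq_square)
  moreover have "d * S \<le> d * s" using S d_nonneg by (simp add: mult_left_mono)
  ultimately have part3: "\<bar>(6 / 64 * (A + B) + C / 64) / 2 - B / 8\<bar> \<le> d * s"
  proof -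
    assume *: "\<bar>A - B\<bar> \<le> 2 * (d * S)" "S\<^sup>2 \<le> 2 * (d * S)" "d * S \<le> d * s"
    have "(6 / 64 * (A + B) + C / 64) / 2 - B / 8 = (A - B) / 16 - S\<^sup>2 / 128"
      using parallelogram by (simp add: field_simps)
    moreover have "\<bar>X / 16 - R / 128\<bar> \<le> Q"
      if "\<bar>X\<bar> \<le> 2 * P" "R \<le> 2 * P" "P \<le> Q" "0 \<le> P" "0 \<le> R" for X R P Q :: real
      using that by linarith
    ultimately show ?thesis
      using * mult_nonneg_nonneg[OF d_nonneg S(1)] zero_le_power2[of S] by metis
  qed
  have part1: "\<bar>(1 - n) - (1 - n\<^sup>2) / 2\<bar> \<le> 0.1 * d ^ 3"
  proof -
    have "(1 - n) - (1 - n\<^sup>2) / 2 = (1 - n)\<^sup>2 / 2" by (simp add: power2_eq_square field_simps)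
    moreover have "(1 - n)\<^sup>2 \<le> (d\<^sup>2 / 2)\<^sup>2" using n by (intro power_mono) auto
    moreover have "(d\<^sup>2 / 2)\<^sup>2 = d\<^sup>2 * d\<^sup>2 / 4" by (simp add: power2_eq_square)
    ultimately show ?thesis using d4 d3 zero_le_power2[of "1 - n"] by linarith
  qed
  have part2: "\<bar>(1 - n\<^sup>2) - (6 / 64 * (A + B) + C / 64)\<bar> \<le> 4.8 * d ^ 3"
  proof -
    have bg: "\<bar>\<beta>\<bar> \<le> 2 * d\<^sup>2" "\<bar>\<gamma>\<bar> \<le> 2 * d\<^sup>2" "\<bar>\<beta>\<bar> \<le> 1 / 8" "\<bar>\<gamma>\<bar> \<le> 1 / 8"
      using assms(1-6) unfolding \<beta>_def \<gamma>_def by linarith+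
    have prods: "\<bar>\<beta> * \<beta>\<bar> \<le> 1 / 4 * d\<^sup>2" "\<bar>\<beta> * \<gamma>\<bar> \<le> 1 / 4 * d\<^sup>2" "\<bar>\<gamma> * \<gamma>\<bar> \<le> 1 / 4 * d\<^sup>2"
      using mult_mono[OF bg(3,1)] mult_mono[OF bg(3,2)] mult_mono[OF bg(4,2)]
      by (simp_all add: abs_mult)
    define e1 e2 e3 where "e1 = \<beta> * (6 / 8) - \<beta> / 8 - \<gamma> / 8 - \<beta> * \<beta> - \<beta> * \<gamma>"
      and "e2 = \<gamma> * (6 / 8) - \<beta> / 8 - \<gamma> / 8 - \<gamma> * \<gamma> - \<beta> * \<gamma>"
      and "e3 = \<beta> / 8 + \<gamma> / 8 + \<beta> * \<gamma>"
    note bounds = bg(1,2)[THEN abs_le_D1] bg(1,2)[THEN abs_le_D2] prods[THEN abs_le_D1] prods[THEN abs_le_D2]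
    have e: "\<bar>e1\<bar> \<le> 2.5 * d\<^sup>2"
      unfolding e1_def by (rule abs_leI) (use bounds in linarith)+
    have e': "\<bar>e2\<bar> \<le> 2.5 * d\<^sup>2"
      unfolding e2_def by (rule abs_leI) (use bounds in linarith)+
    have e'': "\<bar>e3\<bar> \<le> 3 / 4 * d\<^sup>2"
      unfolding e3_def by (rule abs_leI) (use bounds in linarith)+
    have "(1 - n\<^sup>2) = b * (1 - b - c) * A + c * (1 - b - c) * B + b * c * C"
      using norm_sq_comb3[OF unit] by (simp add: n_def z_def A_def B_def C_def)
    also have "b = 1 / 8 + \<beta>" by (simp add: \<beta>_def)
    also have "c = 1 / 8 + \<gamma>" by (simp add: \<gamma>_def)
    finally have "(1 - n\<^sup>2) - (6 / 64 * (A + B) + C / 64) = e1 * A + e2 * B + e3 * C"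
      by (simp add: e1_def e2_def e3_def field_simps)
    also have "\<bar>\<dots>\<bar> \<le> \<bar>e1\<bar> * A + \<bar>e2\<bar> * B + \<bar>e3\<bar> * C"
      using ABC(1-3) abs_triangle_ineq[of "e1 * A + e2 * B" "e3 * C"]
        abs_triangle_ineq[of "e1 * A" "e2 * B"] by (simp add: abs_mult)
    also have "\<dots> \<le> (2.5 * d\<^sup>2) * d\<^sup>2 + (2.5 * d\<^sup>2) * d\<^sup>2 + (3 / 4 * d\<^sup>2) * (4 * d\<^sup>2)"
      using e e' e'' ABC by (intro add_mono mult_mono) auto
    also have "\<dots> = 8 * (d\<^sup>2 * d\<^sup>2)" by simp
    finally show ?thesis using d4 by linarith
  qed
  have "\<bar>(1 - n) - B / 8\<bar> \<le> 2.5 * d ^ 3 + d * s"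
  proof -
    define N M where "N = 6 / 64 * (A + B) + C / 64" and "M = 1 - n\<^sup>2"
    show ?thesis
      using part1 part2 part3 unfolding N_def[symmetric] M_def[symmetric] by linarith
  qed
  moreover have "norm (sgn z) = 1" using n by (auto simp: norm_sgn n_def)
  ultimately have t1: "norm (((1 - n) - B / 8) *\<^sub>R sgn z) \<le> 2.5 * d ^ 3 + d * s" by simp
  have t2: "norm ((B / 8) *\<^sub>R (sgn z - v)) \<le> d ^ 3 / 8"
    using mult_mono[of B "d\<^sup>2" "norm (sgn z - v)" d] ABC(2,5) sgn_comb3_near(2)[OF assms(1-4)]
    by (simp add: z_def power3_eq_cube power2_eq_square)
  have t3: "norm (z - comb3 (1 / 8) (1 / 8) u v w) \<le> 4 * d ^ 3"
  proof -
    have "z - comb3 (1 / 8) (1 / 8) u v w = \<beta> *\<^sub>R (u - v) + \<gamma> *\<^sub>R (w - v)"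
      by (simp add: z_def comb3_eq_offset \<beta>_def \<gamma>_def algebra_simps)
    also have "norm \<dots> \<le> \<bar>\<beta>\<bar> * norm (u - v) + \<bar>\<gamma>\<bar> * norm (w - v)"
      using norm_triangle_ineq[of "\<beta> *\<^sub>R (u - v)" "\<gamma> *\<^sub>R (w - v)"] by simp
    also have "\<dots> \<le> (2 * d\<^sup>2) * d + (2 * d\<^sup>2) * d"
      using assms(5,6) close
      by (intro add_mono mult_mono) (auto simp: \<beta>_def \<gamma>_def norm_minus_commute)
    finally show ?thesis by (simp add: power3_eq_cube power2_eq_square)
  qed
  have "sgn z - comb3 (1 / 8) (1 / 8) u v w - (B / 8) *\<^sub>R v
      = ((1 - n) - B / 8) *\<^sub>R sgn z + (B / 8) *\<^sub>R (sgn z - v) + (z - comb3 (1 / 8) (1 / 8) u v w)"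
    using sgn_comb3_near(1)[OF assms(1-4), folded z_def, folded n_def]
    by (simp add: algebra_simps)
  then have "norm (sgn z - comb3 (1 / 8) (1 / 8) u v w - (B / 8) *\<^sub>R v)
     \<le> (2.5 * d ^ 3 + d * s) + d ^ 3 / 8 + 4 * d ^ 3"
    using t1 t2 t3 norm_triangle_le norm_add_leD by (metis (no_types, lifting) add_mono norm_triangle_mono)
  then show ?thesis using d3 unfolding z_def[symmetric] B_def[symmetric] by linarith
qed

end

text \<open>
  For the midpoint $1 - n$ is $|v-w|^2/8$ up to $O(d^4)$, the same leading term as for the combination
  of three points.
\<close>
lemma sgn_midpoint_defect:
  fixes v w :: "'a::real_inner"
  assumes "norm v = 1" "norm w = 1" "norm (v - w) \<le> d" "d \<le> 0.6"
  shows "norm (sgn (v + w) - v) \<le> d"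
    and "norm (sgn (v + w) - (1 / 2) *\<^sub>R (v + w) - ((norm (v - w))\<^sup>2 / 8) *\<^sub>R v) \<le> d ^ 3"
proof -
  define m where "m = (1 / 2) *\<^sub>R (v + w)"
  define n where "n = norm m"
  define B where "B = (norm (v - w))\<^sup>2"
  have d0: "0 \<le> d" using assms(3) norm_ge_zero order_trans by blast
  have B: "0 \<le> B" "B \<le> d\<^sup>2" using power_mono[OF assms(3), of 2] by (auto simp: B_def)
  have "d\<^sup>2 \<le> 0.6 * d" using mult_right_mono[OF assms(4) d0] by (simp add: power2_eq_square)
  have d4: "d\<^sup>2 * d\<^sup>2 \<le> 0.6 * d ^ 3"
  proof -
    have "d * d ^ 3 \<le> 0.6 * d ^ 3" using assms d0 by (intro mult_right_mono) auto
    then show ?thesis by (simp add: power2_eq_square power3_eq_cube mult.assoc)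
  qed
  have n2: "n\<^sup>2 = 1 - B / 4"
    using assms(1,2) by (simp add: n_def m_def B_def power_mult_distrib power_divide norm_eq_1
        power2_norm_eq_inner inner_add_left inner_add_right inner_diff_left inner_diff_right
        inner_commute field_simps)
  have "n \<le> 1" using n2 B by (intro power2_le_imp_le[of n]) auto
  moreover have "0 \<le> n" by (simp add: n_def)
  ultimately have "n\<^sup>2 \<le> n" by (simp add: power2_eq_square mult_left_le)
  then have n: "1 - n \<le> B / 4" using n2 by simp
  have npos: "0 < n" using n B \<open>d\<^sup>2 \<le> 0.6 * d\<close> assms(4) by linarith
  then have "norm (sgn m) = 1" by (auto simp: norm_sgn n_def)
  have "m = n *\<^sub>R sgn m" using npos by (simp add: sgn_div_norm n_def)
  then have 1: "sgn m - m = (1 - n) *\<^sub>R sgn m" by (metis scaleR_left_diff_distrib scaleR_one)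
  have mv: "m - v = (1 / 2) *\<^sub>R (w - v)"
  proof -
    have "m - v - (1 / 2) *\<^sub>R (w - v) = (1 / 2) *\<^sub>R (v + v) - v"
      by (simp add: m_def algebra_simps)
    also have "\<dots> = 0" by (simp add: scaleR_2[symmetric])
    finally show ?thesis by simp
  qed
  have sm: "sgn (v + w) = sgn m" by (simp add: m_def sgn_scaleR)
  have "norm (sgn m - v) \<le> norm (sgn m - m) + norm (m - v)"
    using norm_triangle_ineq[of "sgn m - m" "m - v"] by simp
  also have "\<dots> \<le> B / 4 + d / 2"
    unfolding 1 mv using n \<open>n \<le> 1\<close> \<open>norm (sgn m) = 1\<close> assms(3)
    by (simp add: norm_minus_commute)
  also have "\<dots> \<le> d" using B \<open>d\<^sup>2 \<le> 0.6 * d\<close> d0 by linarith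
  finally show near: "norm (sgn (v + w) - v) \<le> d" by (simp add: sm)
  have "(1 - n) - B / 8 = (1 - n)\<^sup>2 / 2" using n2 by (simp add: power2_eq_square algebra_simps)
  moreover have "(1 - n)\<^sup>2 \<le> (d\<^sup>2 / 4)\<^sup>2" using n B \<open>n \<le> 1\<close> by (intro power_mono) auto
  moreover have "(d\<^sup>2 / 4)\<^sup>2 = d\<^sup>2 * d\<^sup>2 / 16" by (simp add: power2_eq_square)
  ultimately have "\<bar>(1 - n) - B / 8\<bar> \<le> d ^ 3 / 2" using d4 zero_le_power[OF d0, of 3] zero_le_power2[of "1 - n"]
    by linarith
  then have t1: "norm (((1 - n) - B / 8) *\<^sub>R sgn m) \<le> d ^ 3 / 2"
    using \<open>norm (sgn m) = 1\<close> by simp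
  have t2: "norm ((B / 8) *\<^sub>R (sgn m - v)) \<le> d ^ 3 / 8"
    using mult_mono[of B "d\<^sup>2" "norm (sgn m - v)" d] B near
    by (simp add: sm power3_eq_cube power2_eq_square)
  have "sgn m - m - (B / 8) *\<^sub>R v = ((1 - n) - B / 8) *\<^sub>R sgn m + (B / 8) *\<^sub>R (sgn m - v)"
    using 1 by (simp add: algebra_simps)
  then have "norm (sgn m - m - (B / 8) *\<^sub>R v) \<le> d ^ 3 / 2 + d ^ 3 / 8"
    using t1 t2 by (metis norm_triangle_mono)
  then show "norm (sgn (v + w) - (1 / 2) *\<^sub>R (v + w) - ((norm (v - w))\<^sup>2 / 8) *\<^sub>R v) \<le> d ^ 3"
    using zero_le_power[OF d0, of 3] unfolding sm m_def[symmetric] B_def[symmetric] by linarith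
qed

section \<open>One step of the cubic scheme on the sphere\<close>

text \<open>
  For $\theta \le \pi/2$ one has $\theta/2 \le \sin\theta$, and $\sin\theta$ is the distance of y from
  the line spanned by x, hence at most the chord.
\<close>
lemma sdist_le_twice_norm:
  fixes y x :: "'a::euclidean_space"
  assumes "norm y = 1" "norm x = 1" "0 \<le> y \<bullet> x"
  shows "sdist y x \<le> 2 * norm (y - x)"
proof -
  have t: "\<bar>y \<bullet> x\<bar> \<le> 1" using abs_inner_unit_le assms by blast
  have r: "0 \<le> sdist y x" "sdist y x \<le> pi / 2"
    using t assms(3) arccos_le_mono[of 0 "y \<bullet> x"] arccos_lbound
    by (auto simp: sdist_def abs_le_iff)
  have "sdist y x / 2 \<le> sin (sdist y x)" using half_le_sin r by blast
  also have "\<dots> = sqrt (1 - (y \<bullet> x)\<^sup>2)" using t by (simp add: sdist_def sin_arccos_abs)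
  also have "\<dots> \<le> norm (y - x)"
  proof (rule real_le_lsqrt)
    have "(norm (y - x))\<^sup>2 = 2 - 2 * (y \<bullet> x)"
      using assms by (simp add: norm_eq_1 power2_norm_eq_inner inner_diff_left inner_diff_right
          inner_commute)
    moreover have "0 \<le> (1 - y \<bullet> x)\<^sup>2" by simp
    ultimately show "1 - (y \<bullet> x)\<^sup>2 \<le> (norm (y - x))\<^sup>2"
      by (simp add: power2_eq_square algebra_simps)
  qed auto
  finally show ?thesis by simp
qed

text \<open>
  For a nonnegative mask the admissible balls are those of radius less than $\pi/4$, for which existence,
  uniqueness and independence of the ball are known.
\<close>
lemma riem_value_nonneg_mask:
  fixes x :: "int \<Rightarrow> 'a::euclidean_space" and a i
  defines "J \<equiv> {j. a (i - 2 * j) \<noteq> 0}" and "A \<equiv> \<lambda>j. a (i - 2 * j)"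
  assumes "finite J" "J \<noteq> {}" and nonneg: "\<And>m. 0 \<le> a m" and adm: "admissible a x i p r r'"
  obtains y where "weighted_points.inside J x p r r'" "weighted_points.mean_in J A x p r' y"
    "riem_value a x i y" "riem_analogue a x i = y"
proof -
  interpret weighted_points J A x
    using assms by unfold_locales (auto simp: J_def A_def order_less_le)
  have e: "energy a x i = spread" 
    by (rule ext) (simp only: energy_def spread_def, simp only: J_def A_def)
  have "{j. a (i - 2 * j) < 0} = {}" using nonneg by (auto simp: not_less)
  then have "neg_weight a i = 0" by (simp add: neg_weight_def)
  then have ins: "inside q s s'" if "admissible a x i q s s'" for q s s'
    using that unfolding inside_def by (auto simp: admissible_def J_def)
  obtain y where y: "mean_in p r' y" using ex_mean_in ins adm by blast
  have "is_arg_min (energy a x i) (\<lambda>w. w \<in> sball q s') z \<longleftrightarrow> z = y"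
    if "admissible a x i q s s'" for q s s' z
    using mean_in_unique[OF ins[OF that]] mean_in_independent[OF ins[OF adm] y ins[OF that]]
    unfolding e mean_in_def by blast
  then have v: "riem_value a x i y" using adm unfolding riem_value_def by blast
  moreover have "y' = y" if "riem_value a x i y'" for y'
    using v that adm unfolding riem_value_def by blast
  ultimately have "riem_analogue a x i = y" unfolding riem_analogue_def by blast
  then show ?thesis using that ins[OF adm] y v by blast
qed

definition near_chain :: "(int \<Rightarrow> 'a::real_inner) \<Rightarrow> real \<Rightarrow> bool" where
  "near_chain x d \<longleftrightarrow> (\<forall>i. norm (x i) = 1 \<and> norm (x (i + 1) - x i) \<le> d) \<and> d \<le> 0.6"

lemma near_chainD:
  assumes "near_chain x d"
  shows "norm (x i) = 1" "norm (x (i + 1) - x i) \<le> d" "d \<le> 0.6" "0 \<le> d"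
  using assms order_trans[OF norm_ge_zero, of "x (i + 1) - x i" d] unfolding near_chain_def by auto

lemma near_chain_triple:
  assumes "near_chain x d"
  shows "unit_triple (x (i - 1)) (x i) (x (i + 1)) d"
  using near_chainD[OF assms] near_chainD(2)[OF assms, of "i - 1"]
  by unfold_locales (simp_all add: norm_minus_commute)

lemma cubic_admissible:
  fixes x :: "int \<Rightarrow> 'a::euclidean_space"
  assumes "near_chain x d" "k = 2 * i \<or> k = 2 * i + 1"
  shows "admissible cubic_mask x k (x i) (arccos 0.8) (arccos 0.75)"
proof -
  note D = near_chainD[OF assms(1)]
  have "x j \<in> sball (x i) (arccos 0.8)" if "cubic_mask (k - 2 * j) \<noteq> 0" for j
  proof -
    have "j \<in> {i - 1, i, i + 1}"
      using that assms(2) cubic_mask_even_support[of i] cubic_mask_odd_support[of i] by blast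
    then have n: "norm (x j - x i) \<le> 0.6"
      using D(2)[of i] D(2)[of "i - 1"] D(3) by (auto simp: norm_minus_commute)
    have "(norm (x j - x i))\<^sup>2 = 2 - 2 * (x i \<bullet> x j)"
      using D(1) by (simp add: norm_eq_1 power2_norm_eq_inner inner_diff_left inner_diff_right
          inner_commute)
    moreover have "(norm (x j - x i))\<^sup>2 \<le> 0.6\<^sup>2" using n by (intro power_mono) auto
    ultimately have "0.8 < x i \<bullet> x j" by (simp add: power2_eq_square)
    then have "arccos (x i \<bullet> x j) < arccos 0.8"
      using abs_inner_unit_le[of "x i" "x j"] D(1) by (intro arccos_less_arccos) auto
    then show ?thesis using D(1) by (simp add: sball_def sdist_def)
  qed
  moreover have "neg_weight cubic_mask k = 0"
  proof -
    have "{j. cubic_mask (k - 2 * j) < 0} = {}" by (auto simp: cubic_mask_def)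
    then show ?thesis by (simp add: neg_weight_def)
  qed
  \<comment> \<open>Chords of length at most 0.6 have inner product at least 0.82. The numbers 0.8 and 0.75 leave
    room between this and the inner product $\sqrt 2/2$ of points at distance $\pi/4$.\<close>
  moreover have "arccos 0.8 < arccos (0.75 :: real)" by (rule arccos_less_arccos) auto
  moreover have "arccos (0.75 :: real) < pi / 4"
  proof -
    have "(sqrt 2 / 2)\<^sup>2 < (0.75 :: real)\<^sup>2" by (simp add: power_divide power2_eq_square)
    then have "sqrt 2 / 2 < (0.75 :: real)" by (rule power_less_imp_less_base) simp
    moreover have "0 \<le> sqrt (2 :: real)" by simp
    then have "- 1 \<le> sqrt (2 :: real) / 2" by linarith
    ultimately have "arccos (0.75 :: real) < arccos (cos (pi / 4))"
      by (intro arccos_less_arccos) (auto simp: cos_45)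
    then show ?thesis by (subst (asm) arccos_cos) auto
  qed
  ultimately show ?thesis using D(1) by (auto simp: admissible_def)
qed

lemma cubic_mask_nonneg: "0 \<le> cubic_mask m"
  by (simp add: cubic_mask_def)

text \<open>
  The critical equation for two points with equal weights says that the two inverse exponentials are
  opposite. Their norms are the distances, which must therefore be equal.
\<close>
lemma riem_analogue_cubic_odd:
  fixes x :: "int \<Rightarrow> 'a::euclidean_space"
  assumes "near_chain x d"
  shows "riem_value cubic_mask x (2 * i + 1) (riem_analogue cubic_mask x (2 * i + 1))"
    and "riem_analogue cubic_mask x (2 * i + 1) = sgn (x i + x (i + 1))"
proof -
  define J where "J = {j. cubic_mask (2 * i + 1 - 2 * j) \<noteq> 0}"
  have J: "J = {i, i + 1}" by (simp add: J_def cubic_mask_odd_support)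
  define A where "A = (\<lambda>j. cubic_mask (2 * i + 1 - 2 * j))"
  have Ai: "A i = 1 / 2" "A (i + 1) = 1 / 2" by (simp_all add: A_def cubic_mask_def)
  obtain r r' y where
    ins: "weighted_points.inside J x (x i) r r'" and mean: "weighted_points.mean_in J A x (x i) r' y"
    and y: "riem_value cubic_mask x (2 * i + 1) y" "riem_analogue cubic_mask x (2 * i + 1) = y"
    using riem_value_nonneg_mask[OF _ _ cubic_mask_nonneg cubic_admissible[OF assms], of "2 * i + 1" i]
    unfolding J_def[symmetric] A_def[symmetric] J by auto
  then show "riem_value cubic_mask x (2 * i + 1) (riem_analogue cubic_mask x (2 * i + 1))" by simp
  interpret weighted_points J A x by unfold_locales (auto simp: J Ai)
  note R = mean_in_sdist_range[OF ins mean]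
  define v w where "v = x i" and "w = x (i + 1)"
  have u: "norm v = 1" "norm w = 1" "norm y = 1"
    using near_chainD(1)[OF assms] mean_in_norm[OF ins mean] by (auto simp: v_def w_def)
  define s t where "s = sdist y v" and "t = sdist y w"
  have st: "0 \<le> s" "s < pi / 2" "0 \<le> t" "t < pi / 2"
    using R by (auto simp: s_def t_def v_def w_def J)
  have bal: "arc_weight s *\<^sub>R (v - (y \<bullet> v) *\<^sub>R y) = - (arc_weight t *\<^sub>R (w - (y \<bullet> w) *\<^sub>R y))"
  proof -
    have "(1 / 2) *\<^sub>R (arc_weight s *\<^sub>R (v - (y \<bullet> v) *\<^sub>R y) + arc_weight t *\<^sub>R (w - (y \<bullet> w) *\<^sub>R y)) = 0"
      using mean_in_critical[OF ins mean] by (simp add: J Ai v_def w_def s_def t_def scaleR_add_right)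
    then show ?thesis by (simp add: eq_neg_iff_add_eq_0)
  qed
  have n: "norm (arc_weight (sdist y z) *\<^sub>R (z - (y \<bullet> z) *\<^sub>R y)) = sdist y z"
    if "norm z = 1" "0 \<le> sdist y z" "sdist y z < pi / 2" for z
  proof -
    have c: "\<bar>y \<bullet> z\<bar> \<le> 1" using abs_inner_unit_le u(3) that(1) by blast
    have "norm (z - (y \<bullet> z) *\<^sub>R y) = sqrt (1 - (y \<bullet> z)\<^sup>2)"
      using norm_tangential_part[OF that(1) u(3)] by (simp add: inner_commute)
    also have "\<dots> = sin (sdist y z)" using c by (simp add: sdist_def sin_arccos_abs)
    finally have "norm (z - (y \<bullet> z) *\<^sub>R y) = sin (sdist y z)" .
    moreover have "0 < sin (sdist y z)" if "sdist y z \<noteq> 0"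
      using that \<open>0 \<le> sdist y z\<close> \<open>sdist y z < pi / 2\<close> by (intro sin_gt_zero) auto
    ultimately show ?thesis using that(2) by (auto simp: arc_weight_def)
  qed
  have "s = t" using n[of v] n[of w] u st arg_cong[OF bal, of norm] by (simp add: s_def t_def)
  define W where "W = arc_weight s / 2 + arc_weight t / 2"
  have "0 < arc_weight s" using arc_weight_bounds(1)[OF st(1,2)] by simp
  then have "arc_weight s / 2 / W = 1 / 2" "arc_weight t / 2 / W = 1 / 2"
    using \<open>s = t\<close> by (simp_all add: W_def)
  then have "y = sgn ((1 / 2) *\<^sub>R v + (1 / 2) *\<^sub>R w)"
    using mean_in_eq_sgn(2)[OF ins mean]
    by (simp add: J Ai v_def[symmetric] w_def[symmetric] s_def[symmetric] t_def[symmetric]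
        W_def[symmetric])
  also have "\<dots> = sgn (v + w)" by (simp add: scaleR_add_right[symmetric] sgn_scaleR)
  finally show "riem_analogue cubic_mask x (2 * i + 1) = sgn (x i + x (i + 1))"
    using y by (simp add: v_def w_def)
qed

text \<open>
  The factors $\theta/\sin\theta$ lie between 1 and 2, which gives the first bounds on b and c. These
  show that the new point is within d of the middle point, so that the three distances are
  at most $4d$; then the factors are at most $1 + 16d^2$.
\<close>
lemma riem_analogue_cubic_even:
  fixes x :: "int \<Rightarrow> 'a::euclidean_space"
  assumes "near_chain x d"
  shows "riem_value cubic_mask x (2 * i) (riem_analogue cubic_mask x (2 * i))"
    and "\<exists>b c. 0 \<le> b \<and> b \<le> 1 / 4 \<and> 0 \<le> c \<and> c \<le> 1 / 4 \<and> \<bar>b - 1 / 8\<bar> \<le> 2 * d\<^sup>2 \<and> \<bar>c - 1 / 8\<bar> \<le> 2 * d\<^sup>2 \<and>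
          riem_analogue cubic_mask x (2 * i) = sgn (comb3 b c (x (i - 1)) (x i) (x (i + 1)))"
proof -
  define J where "J = {j. cubic_mask (2 * i - 2 * j) \<noteq> 0}"
  have J: "J = {i - 1, i, i + 1}" by (simp add: J_def cubic_mask_even_support)
  define A where "A = (\<lambda>j. cubic_mask (2 * i - 2 * j))"
  have Ai: "A (i - 1) = 1 / 8" "A i = 6 / 8" "A (i + 1) = 1 / 8"
    by (simp_all add: A_def cubic_mask_def)
  obtain r r' y where
    ins: "weighted_points.inside J x (x i) r r'" and mean: "weighted_points.mean_in J A x (x i) r' y"
    and y: "riem_value cubic_mask x (2 * i) y" "riem_analogue cubic_mask x (2 * i) = y"
    using riem_value_nonneg_mask[OF _ _ cubic_mask_nonneg cubic_admissible[OF assms], of "2 * i" i]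
    unfolding J_def[symmetric] A_def[symmetric] J by auto
  then show "riem_value cubic_mask x (2 * i) (riem_analogue cubic_mask x (2 * i))" by simp
  interpret weighted_points J A x by unfold_locales (auto simp: J Ai)
  define u v w where "u = x (i - 1)" and "v = x i" and "w = x (i + 1)"
  interpret unit_triple u v w d
    unfolding u_def v_def w_def by (rule near_chain_triple[OF assms])
  define f g h where "f = arc_weight (sdist y u)" and "g = arc_weight (sdist y v)"
    and "h = arc_weight (sdist y w)"
  note R = mean_in_sdist_range[OF ins mean]
  have fgh: "1 \<le> f" "f \<le> 2" "1 \<le> g" "g \<le> 2" "1 \<le> h" "h \<le> 2"
    using arc_weight_bounds R by (simp_all add: J f_def g_def h_def u_def v_def w_def)
  define W where "W = f / 8 + 6 / 8 * g + h / 8"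
  define b c where "b = f / 8 / W" and "c = h / 8 / W"
  have W1: "1 \<le> W" using fgh by (simp add: W_def)
  have sums: "1 - b - c = 6 / 8 * g / W"
  proof -
    have "1 - b - c = (W - f / 8 - h / 8) / W"
      using W1 by (simp add: b_def c_def diff_divide_distrib)
    then show ?thesis by (simp add: W_def)
  qed
  have bc: "0 \<le> b" "b \<le> 1 / 4" "0 \<le> c" "c \<le> 1 / 4"
    using fgh W1 by (auto simp: b_def c_def field_simps)
  have "y = sgn (\<Sum>j\<in>J. (A j * arc_weight (sdist y (x j)) / (\<Sum>j\<in>J. A j * arc_weight (sdist y (x j)))) *\<^sub>R x j)"
    by (rule mean_in_eq_sgn(2)[OF ins mean])
  also have "(\<Sum>j\<in>J. A j * arc_weight (sdist y (x j))) = W"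
    by (simp add: J Ai W_def f_def g_def h_def u_def v_def w_def)
  also have "(\<Sum>j\<in>J. (A j * arc_weight (sdist y (x j)) / W) *\<^sub>R x j) = comb3 b c u v w"
    unfolding comb3_def sums
    by (simp add: J Ai b_def c_def f_def g_def h_def u_def v_def w_def)
  finally have ys: "y = sgn (comb3 b c u v w)" .
  have near: "norm (y - v) \<le> d" using sgn_comb3_near(2)[OF bc] ys by simp
  have sq: "(sdist y z)\<^sup>2 \<le> 16 * d\<^sup>2" if "z \<in> {u, v, w}" for z
  proof -
    have "norm (v - z) \<le> d" using that close d_nonneg by (auto simp: norm_minus_commute)
    then have "norm (y - z) \<le> 2 * d" using norm_triangle_ineq[of "y - v" "v - z"] near by simp
    moreover have "norm z = 1" using that unit by auto
    moreover have "0 < y \<bullet> z"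
      using mean_in_inner_pos[OF ins mean] that by (auto simp: J u_def v_def w_def)
    ultimately have "sdist y z \<le> 4 * d"
      using sdist_le_twice_norm[of y z] mean_in_norm[OF ins mean] by simp
    moreover have "0 \<le> sdist y z"
      using R that by (auto simp: J u_def v_def w_def)
    ultimately have "(sdist y z)\<^sup>2 \<le> (4 * d)\<^sup>2" by (intro power_mono) auto
    then show ?thesis by (simp add: power_mult_distrib)
  qed
  have up: "f \<le> 1 + 16 * d\<^sup>2" "g \<le> 1 + 16 * d\<^sup>2" "h \<le> 1 + 16 * d\<^sup>2"
    using arc_weight_bounds(3)[OF R, of "i - 1"] arc_weight_bounds(3)[OF R, of i]
      arc_weight_bounds(3)[OF R, of "i + 1"] sq[of u] sq[of v] sq[of w]
    unfolding f_def g_def h_def u_def v_def w_def by (simp_all add: J)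
  have est: "\<bar>t / 8 / W - 1 / 8\<bar> \<le> 2 * d\<^sup>2" if "1 \<le> t" "t \<le> 1 + 16 * d\<^sup>2" for t
  proof -
    have "t / 8 / W - 1 / 8 = (t - W) / (8 * W)" using W1 by (simp add: field_simps)
    moreover have "\<bar>t - W\<bar> \<le> 16 * d\<^sup>2"
      using that up fgh by (simp add: W_def abs_le_iff)
    moreover have "\<bar>(t - W) / (8 * W)\<bar> = \<bar>t - W\<bar> / (8 * W)" using W1 by (simp add: abs_mult)
    moreover have "\<bar>t - W\<bar> / (8 * W) \<le> \<bar>t - W\<bar> / 8"
      using W1 by (intro divide_left_mono) auto
    moreover have "\<bar>t - W\<bar> / 8 \<le> 2 * d\<^sup>2"
      using \<open>\<bar>t - W\<bar> \<le> 16 * d\<^sup>2\<close> by simp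
    ultimately show ?thesis by (metis order_trans)
  qed
  show "\<exists>b c. 0 \<le> b \<and> b \<le> 1 / 4 \<and> 0 \<le> c \<and> c \<le> 1 / 4 \<and> \<bar>b - 1 / 8\<bar> \<le> 2 * d\<^sup>2 \<and> \<bar>c - 1 / 8\<bar> \<le> 2 * d\<^sup>2 \<and>
          riem_analogue cubic_mask x (2 * i) = sgn (comb3 b c (x (i - 1)) (x i) (x (i + 1)))"
    using bc est[OF fgh(1) up(1)] est[OF fgh(5) up(3)] y(2) ys
    by (intro exI[of _ b] exI[of _ c]) (simp add: b_def c_def u_def v_def w_def)
qed

section \<open>Limits of data on dyadic grids\<close>

text \<open>
  Bounded because the infinite product of the factors $1 + \alpha_k$ is at most
  $\exp(\sum\alpha_k)$.
\<close>
lemma gronwall_bounded: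
  fixes u :: "nat \<Rightarrow> real"
  assumes step: "\<And>k. u (Suc k) \<le> (1 + \<alpha> k) * u k + \<beta> k"
    and nonneg: "\<And>k. 0 \<le> u k" "\<And>k. 0 \<le> \<alpha> k" "\<And>k. 0 \<le> \<beta> k"
    and "summable \<alpha>" "summable \<beta>"
  shows "\<exists>M\<ge>0. \<forall>k. u k \<le> M"
proof (intro exI conjI allI)
  define A B where "A = (\<lambda>k. \<Sum>j<k. \<alpha> j)" and "B = (\<lambda>k. \<Sum>j<k. \<beta> j)"
  have AB: "0 \<le> A k" "0 \<le> B k" "A k \<le> suminf \<alpha>" "B k \<le> suminf \<beta>" for k
    using assms by (auto simp: A_def B_def intro!: sum_nonneg sum_le_suminf)
  have *: "u k \<le> exp (A k) * (u 0 + B k)" for k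
  proof (induction k)
    case 0
    then show ?case by (simp add: A_def B_def)
  next
    case (Suc k)
    have "u (Suc k) \<le> (1 + \<alpha> k) * (exp (A k) * (u 0 + B k)) + \<beta> k"
    proof -
      have "(1 + \<alpha> k) * u k \<le> (1 + \<alpha> k) * (exp (A k) * (u 0 + B k))"
        using Suc nonneg(2)[of k] by (intro mult_left_mono) auto
      then show ?thesis using step[of k] by linarith
    qed
    also have "\<dots> \<le> exp (\<alpha> k) * (exp (A k) * (u 0 + B k)) + \<beta> k"
      using exp_ge_add_one_self[of "\<alpha> k"] nonneg(1)[of 0] AB by (simp add: mult_right_mono)
    also have "exp (\<alpha> k) * (exp (A k) * (u 0 + B k)) = exp (A (Suc k)) * (u 0 + B k)"
      by (simp add: A_def exp_add)
    also have "\<beta> k \<le> exp (A (Suc k)) * \<beta> k"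
      using mult_right_mono[of 1 "exp (A (Suc k))" "\<beta> k"] AB(1)[of "Suc k"] nonneg(3) by simp
    finally show ?case by (simp add: B_def algebra_simps)
  qed
  show "u k \<le> exp (suminf \<alpha>) * (u 0 + suminf \<beta>)" for k
    using AB[of k] nonneg(1)[of 0] by (intro order_trans[OF *] mult_mono) auto
  show "0 \<le> exp (suminf \<alpha>) * (u 0 + suminf \<beta>)"
    using nonneg(1)[of 0] AB(2,4)[of 0] by simp
qed

lemma summable_of_contraction:
  fixes u :: "nat \<Rightarrow> real"
  assumes step: "\<And>k. u (Suc k) \<le> u k / 2 + c k"
    and nonneg: "\<And>k. 0 \<le> u k" "\<And>k. 0 \<le> c k" and "summable c"
  shows "summable u"
proof (rule summableI_nonneg_bounded)
  fix n
  \<comment> \<open>The invariant survives a step because 2 u (n + 1) is at most u n + 2 c n.\<close>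
  have "(\<Sum>k<n. u k) + 2 * u n \<le> 2 * u 0 + 2 * (\<Sum>k<n. c k)"
  proof (induction n)
    case (Suc n)
    then show ?case using step[of n] by simp
  qed simp
  moreover have "(\<Sum>k<n. c k) \<le> suminf c" using assms by (intro sum_le_suminf) auto
  ultimately show "(\<Sum>k<n. u k) \<le> 2 * u 0 + 2 * suminf c" using nonneg(1)[of n] by linarith
qed (rule nonneg)

text \<open>
  The sequence q k lives on the grid of mesh $2^{-k}$; it is compared with f on the whole cell to
  the right of each grid point.
\<close>
definition grid_limit :: "(nat \<Rightarrow> int \<Rightarrow> 'a::real_normed_vector) \<Rightarrow> (real \<Rightarrow> 'a) \<Rightarrow> bool" where
  "grid_limit q f \<longleftrightarrow>
     (\<exists>\<eta>. \<eta> \<longlonglongrightarrow> 0 \<and> (\<forall>k t. norm (q k \<lfloor>2 ^ k * t\<rfloor> - f t) \<le> \<eta> k))"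

lemma grid_limitE:
  assumes "grid_limit q f"
  obtains \<eta> where "\<eta> \<longlonglongrightarrow> 0" "\<And>k t. norm (q k \<lfloor>2 ^ k * t\<rfloor> - f t) \<le> \<eta> k"
proof -
  obtain \<eta> where \<eta>: "\<eta> \<longlonglongrightarrow> 0 \<and> (\<forall>k t. norm (q k \<lfloor>2 ^ k * t\<rfloor> - f t) \<le> \<eta> k)"
    using assms unfolding grid_limit_def by (elim exE)
  show thesis by (rule that[of \<eta>]) (use \<eta> in simp_all)
qed

text \<open>
  The value at t on level k + 1 belongs to one of the two children of the cell that contains t on
  level k, so the step functions of the levels form a uniform Cauchy sequence. The limit is continuous
  because the jumps of the step functions tend to 0.
\<close>
lemma grid_limit_exists:
  fixes q :: "nat \<Rightarrow> int \<Rightarrow> 'a::banach"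
  assumes refine: "\<And>k i. norm (q (Suc k) (2 * i) - q k i) \<le> \<epsilon> k"
      "\<And>k i. norm (q (Suc k) (2 * i + 1) - q k i) \<le> \<epsilon> k"
    and "summable \<epsilon>"
    and step: "\<And>k i. norm (q k (i + 1) - q k i) \<le> \<delta> k" and "\<delta> \<longlonglongrightarrow> 0"
  obtains f where "grid_limit q f" "continuous_on UNIV f"
proof
  define g where "g k t = q k \<lfloor>2 ^ k * t\<rfloor>" for k and t :: real
  define f where "f t = g 0 t + (\<Sum>k. g (Suc k) t - g k t)" for t
  define \<eta> where "\<eta> n = (\<Sum>k. \<epsilon> (k + n))" for n
  have gs: "norm (g (Suc k) t - g k t) \<le> \<epsilon> k" for k t
  proof -
    define r where "r = 2 ^ k * t"
    define i where "i = \<lfloor>r\<rfloor>"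
    have "\<lfloor>2 ^ Suc k * t\<rfloor> = 2 * i \<or> \<lfloor>2 ^ Suc k * t\<rfloor> = 2 * i + 1"
    proof -
      have "2 ^ Suc k * t = 2 * r" by (simp add: r_def)
      moreover have "\<lfloor>2 * r\<rfloor> = 2 * i \<or> \<lfloor>2 * r\<rfloor> = 2 * i + 1" unfolding i_def by linarith
      ultimately show ?thesis by metis
    qed
    then show ?thesis unfolding g_def r_def[symmetric] i_def[symmetric] using refine[of k i] by metis
  qed
  have sg: "summable (\<lambda>k. g (Suc k) t - g k t)" for t
    by (rule summable_comparison_test'[OF \<open>summable \<epsilon>\<close>]) (rule gs)
  have tail: "norm (g n t - f t) \<le> \<eta> n" for n t
  proof -
    have "(\<Sum>k<n. g (Suc k) t - g k t) = g n t - g 0 t" by (rule sum_lessThan_telescope)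
    then have "f t - g n t = (\<Sum>k. g (Suc (k + n)) t - g (k + n) t)"
      using suminf_split_initial_segment[OF sg[of t], of n] by (simp add: f_def)
    moreover have "norm (\<Sum>k. g (Suc (k + n)) t - g (k + n) t) \<le> \<eta> n"
      unfolding \<eta>_def using gs \<open>summable \<epsilon>\<close>
      by (intro norm_suminf_le summable_ignore_initial_segment) auto
    ultimately show ?thesis by (simp add: norm_minus_commute)
  qed
  have \<eta>: "\<eta> \<longlonglongrightarrow> 0" unfolding \<eta>_def using suminf_exist_split2[OF \<open>summable \<epsilon>\<close>] .
  show "grid_limit q f" unfolding grid_limit_def using \<eta> tail unfolding g_def by blast
  show "continuous_on UNIV f"
    unfolding continuous_on_iff
  proof (intro ballI allI impI)
    fix x e :: real assume "0 < e"
    have "(\<lambda>k. \<eta> k + \<delta> k + \<eta> k) \<longlonglongrightarrow> 0 + 0 + 0" by (intro tendsto_add \<eta> \<open>\<delta> \<longlonglongrightarrow> 0\<close>)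
    then have "\<forall>\<^sub>F k in sequentially. \<eta> k + \<delta> k + \<eta> k < e" using \<open>0 < e\<close> by (intro order_tendstoD(2)) auto
    then obtain k where k: "\<eta> k + \<delta> k + \<eta> k < e" by (auto simp: eventually_sequentially)
    have "dist (f t) (f x) < e" if "dist t x < 1 / 2 ^ k" for t
    proof -
      define r r' where "r = 2 ^ k * t" and "r' = 2 ^ k * x"
      have "r - r' = 2 ^ k * (t - x)" by (simp add: r_def r'_def right_diff_distrib)
      then have "\<bar>r - r'\<bar> = 2 ^ k * \<bar>t - x\<bar>" by (simp add: abs_mult)
      also have "\<dots> < 1" using that by (simp add: dist_real_def pos_less_divide_eq mult.commute)
      finally have "\<lfloor>r\<rfloor> = \<lfloor>r'\<rfloor> \<or> \<lfloor>r\<rfloor> = \<lfloor>r'\<rfloor> + 1 \<or> \<lfloor>r'\<rfloor> = \<lfloor>r\<rfloor> + 1" by linarith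
      then have "norm (g k t - g k x) \<le> \<delta> k"
        using step[of k "\<lfloor>r\<rfloor>"] step[of k "\<lfloor>r'\<rfloor>"] order_trans[OF norm_ge_zero step[of k 0]]
        unfolding g_def r_def[symmetric] r'_def[symmetric] by (auto simp: norm_minus_commute)
      then have "norm ((f t - g k t) + (g k t - g k x) + (g k x - f x)) \<le> \<eta> k + \<delta> k + \<eta> k"
        using tail[of k t] tail[of k x] by (intro norm_triangle_mono) (auto simp: norm_minus_commute)
      then show ?thesis using k by (simp add: dist_norm)
    qed
    then show "\<exists>d>0. \<forall>t\<in>UNIV. dist t x < d \<longrightarrow> dist (f t) (f x) < e"
      by (intro exI[of _ "1 / 2 ^ k"]) auto
  qed
qed

lemma grid_limit_tendsto:
  assumes "grid_limit q f"
  shows "(\<lambda>k. q k \<lfloor>2 ^ k * t\<rfloor>) \<longlonglongrightarrow> f t"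
proof -
  obtain \<eta> where \<eta>: "\<eta> \<longlonglongrightarrow> 0" "\<And>k t. norm (q k \<lfloor>2 ^ k * t\<rfloor> - f t) \<le> \<eta> k"
    using assms by (rule grid_limitE) (rule that)
  have "(\<lambda>k. q k \<lfloor>2 ^ k * t\<rfloor> - f t) \<longlonglongrightarrow> 0"
    by (rule Lim_null_comparison[OF _ \<eta>(1)]) (simp add: \<eta>(2))
  then show ?thesis by (rule LIM_zero_cancel)
qed

lemma dyadic_floor_tendsto: "(\<lambda>k. of_int \<lfloor>2 ^ k * t\<rfloor> / 2 ^ k) \<longlonglongrightarrow> (t :: real)"
proof -
  have bound: "\<bar>of_int \<lfloor>2 ^ k * t\<rfloor> / 2 ^ k - t\<bar> \<le> (1 / 2) ^ k" for k :: nat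
  proof -
    have "of_int \<lfloor>2 ^ k * t\<rfloor> / 2 ^ k - t = (of_int \<lfloor>2 ^ k * t\<rfloor> - 2 ^ k * t) / 2 ^ k"
      by (simp add: diff_divide_distrib)
    moreover have "\<bar>of_int \<lfloor>r\<rfloor> - r\<bar> \<le> 1" for r :: real by linarith
    then have "\<bar>of_int \<lfloor>2 ^ k * t\<rfloor> - 2 ^ k * t\<bar> / 2 ^ k \<le> 1 / 2 ^ k"
      by (intro divide_right_mono) auto
    ultimately show ?thesis by (simp add: power_one_over)
  qed
  have "(\<lambda>k. (1 / 2 :: real) ^ k) \<longlonglongrightarrow> 0" by (rule LIMSEQ_power_zero) simp
  then have "(\<lambda>k. of_int \<lfloor>2 ^ k * t\<rfloor> / 2 ^ k - t) \<longlonglongrightarrow> 0"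
    by (rule Lim_null_comparison[rotated])
      (intro always_eventually allI, unfold real_norm_def, rule bound)
  then show ?thesis by (rule LIM_zero_cancel)
qed

text \<open>
  Near s the difference quotients of the data are within e of D s on all fine levels. Summing them
  between two points a and b and passing to the limit bounds the deviation of f b - f a from its linear
  approximation by e (b - a).
\<close>
lemma grid_limit_derivative:
  fixes p :: "nat \<Rightarrow> int \<Rightarrow> 'a::real_normed_vector"
  assumes p: "grid_limit p f"
    and D: "grid_limit (\<lambda>k i. 2 ^ k *\<^sub>R (p k (i + 1) - p k i)) D"
    and cont: "continuous_on UNIV D"
  shows "(f has_vector_derivative D s) (at s)"
proof -
  obtain \<eta> where \<eta>: "\<eta> \<longlonglongrightarrow> 0"
    and diff: "\<And>k t. norm (2 ^ k *\<^sub>R (p k (\<lfloor>2 ^ k * t\<rfloor> + 1) - p k \<lfloor>2 ^ k * t\<rfloor>) - D t) \<le> \<eta> k"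
    using D by (rule grid_limitE) (rule that)
  have key: "norm (f b - f a - (b - a) *\<^sub>R D s) \<le> (b - a) * e"
    if osc: "\<And>u. \<bar>u - s\<bar> < d \<Longrightarrow> norm (D u - D s) \<le> e"
      and ab: "a \<le> b" "\<bar>a - s\<bar> < d" "\<bar>b - s\<bar> < d" for a b d e
  proof -
    define i j where "i k = \<lfloor>2 ^ k * a\<rfloor>" and "j k = \<lfloor>2 ^ k * b\<rfloor>" for k :: nat
    define h where "h k = of_int (j k) / 2 ^ k - of_int (i k) / (2 ^ k :: real)" for k
    have ij: "i k \<le> j k" for k using ab(1) by (auto simp: i_def j_def intro!: floor_mono mult_left_mono)
    have "(\<lambda>k. p k (j k) - p k (i k) - h k *\<^sub>R D s) \<longlonglongrightarrow> f b - f a - (b - a) *\<^sub>R D s"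
      unfolding h_def i_def j_def
      by (intro tendsto_intros grid_limit_tendsto p dyadic_floor_tendsto)
    then have L: "(\<lambda>k. norm (p k (j k) - p k (i k) - h k *\<^sub>R D s))
        \<longlonglongrightarrow> norm (f b - f a - (b - a) *\<^sub>R D s)"
      by (rule tendsto_norm)
    have "(\<lambda>k. h k * (e + \<eta> k)) \<longlonglongrightarrow> (b - a) * (e + 0)"
      unfolding h_def i_def j_def by (intro tendsto_intros dyadic_floor_tendsto \<eta>)
    then have R: "(\<lambda>k. h k * (e + \<eta> k)) \<longlonglongrightarrow> (b - a) * e" by simp
    have "(\<lambda>k. of_int (i k) / 2 ^ k) \<longlonglongrightarrow> a" unfolding i_def by (rule dyadic_floor_tendsto)
    then have "\<forall>\<^sub>F k in sequentially. s - d < of_int (i k) / 2 ^ k"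
      using ab(2) by (intro order_tendstoD(1)) auto
    then have "\<forall>\<^sub>F k in sequentially. norm (p k (j k) - p k (i k) - h k *\<^sub>R D s) \<le> h k * (e + \<eta> k)"
    proof eventually_elim
      case (elim k)
      have "norm (p k (i k + int n) - p k (i k) - (real n / 2 ^ k) *\<^sub>R D s)
          \<le> real n / 2 ^ k * (e + \<eta> k)" if "i k + int n \<le> j k" for n
        using that
      proof (induction n)
        case (Suc n)
        define l where "l = i k + int n"
        define u where "u = of_int l / (2 ^ k :: real)"
        have "of_int (i k) / 2 ^ k \<le> u" by (simp add: u_def l_def divide_right_mono)
        moreover have "u \<le> b"
        proof -
          have "real_of_int l \<le> of_int (j k)" using Suc.prems by (simp add: l_def)
          also have "\<dots> \<le> 2 ^ k * b" unfolding j_def by (rule of_int_floor_le)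
          finally show ?thesis by (simp add: u_def pos_divide_le_eq mult.commute)
        qed
        ultimately have "norm (D u - D s) \<le> e" using elim ab(3) by (intro osc) auto
        moreover have "norm (2 ^ k *\<^sub>R (p k (l + 1) - p k l) - D u) \<le> \<eta> k"
          using diff[of k u] by (simp add: u_def)
        ultimately have "norm ((2 ^ k *\<^sub>R (p k (l + 1) - p k l) - D u) + (D u - D s)) \<le> \<eta> k + e"
          by (intro norm_triangle_mono)
        then have "norm (2 ^ k *\<^sub>R (p k (l + 1) - p k l) - D s) \<le> e + \<eta> k" by (simp add: add.commute)
        then have "norm ((1 / 2 ^ k) *\<^sub>R (2 ^ k *\<^sub>R (p k (l + 1) - p k l) - D s)) \<le> 1 / 2 ^ k * (e + \<eta> k)"
          by (simp add: divide_right_mono)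
        moreover have "(1 / 2 ^ k) *\<^sub>R (2 ^ k *\<^sub>R (p k (l + 1) - p k l) - D s)
             = p k (l + 1) - p k l - (1 / 2 ^ k) *\<^sub>R D s"
          by (simp add: scaleR_diff_right)
        ultimately have "norm (p k (l + 1) - p k l - (1 / 2 ^ k) *\<^sub>R D s) \<le> 1 / 2 ^ k * (e + \<eta> k)"
          by simp
        moreover have "norm (p k l - p k (i k) - (real n / 2 ^ k) *\<^sub>R D s) \<le> real n / 2 ^ k * (e + \<eta> k)"
          using Suc by (simp add: l_def)
        ultimately have "norm ((p k (l + 1) - p k l - (1 / 2 ^ k) *\<^sub>R D s)
            + (p k l - p k (i k) - (real n / 2 ^ k) *\<^sub>R D s))
            \<le> 1 / 2 ^ k * (e + \<eta> k) + real n / 2 ^ k * (e + \<eta> k)"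
          by (rule norm_triangle_mono)
        then show ?case by (simp add: l_def algebra_simps add_divide_distrib)
      qed simp
      from this[of "nat (j k - i k)"] show ?case using ij[of k]
        by (simp add: h_def diff_divide_distrib)
    qed
    then show ?thesis using tendsto_le[OF _ R L] by simp
  qed
  show ?thesis
    unfolding has_vector_derivative_def has_derivative_at_alt
  proof (intro conjI allI impI)
    show "bounded_linear (\<lambda>x. x *\<^sub>R D s)" by (rule bounded_linear_scaleR_left)
    fix e :: real assume "0 < e"
    obtain d where "0 < d" and near: "\<forall>u\<in>UNIV. dist u s < d \<longrightarrow> dist (D u) (D s) < e"
      using cont[unfolded continuous_on_iff, THEN bspec, OF UNIV_I[of s], THEN spec, THEN mp, OF \<open>0 < e\<close>]
      by (elim exE conjE)
    have osc: "norm (D u - D s) \<le> e" if "\<bar>u - s\<bar> < d" for u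
      using near[THEN bspec, OF UNIV_I, of u] that by (simp add: dist_norm)
    have "norm (f y - f s - (y - s) *\<^sub>R D s) \<le> e * norm (y - s)" if "norm (y - s) < d" for y
    proof (cases "s \<le> y")
      case True
      have "norm (f y - f s - (y - s) *\<^sub>R D s) \<le> (y - s) * e"
        by (rule key[OF osc]) (use True that \<open>0 < d\<close> in simp_all)
      moreover have "e * norm (y - s) = (y - s) * e" using True by simp
      ultimately show ?thesis by metis
    next
      case False
      have "norm (f s - f y - (s - y) *\<^sub>R D s) \<le> (s - y) * e"
        by (rule key[OF osc]) (use False that in auto)
      moreover have "f s - f y - (s - y) *\<^sub>R D s = - (f y - f s - (y - s) *\<^sub>R D s)"
        by (simp add: scaleR_diff_left)
      then have "norm (f s - f y - (s - y) *\<^sub>R D s) = norm (f y - f s - (y - s) *\<^sub>R D s)"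
        by (simp only: norm_minus_cancel)
      moreover have "e * norm (y - s) = (s - y) * e" using False by simp
      ultimately show ?thesis by metis
    qed
    then show "\<exists>d>0. \<forall>y. norm (y - s) < d \<longrightarrow> norm (f y - f s - (y - s) *\<^sub>R D s) \<le> e * norm (y - s)"
      using \<open>0 < d\<close> by blast
  qed
qed

section \<open>Perturbations of the linear cubic scheme\<close>

definition fdiff :: "(int \<Rightarrow> 'a::ab_group_add) \<Rightarrow> int \<Rightarrow> 'a" where
  "fdiff x i = x (i + 1) - x i"

lemma fdiff_add: "fdiff (\<lambda>i. x i + y i) = (\<lambda>i. fdiff x i + fdiff y i)"
  by (rule ext) (simp add: fdiff_def)

definition supnorm :: "(int \<Rightarrow> 'a::real_normed_vector) \<Rightarrow> real" where
  "supnorm x = (SUP i. norm (x i))"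

lemma supnorm_least:
  assumes "\<And>i. norm (x i) \<le> M"
  shows "supnorm x \<le> M"
  unfolding supnorm_def using assms by (intro cSUP_least) auto

lemma norm_le_supnorm:
  assumes "\<And>i. norm (x i) \<le> M"
  shows "norm (x i) \<le> supnorm x"
  unfolding supnorm_def using assms by (intro cSUP_upper bdd_aboveI[of _ M]) auto

lemma norm_fdiff_le:
  assumes "\<And>i. norm (x i) \<le> M"
  shows "norm (fdiff x i) \<le> 2 * M"
  using norm_triangle_ineq4[of "x (i + 1)" "x i"] assms[of i] assms[of "i + 1"]
  by (simp add: fdiff_def)

lemma int_cases_parity:
  fixes m :: int
  obtains i where "m = 2 * i" | i where "m = 2 * i + 1"
  by (metis evenE oddE)

lemma norm_two_scaled_le:
  assumes "norm x \<le> M" "norm y \<le> M" "0 \<le> a" "0 \<le> b"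
  shows "norm (a *\<^sub>R x + b *\<^sub>R y) \<le> (a + b) * M"
proof -
  have "norm (a *\<^sub>R x + b *\<^sub>R y) \<le> a * norm x + b * norm y"
    using norm_triangle_ineq[of "a *\<^sub>R x" "b *\<^sub>R y"] assms by simp
  also have "\<dots> \<le> a * M + b * M" using assms by (intro add_mono mult_left_mono) auto
  finally show ?thesis by (simp add: distrib_right)
qed

abbreviation cubic :: "(int \<Rightarrow> 'a::real_vector) \<Rightarrow> int \<Rightarrow> 'a" where
  "cubic \<equiv> linear_rule cubic_mask"

lemmas cubic_simps = linear_rule_cubic_mask_even linear_rule_cubic_mask_odd

text \<open>
  Clearing the denominator turns the identities below between combinations of data points into
  identities with small integer coefficients, which are decided by expanding multiples into sums.
\<close>
lemma scaleR_eqI: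
  fixes x y :: "'a::real_vector"
  assumes "8 *\<^sub>R x = 8 *\<^sub>R y"
  shows "x = y"
  using assms by simp

lemma scaleR_as_sum:
  fixes x :: "'a::real_vector"
  shows "2 *\<^sub>R x = x + x" "3 *\<^sub>R x = x + x + x" "4 *\<^sub>R x = x + x + x + x"
    "6 *\<^sub>R x = x + x + x + x + x + x" "8 *\<^sub>R x = x + x + x + x + x + x + x + x"
proof -
  have *: "(1 + a) *\<^sub>R x = x + a *\<^sub>R x" for a :: real by (simp add: scaleR_add_left)
  show "2 *\<^sub>R x = x + x" by (rule scaleR_2)
  show "3 *\<^sub>R x = x + x + x" using *[of 1] *[of 2] by (simp add: add.assoc)
  show "4 *\<^sub>R x = x + x + x + x" using *[of 1] *[of 2] *[of 3] by (simp add: add.assoc)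
  show "6 *\<^sub>R x = x + x + x + x + x + x"
    using *[of 1] *[of 2] *[of 3] *[of 4] *[of 5] by (simp add: add.assoc)
  show "8 *\<^sub>R x = x + x + x + x + x + x + x + x"
    using *[of 1] *[of 2] *[of 3] *[of 4] *[of 5] *[of 6] *[of 7] by (simp add: add.assoc)
qed

lemma next_even: "2 * i + 1 + 1 = 2 * (i + 1)" for i :: int
  by simp

lemma fdiff_cubic:
  "fdiff (cubic x) (2 * i) = (1 / 8) *\<^sub>R fdiff x (i - 1) + (3 / 8) *\<^sub>R fdiff x i"
  "fdiff (cubic x) (2 * i + 1) = (3 / 8) *\<^sub>R fdiff x i + (1 / 8) *\<^sub>R fdiff x (i + 1)"
proof -
  have e: "cubic x (2 * i + 1 + 1) = (1 / 8) *\<^sub>R x i + (6 / 8) *\<^sub>R x (i + 1) + (1 / 8) *\<^sub>R x (i + 1 + 1)"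
    using linear_rule_cubic_mask_even[of x "i + 1"] unfolding next_even by simp
  show "fdiff (cubic x) (2 * i) = (1 / 8) *\<^sub>R fdiff x (i - 1) + (3 / 8) *\<^sub>R fdiff x i"
    unfolding fdiff_def cubic_simps
    by (rule scaleR_eqI) (simp add: scaleR_add_right scaleR_diff_right, (simp add: scaleR_as_sum algebra_simps)?)
  show "fdiff (cubic x) (2 * i + 1) = (3 / 8) *\<^sub>R fdiff x i + (1 / 8) *\<^sub>R fdiff x (i + 1)"
    unfolding fdiff_def e cubic_simps
    by (rule scaleR_eqI) (simp add: scaleR_add_right scaleR_diff_right, (simp add: scaleR_as_sum algebra_simps)?)
qed

lemma fdiff2_cubic:
  "fdiff (fdiff (cubic x)) (2 * i) = (1 / 8) *\<^sub>R fdiff (fdiff x) (i - 1) + (1 / 8) *\<^sub>R fdiff (fdiff x) i"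
  "fdiff (fdiff (cubic x)) (2 * i + 1) = (1 / 4) *\<^sub>R fdiff (fdiff x) i"
proof -
  have e: "fdiff (cubic x) (2 * i + 1 + 1) = (1 / 8) *\<^sub>R fdiff x i + (3 / 8) *\<^sub>R fdiff x (i + 1)"
    using fdiff_cubic(1)[of x "i + 1"] unfolding next_even by simp
  show "fdiff (fdiff (cubic x)) (2 * i) = (1 / 8) *\<^sub>R fdiff (fdiff x) (i - 1) + (1 / 8) *\<^sub>R fdiff (fdiff x) i"
    unfolding fdiff_def[of "fdiff (cubic x)"] fdiff_def[of "fdiff x"] fdiff_cubic
    by (rule scaleR_eqI) (simp add: scaleR_add_right scaleR_diff_right, (simp add: scaleR_as_sum algebra_simps)?)
  show "fdiff (fdiff (cubic x)) (2 * i + 1) = (1 / 4) *\<^sub>R fdiff (fdiff x) i"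
    unfolding fdiff_def[of "fdiff (cubic x)"] fdiff_def[of "fdiff x"] e fdiff_cubic
    by (rule scaleR_eqI) (simp add: scaleR_add_right scaleR_diff_right, (simp add: scaleR_as_sum algebra_simps)?)
qed

lemma fdiff3_cubic:
  "fdiff (fdiff (fdiff (cubic x))) (2 * i) = (1 / 8) *\<^sub>R fdiff (fdiff (fdiff x)) (i - 1)"
  "fdiff (fdiff (fdiff (cubic x))) (2 * i + 1) = (1 / 8) *\<^sub>R fdiff (fdiff (fdiff x)) i"
proof -
  have e: "fdiff (fdiff (cubic x)) (2 * i + 1 + 1)
      = (1 / 8) *\<^sub>R fdiff (fdiff x) i + (1 / 8) *\<^sub>R fdiff (fdiff x) (i + 1)"
    using fdiff2_cubic(1)[of x "i + 1"] unfolding next_even by simp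
  show "fdiff (fdiff (fdiff (cubic x))) (2 * i) = (1 / 8) *\<^sub>R fdiff (fdiff (fdiff x)) (i - 1)"
    unfolding fdiff_def[of "fdiff (fdiff (cubic x))"] fdiff_def[of "fdiff (fdiff x)"] fdiff2_cubic
    by (rule scaleR_eqI) (simp add: scaleR_add_right scaleR_diff_right, (simp add: scaleR_as_sum algebra_simps)?)
  show "fdiff (fdiff (fdiff (cubic x))) (2 * i + 1) = (1 / 8) *\<^sub>R fdiff (fdiff (fdiff x)) i"
    unfolding fdiff_def[of "fdiff (fdiff (cubic x))"] fdiff_def[of "fdiff (fdiff x)"] e fdiff2_cubic
    by (rule scaleR_eqI) (simp add: scaleR_add_right scaleR_diff_right, (simp add: scaleR_as_sum algebra_simps)?)
qed

lemma norm_fdiff_cubic_le: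
  assumes "\<And>i. norm (fdiff x i) \<le> M"
  shows "norm (fdiff (cubic x) m) \<le> M / 2"
  using norm_two_scaled_le[OF assms assms, of "1 / 8" "3 / 8"]
    norm_two_scaled_le[OF assms assms, of "3 / 8" "1 / 8"]
  by (cases m rule: int_cases_parity) (simp_all add: fdiff_cubic)

lemma norm_fdiff2_cubic_le:
  assumes "\<And>i. norm (fdiff (fdiff x) i) \<le> M"
  shows "norm (fdiff (fdiff (cubic x)) m) \<le> M / 4"
  using norm_two_scaled_le[OF assms assms, of "1 / 8" "1 / 8"] assms
  by (cases m rule: int_cases_parity) (simp_all add: fdiff2_cubic)

lemma norm_fdiff3_cubic_le:
  assumes "\<And>i. norm (fdiff (fdiff (fdiff x)) i) \<le> M"
  shows "norm (fdiff (fdiff (fdiff (cubic x))) m) \<le> M / 8"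
  using assms by (cases m rule: int_cases_parity) (simp_all add: fdiff3_cubic)

lemma scaleR_shift:
  fixes a b y z :: "'a::real_vector"
  assumes "a - b = y"
  shows "c *\<^sub>R a + z - c *\<^sub>R b = c *\<^sub>R y + z"
proof -
  have "a = y + b" using assms by (simp add: diff_eq_eq)
  then show ?thesis by (simp add: scaleR_add_right)
qed

text \<open>
  Iterates of a nonlinear scheme that is close to the linear one. The proximity condition is of
  the order that is needed for second derivatives.
\<close>
locale perturbed_cubic =
  fixes p :: "nat \<Rightarrow> int \<Rightarrow> 'a::banach" and C :: real
  assumes C: "0 \<le> C"
    and bounded: "\<And>k i. norm (fdiff (p k) i) \<le> 1"
    and contract: "\<And>k. supnorm (fdiff (p (Suc k))) \<le> 5 / 6 * supnorm (fdiff (p k))"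
    and move: "\<And>k i. norm (p (Suc k) (2 * i) - p k i) \<le> supnorm (fdiff (p k))"
      "\<And>k i. norm (p (Suc k) (2 * i + 1) - p k i) \<le> supnorm (fdiff (p k))"
    and proximity: "\<And>k i. norm (fdiff (\<lambda>j. p (Suc k) j - cubic (p k) j) i)
      \<le> C * supnorm (fdiff (p k)) * ((supnorm (fdiff (p k)))\<^sup>2 + supnorm (fdiff (fdiff (p k))))"
begin

definition \<delta> :: "nat \<Rightarrow> real" where "\<delta> k = supnorm (fdiff (p k))"
definition \<sigma> :: "nat \<Rightarrow> real" where "\<sigma> k = supnorm (fdiff (fdiff (p k)))"
definition \<tau> :: "nat \<Rightarrow> real" where "\<tau> k = supnorm (fdiff (fdiff (fdiff (p k))))"
text \<open>
  The bound on the differences of the perturbation in the k-th step.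
\<close>
definition E :: "nat \<Rightarrow> real" where "E k = C * \<delta> k * ((\<delta> k)\<^sup>2 + \<sigma> k)"

definition defect :: "nat \<Rightarrow> int \<Rightarrow> 'a" where "defect k = (\<lambda>j. p (Suc k) j - cubic (p k) j)"

lemma norm_fdiff_le_sup:
  "norm (fdiff (p k) i) \<le> \<delta> k"
  "norm (fdiff (fdiff (p k)) i) \<le> \<sigma> k"
  "norm (fdiff (fdiff (fdiff (p k))) i) \<le> \<tau> k"
proof -
  have 1: "norm (fdiff (p k) i) \<le> 1" for i by (rule bounded)
  then have 2: "norm (fdiff (fdiff (p k)) i) \<le> 2 * 1" for i by (rule norm_fdiff_le)
  then have 3: "norm (fdiff (fdiff (fdiff (p k))) i) \<le> 2 * (2 * 1)" for i by (rule norm_fdiff_le)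
  show "norm (fdiff (p k) i) \<le> \<delta> k" unfolding \<delta>_def using 1 by (rule norm_le_supnorm)
  show "norm (fdiff (fdiff (p k)) i) \<le> \<sigma> k" unfolding \<sigma>_def using 2 by (rule norm_le_supnorm)
  show "norm (fdiff (fdiff (fdiff (p k))) i) \<le> \<tau> k"
    unfolding \<tau>_def using 3 by (rule norm_le_supnorm)
qed

lemma sup_nonneg: "0 \<le> \<delta> k" "0 \<le> \<sigma> k" "0 \<le> \<tau> k" "0 \<le> E k"
proof -
  show *: "0 \<le> \<delta> k" "0 \<le> \<sigma> k" "0 \<le> \<tau> k"
    using norm_fdiff_le_sup[of k 0] by (auto intro: order_trans[OF norm_ge_zero])
  show "0 \<le> E k" using C * by (simp add: E_def)
qed

lemma sup_relations: "\<delta> k \<le> 1" "\<sigma> k \<le> 2 * \<delta> k"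
proof -
  show "\<delta> k \<le> 1" unfolding \<delta>_def by (rule supnorm_least) (rule bounded)
  show "\<sigma> k \<le> 2 * \<delta> k"
    unfolding \<sigma>_def by (rule supnorm_least, rule norm_fdiff_le, rule norm_fdiff_le_sup(1))
qed

lemma norm_defect_le:
  shows "norm (fdiff (defect k) i) \<le> E k"
    "norm (fdiff (fdiff (defect k)) i) \<le> 2 * E k"
    "norm (fdiff (fdiff (fdiff (defect k))) i) \<le> 2 * (2 * E k)"
proof -
  show *: "norm (fdiff (defect k) i) \<le> E k" for i
    using proximity[of k i] by (simp add: defect_def E_def \<delta>_def \<sigma>_def)
  show "norm (fdiff (fdiff (defect k)) i) \<le> 2 * E k" for i
    by (rule norm_fdiff_le, rule *)
  then show "norm (fdiff (fdiff (fdiff (defect k))) i) \<le> 2 * (2 * E k)"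
    by (rule norm_fdiff_le)
qed

lemma split_defect:
  shows "fdiff (p (Suc k)) = (\<lambda>i. fdiff (cubic (p k)) i + fdiff (defect k) i)"
    "fdiff (fdiff (p (Suc k))) = (\<lambda>i. fdiff (fdiff (cubic (p k))) i + fdiff (fdiff (defect k)) i)"
    "fdiff (fdiff (fdiff (p (Suc k)))) = (\<lambda>i. fdiff (fdiff (fdiff (cubic (p k)))) i + fdiff (fdiff (fdiff (defect k))) i)"
proof -
  have "p (Suc k) = (\<lambda>i. cubic (p k) i + defect k i)" by (simp add: defect_def)
  then show 1: "fdiff (p (Suc k)) = (\<lambda>i. fdiff (cubic (p k)) i + fdiff (defect k) i)"
    by (metis fdiff_add)
  show 2: "fdiff (fdiff (p (Suc k))) = (\<lambda>i. fdiff (fdiff (cubic (p k))) i + fdiff (fdiff (defect k)) i)"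
    unfolding 1 by (rule fdiff_add)
  show "fdiff (fdiff (fdiff (p (Suc k)))) = (\<lambda>i. fdiff (fdiff (fdiff (cubic (p k)))) i + fdiff (fdiff (fdiff (defect k))) i)"
    unfolding 2 by (rule fdiff_add)
qed

lemma recurrences:
  "\<delta> (Suc k) \<le> \<delta> k / 2 + E k"
  "\<sigma> (Suc k) \<le> \<sigma> k / 4 + 2 * E k"
  "\<tau> (Suc k) \<le> \<tau> k / 8 + 2 * (2 * E k)"
proof -
  show "\<delta> (Suc k) \<le> \<delta> k / 2 + E k"
    unfolding \<delta>_def[of "Suc k"] split_defect(1)
    by (rule supnorm_least, rule norm_triangle_mono, rule norm_fdiff_cubic_le,
        rule norm_fdiff_le_sup(1), rule norm_defect_le(1))
  show "\<sigma> (Suc k) \<le> \<sigma> k / 4 + 2 * E k"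
    unfolding \<sigma>_def[of "Suc k"] split_defect(2)
    by (rule supnorm_least, rule norm_triangle_mono, rule norm_fdiff2_cubic_le,
        rule norm_fdiff_le_sup(2), rule norm_defect_le(2))
  show "\<tau> (Suc k) \<le> \<tau> k / 8 + 2 * (2 * E k)"
    unfolding \<tau>_def[of "Suc k"] split_defect(3)
    by (rule supnorm_least, rule norm_triangle_mono, rule norm_fdiff3_cubic_le,
        rule norm_fdiff_le_sup(3), rule norm_defect_le(3))
qed

lemma summable_\<delta>: "summable \<delta>"
proof -
  have "\<delta> k \<le> (5 / 6) ^ k" for k
  proof (induction k)
    case 0
    then show ?case using sup_relations by simp
  next
    case (Suc k)
    then show ?case using contract[of k] by (simp add: \<delta>_def)
  qed
  then have "norm (\<delta> k) \<le> (5 / 6) ^ k" for k using sup_nonneg(1)[of k] by simp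
  moreover have "summable (\<lambda>k. (5 / 6 :: real) ^ k)" by (rule summable_geometric) simp
  ultimately show ?thesis by (rule summable_comparison_test'[rotated])
qed

text \<open>
  The perturbation is at most $3C\delta_k^2$, so $2^k\delta_k$ grows in step k at most by the
  factor $1 + 6C\delta_k$, and $\delta$ is summable because of the contraction.
\<close>
lemma \<delta>_decay: "\<exists>M\<ge>0. \<forall>k. 2 ^ k * \<delta> k \<le> M"
proof (rule gronwall_bounded)
  fix k
  have "(\<delta> k)\<^sup>2 \<le> \<delta> k"
    using sup_nonneg(1)[of k] sup_relations(1)[of k] by (simp add: power2_eq_square mult_left_le)
  then have "(\<delta> k)\<^sup>2 + \<sigma> k \<le> 3 * \<delta> k" using sup_relations(2)[of k] by simp
  then have "E k \<le> C * \<delta> k * (3 * \<delta> k)"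
    unfolding E_def using C sup_nonneg(1) by (intro mult_left_mono) auto
  then have "\<delta> (Suc k) \<le> \<delta> k / 2 + C * \<delta> k * (3 * \<delta> k)" using recurrences(1)[of k] by linarith
  then have "2 ^ Suc k * \<delta> (Suc k) \<le> 2 ^ Suc k * (\<delta> k / 2 + C * \<delta> k * (3 * \<delta> k))"
    by (intro mult_left_mono) auto
  also have "\<dots> = (1 + 6 * C * \<delta> k) * (2 ^ k * \<delta> k) + 0" by (simp add: algebra_simps)
  finally show "2 ^ Suc k * \<delta> (Suc k) \<le> (1 + 6 * C * \<delta> k) * (2 ^ k * \<delta> k) + 0" .
  show "0 \<le> 2 ^ k * \<delta> k" "0 \<le> 6 * C * \<delta> k" "0 \<le> (0 :: real)"
    using sup_nonneg(1) C by simp_all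
  show "summable (\<lambda>k. 6 * C * \<delta> k)" by (rule summable_mult[OF summable_\<delta>])
  show "summable (\<lambda>k. 0 :: real)" by (rule summable_zero)
qed

lemma four_power_E:
  "4 ^ k * E k = C * \<delta> k * ((2 ^ k * \<delta> k)\<^sup>2 + 4 ^ k * \<sigma> k)"
proof -
  have "(4 :: real) ^ k = (2 ^ k)\<^sup>2"
    by (simp add: power2_eq_square flip: power_mult_distrib)
  then show ?thesis by (simp add: E_def power_mult_distrib algebra_simps)
qed

text \<open>
  Once $2^k\delta_k$ is bounded by $M$, the part $\delta_k^3$ of the perturbation contributes at
  most $M^2\delta_k$ after multiplication by $4^k$.
\<close>
lemma \<sigma>_decay: "\<exists>M\<ge>0. \<forall>k. 4 ^ k * \<sigma> k \<le> M"
proof -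
  obtain M where M: "\<forall>k. 2 ^ k * \<delta> k \<le> M" "0 \<le> M" using \<delta>_decay by blast
  show ?thesis
  proof (rule gronwall_bounded)
    fix k
    have "(2 ^ k * \<delta> k)\<^sup>2 \<le> M\<^sup>2" using M sup_nonneg by (intro power_mono) auto
    then have "4 ^ k * E k \<le> C * \<delta> k * (M\<^sup>2 + 4 ^ k * \<sigma> k)"
      unfolding four_power_E using C sup_nonneg(1) by (intro mult_left_mono add_right_mono) auto
    moreover have "4 ^ Suc k * \<sigma> (Suc k) \<le> 4 ^ Suc k * (\<sigma> k / 4 + 2 * E k)"
      using recurrences(2)[of k] by (intro mult_left_mono) auto
    moreover have "4 ^ Suc k * (\<sigma> k / 4 + 2 * E k) = 4 ^ k * \<sigma> k + 8 * (4 ^ k * E k)"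
      by (simp add: algebra_simps)
    ultimately have "4 ^ Suc k * \<sigma> (Suc k) \<le> 4 ^ k * \<sigma> k + 8 * (C * \<delta> k * (M\<^sup>2 + 4 ^ k * \<sigma> k))"
      by linarith
    then show "4 ^ Suc k * \<sigma> (Suc k) \<le> (1 + 8 * C * \<delta> k) * (4 ^ k * \<sigma> k) + 8 * C * M\<^sup>2 * \<delta> k"
      by (simp add: algebra_simps)
    show "0 \<le> 4 ^ k * \<sigma> k" "0 \<le> 8 * C * \<delta> k" "0 \<le> 8 * C * M\<^sup>2 * \<delta> k"
      using sup_nonneg(1,2) C by simp_all
    show "summable (\<lambda>k. 8 * C * \<delta> k)" "summable (\<lambda>k. 8 * C * M\<^sup>2 * \<delta> k)"
      by (rule summable_mult[OF summable_\<delta>])+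
  qed
qed

lemma summable_E: "summable (\<lambda>k. 4 ^ k * E k)"
proof -
  obtain M where M: "\<forall>k. 2 ^ k * \<delta> k \<le> M" "0 \<le> M" using \<delta>_decay by blast
  obtain N where N: "\<forall>k. 4 ^ k * \<sigma> k \<le> N" "0 \<le> N" using \<sigma>_decay by blast
  have "norm (4 ^ k * E k) \<le> C * (M\<^sup>2 + N) * \<delta> k" for k
  proof -
    have "(2 ^ k * \<delta> k)\<^sup>2 \<le> M\<^sup>2" using M sup_nonneg by (intro power_mono) auto
    then have "4 ^ k * E k \<le> C * \<delta> k * (M\<^sup>2 + N)"
      unfolding four_power_E using C sup_nonneg(1) N by (intro mult_left_mono add_mono) auto
    then show ?thesis using sup_nonneg(4)[of k] by (simp add: mult_ac)
  qed
  moreover have "summable (\<lambda>k. C * (M\<^sup>2 + N) * \<delta> k)" by (rule summable_mult[OF summable_\<delta>])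
  ultimately show ?thesis by (rule summable_comparison_test'[rotated])
qed

lemma summable_\<tau>: "summable (\<lambda>k. 4 ^ k * \<tau> k)"
proof (rule summable_of_contraction[of _ "\<lambda>k. 16 * (4 ^ k * E k)"])
  fix k
  have "4 ^ Suc k * \<tau> (Suc k) \<le> 4 ^ Suc k * (\<tau> k / 8 + 2 * (2 * E k))"
    using recurrences(3)[of k] by (intro mult_left_mono) auto
  then show "4 ^ Suc k * \<tau> (Suc k) \<le> 4 ^ k * \<tau> k / 2 + 16 * (4 ^ k * E k)"
    by (simp add: algebra_simps)
  show "0 \<le> 4 ^ k * \<tau> k" "0 \<le> 16 * (4 ^ k * E k)" using sup_nonneg by simp_all
next
  show "summable (\<lambda>k. 16 * (4 ^ k * E k))" by (rule summable_mult[OF summable_E])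
qed

lemma summable_\<sigma>: "summable (\<lambda>k. 2 ^ k * \<sigma> k)"
proof -
  obtain N where N: "\<forall>k. 4 ^ k * \<sigma> k \<le> N" "0 \<le> N" using \<sigma>_decay by blast
  have "norm (2 ^ k * \<sigma> k) \<le> N * (1 / 2) ^ k" for k
  proof -
    have "2 ^ k * \<sigma> k = (4 ^ k * \<sigma> k) * (1 / 2) ^ k"
      by (simp add: power_one_over field_simps flip: power_mult_distrib)
    also have "\<dots> \<le> N * (1 / 2) ^ k" using N by (intro mult_right_mono) auto
    finally show ?thesis using sup_nonneg(2)[of k] by simp
  qed
  moreover have "summable (\<lambda>k. N * (1 / 2) ^ k)"
    by (rule summable_mult, rule summable_geometric) simp
  ultimately show ?thesis by (rule summable_comparison_test'[rotated])
qed

text \<open>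
  For each of the three scaled sequences of differences, passing to the next level changes the value
  at most by a multiple of the following difference and of the perturbation. Both are summable
  after scaling.
\<close>
lemma C2_limit:
  obtains f D G where "grid_limit p f"
    "\<And>t. (f has_vector_derivative D t) (at t)"
    "\<And>t. (D has_vector_derivative G t) (at t)"
    "continuous_on UNIV G"
proof -
  note split = split_defect
  have "\<delta> \<longlonglongrightarrow> 0" by (rule summable_LIMSEQ_zero[OF summable_\<delta>])
  obtain f where f: "grid_limit p f" "continuous_on UNIV f"
  proof (rule grid_limit_exists)
    show "norm (p (Suc k) (2 * i) - p k i) \<le> \<delta> k"
      "norm (p (Suc k) (2 * i + 1) - p k i) \<le> \<delta> k" for k i
      unfolding \<delta>_def by (rule move)+
    show "norm (p k (i + 1) - p k i) \<le> \<delta> k" for k i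
      using norm_fdiff_le_sup(1)[of k i] by (simp add: fdiff_def)
  qed (use summable_\<delta> \<open>\<delta> \<longlonglongrightarrow> 0\<close> in simp_all)
  define q1 where "q1 = (\<lambda>k i. 2 ^ k *\<^sub>R fdiff (p k) i)"
  define q2 where "q2 = (\<lambda>k i. 4 ^ k *\<^sub>R fdiff (fdiff (p k)) i)"
  have q1: "q1 (Suc k) i = 2 ^ k *\<^sub>R (2 *\<^sub>R fdiff (cubic (p k)) i) + (2 * 2 ^ k) *\<^sub>R fdiff (defect k) i" for k i
    by (simp add: q1_def split(1) scaleR_add_right mult.commute)
  have E24: "2 * 2 ^ k * E k \<le> 4 * (4 ^ k * E k)" for k
  proof -
    have "(2 :: real) ^ k \<le> 4 ^ k" by (intro power_mono) auto
    then have "2 ^ k * E k \<le> 4 ^ k * E k" using sup_nonneg(4) by (intro mult_right_mono) auto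
    moreover have "0 \<le> 4 ^ k * E k" using sup_nonneg(4) by simp
    ultimately have "2 * (2 ^ k * E k) \<le> 4 * (4 ^ k * E k)" by linarith
    then show ?thesis by (simp only: mult.assoc)
  qed
  obtain D where D: "grid_limit q1 D" "continuous_on UNIV D"
  proof (rule grid_limit_exists[of q1 "\<lambda>k. 2 ^ k * \<sigma> k + 4 * (4 ^ k * E k)" "\<lambda>k. 2 ^ k * \<sigma> k"])
    fix k i
    have *: "norm (2 ^ k *\<^sub>R x + (2 * 2 ^ k) *\<^sub>R fdiff (defect k) j) \<le> 2 ^ k * \<sigma> k + 4 * (4 ^ k * E k)"
      if "norm x \<le> \<sigma> k" for x j
    proof (rule norm_triangle_mono)
      show "norm (2 ^ k *\<^sub>R x) \<le> 2 ^ k * \<sigma> k" using that by simp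
      have "norm ((2 * 2 ^ k) *\<^sub>R fdiff (defect k) j) \<le> 2 * 2 ^ k * E k" using norm_defect_le(1)[of k j] by simp
      then show "norm ((2 * 2 ^ k) *\<^sub>R fdiff (defect k) j) \<le> 4 * (4 ^ k * E k)" using E24 by (rule order_trans)
    qed
    have s: "norm ((1 / 4) *\<^sub>R fdiff (fdiff (p k)) j) \<le> \<sigma> k" for j
      using norm_fdiff_le_sup(2)[of k j] sup_nonneg(2)[of k] by simp
    have "q1 (Suc k) (2 * i) - q1 k i
        = 2 ^ k *\<^sub>R (- ((1 / 4) *\<^sub>R fdiff (fdiff (p k)) (i - 1))) + (2 * 2 ^ k) *\<^sub>R fdiff (defect k) (2 * i)"
    proof -
      have "2 *\<^sub>R fdiff (cubic (p k)) (2 * i) - fdiff (p k) i = - ((1 / 4) *\<^sub>R fdiff (fdiff (p k)) (i - 1))"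
        unfolding fdiff_cubic fdiff_def[of "fdiff (p k)"]
        by (rule scaleR_eqI) (simp add: scaleR_add_right scaleR_diff_right, (simp add: scaleR_as_sum algebra_simps)?)
      then show ?thesis unfolding q1 unfolding q1_def by (rule scaleR_shift)
    qed
    then show "norm (q1 (Suc k) (2 * i) - q1 k i) \<le> 2 ^ k * \<sigma> k + 4 * (4 ^ k * E k)"
      using * s by (simp only: norm_minus_cancel)
    have "q1 (Suc k) (2 * i + 1) - q1 k i
        = 2 ^ k *\<^sub>R ((1 / 4) *\<^sub>R fdiff (fdiff (p k)) i) + (2 * 2 ^ k) *\<^sub>R fdiff (defect k) (2 * i + 1)"
    proof -
      have "2 *\<^sub>R fdiff (cubic (p k)) (2 * i + 1) - fdiff (p k) i = (1 / 4) *\<^sub>R fdiff (fdiff (p k)) i"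
        unfolding fdiff_cubic fdiff_def[of "fdiff (p k)"]
        by (rule scaleR_eqI) (simp add: scaleR_add_right scaleR_diff_right, (simp add: scaleR_as_sum algebra_simps)?)
      then show ?thesis unfolding q1 unfolding q1_def by (rule scaleR_shift)
    qed
    then show "norm (q1 (Suc k) (2 * i + 1) - q1 k i) \<le> 2 ^ k * \<sigma> k + 4 * (4 ^ k * E k)"
      using * s by metis
    have "q1 k (i + 1) - q1 k i = 2 ^ k *\<^sub>R fdiff (fdiff (p k)) i"
      by (simp add: q1_def fdiff_def[of "fdiff (p k)"] scaleR_diff_right)
    then show "norm (q1 k (i + 1) - q1 k i) \<le> 2 ^ k * \<sigma> k"
      using norm_fdiff_le_sup(2)[of k i] by simp
  next
    show "summable (\<lambda>k. 2 ^ k * \<sigma> k + 4 * (4 ^ k * E k))"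
      by (intro summable_add summable_mult summable_\<sigma> summable_E)
    show "(\<lambda>k. 2 ^ k * \<sigma> k) \<longlonglongrightarrow> 0" by (rule summable_LIMSEQ_zero[OF summable_\<sigma>])
  qed
  have q2: "q2 (Suc k) i = 4 ^ k *\<^sub>R (4 *\<^sub>R fdiff (fdiff (cubic (p k))) i) + (4 * 4 ^ k) *\<^sub>R fdiff (fdiff (defect k)) i" for k i
    by (simp add: q2_def split(2) scaleR_add_right mult.commute)
  obtain G where G: "grid_limit q2 G" "continuous_on UNIV G"
  proof (rule grid_limit_exists[of q2 "\<lambda>k. 4 ^ k * \<tau> k + 8 * (4 ^ k * E k)" "\<lambda>k. 4 ^ k * \<tau> k"])
    fix k i
    have *: "norm (4 ^ k *\<^sub>R x + (4 * 4 ^ k) *\<^sub>R fdiff (fdiff (defect k)) j) \<le> 4 ^ k * \<tau> k + 8 * (4 ^ k * E k)"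
      if "norm x \<le> \<tau> k" for x j
    proof (rule norm_triangle_mono)
      show "norm (4 ^ k *\<^sub>R x) \<le> 4 ^ k * \<tau> k" using that by simp
      show "norm ((4 * 4 ^ k) *\<^sub>R fdiff (fdiff (defect k)) j) \<le> 8 * (4 ^ k * E k)"
        using norm_defect_le(2)[of k j] by simp
    qed
    have "q2 (Suc k) (2 * i) - q2 k i
        = 4 ^ k *\<^sub>R (- ((1 / 2) *\<^sub>R fdiff (fdiff (fdiff (p k))) (i - 1))) + (4 * 4 ^ k) *\<^sub>R fdiff (fdiff (defect k)) (2 * i)"
    proof -
      have "4 *\<^sub>R fdiff (fdiff (cubic (p k))) (2 * i) - fdiff (fdiff (p k)) i
          = - ((1 / 2) *\<^sub>R fdiff (fdiff (fdiff (p k))) (i - 1))"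
        unfolding fdiff2_cubic fdiff_def[of "fdiff (fdiff (p k))"]
        by (rule scaleR_eqI) (simp add: scaleR_add_right scaleR_diff_right, (simp add: scaleR_as_sum algebra_simps)?)
      then show ?thesis unfolding q2 unfolding q2_def by (rule scaleR_shift)
    qed
    moreover have "norm (- ((1 / 2) *\<^sub>R fdiff (fdiff (fdiff (p k))) (i - 1))) \<le> \<tau> k"
      using norm_fdiff_le_sup(3)[of k "i - 1"] sup_nonneg(3)[of k] by simp
    ultimately show "norm (q2 (Suc k) (2 * i) - q2 k i) \<le> 4 ^ k * \<tau> k + 8 * (4 ^ k * E k)"
      using * by metis
    have "q2 (Suc k) (2 * i + 1) - q2 k i
        = 4 ^ k *\<^sub>R 0 + (4 * 4 ^ k) *\<^sub>R fdiff (fdiff (defect k)) (2 * i + 1)"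
      unfolding q2 fdiff2_cubic by (simp add: q2_def)
    then show "norm (q2 (Suc k) (2 * i + 1) - q2 k i) \<le> 4 ^ k * \<tau> k + 8 * (4 ^ k * E k)"
      using *[of 0] sup_nonneg(3)[of k] by simp
    have "q2 k (i + 1) - q2 k i = 4 ^ k *\<^sub>R fdiff (fdiff (fdiff (p k))) i"
      by (simp add: q2_def fdiff_def[of "fdiff (fdiff (p k))"] scaleR_diff_right)
    then show "norm (q2 k (i + 1) - q2 k i) \<le> 4 ^ k * \<tau> k"
      using norm_fdiff_le_sup(3)[of k i] by simp
  next
    show "summable (\<lambda>k. 4 ^ k * \<tau> k + 8 * (4 ^ k * E k))"
      by (intro summable_add summable_mult summable_\<tau> summable_E)
    show "(\<lambda>k. 4 ^ k * \<tau> k) \<longlonglongrightarrow> 0" by (rule summable_LIMSEQ_zero[OF summable_\<tau>])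
  qed
  have "grid_limit (\<lambda>k i. 2 ^ k *\<^sub>R (p k (i + 1) - p k i)) D"
    using D(1) by (simp add: q1_def fdiff_def)
  then have 1: "(f has_vector_derivative D t) (at t)" for t
    by (rule grid_limit_derivative[OF f(1) _ D(2)])
  have "(\<lambda>k i. 2 ^ k *\<^sub>R (q1 k (i + 1) - q1 k i)) = q2"
    by (intro ext) (simp add: q1_def q2_def fdiff_def[of "fdiff (p _)"] scaleR_diff_right
        flip: power_mult_distrib)
  then have 2: "(D has_vector_derivative G t) (at t)" for t
    using grid_limit_derivative[OF D(1) _ G(2)] G(1) by simp
  show ?thesis by (rule that[OF f(1) 1 2 G(2)])
qed

end

section \<open>Stereographic charts and interpolation\<close>

lemma Ck_on_mono: "Ck_on (Suc k) S f \<Longrightarrow> Ck_on k S f"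
proof (induction k arbitrary: f)
  case 0
  then obtain f' where "\<forall>x\<in>S. (f has_derivative f' x) (at x)" by auto
  then show ?case
    by (auto simp: continuous_on_eq_continuous_within
        intro: has_derivative_continuous has_derivative_at_withinI)
next
  case (Suc k)
  then obtain f' where "\<forall>x\<in>S. (f has_derivative f' x) (at x)" "\<forall>v. Ck_on (Suc k) S (\<lambda>x. f' x v)"
    by (auto simp del: Ck_on.simps(2) simp: Ck_on.simps(2)[of "Suc k" S f])
  then show ?case using Suc.IH by (auto simp: Ck_on.simps(2)[of k S f])
qed

lemma Ck_on_const: "Ck_on k S (\<lambda>x. c)"
proof (induction k arbitrary: c)
  case (Suc k)
  then show ?case by (auto intro!: exI[of _ "\<lambda>x v. 0"])
qed simp

lemma Ck_on_linear:
  assumes "bounded_linear f"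
  shows "Ck_on k S f"
proof (cases k)
  case 0
  then show ?thesis using assms by (simp add: linear_continuous_on)
next
  case (Suc m)
  then show ?thesis using assms
    by (auto intro!: exI[of _ "\<lambda>x. f"] bounded_linear_imp_has_derivative Ck_on_const)
qed

lemma Ck_on_add:
  assumes "Ck_on k S f" "Ck_on k S g"
  shows "Ck_on k S (\<lambda>x. f x + g x)"
  using assms
proof (induction k arbitrary: f g)
  case 0
  then show ?case by (auto intro: continuous_on_add)
next
  case (Suc k)
  obtain f' where f: "\<forall>x\<in>S. (f has_derivative f' x) (at x)" "\<forall>v. Ck_on k S (\<lambda>x. f' x v)"
    using Suc.prems(1) by auto
  obtain g' where g: "\<forall>x\<in>S. (g has_derivative g' x) (at x)" "\<forall>v. Ck_on k S (\<lambda>x. g' x v)"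
    using Suc.prems(2) by auto
  show ?case
    using f g Suc.IH by (auto intro!: exI[of _ "\<lambda>x v. f' x v + g' x v"] has_derivative_add)
qed

lemma Ck_on_scaleR:
  assumes "Ck_on k S f" "Ck_on k S g"
  shows "Ck_on k S (\<lambda>x. f x *\<^sub>R g x)"
  using assms
proof (induction k arbitrary: f g)
  case 0
  then show ?case by (auto intro: continuous_on_scaleR)
next
  case (Suc k)
  obtain f' where f: "\<forall>x\<in>S. (f has_derivative f' x) (at x)" "\<forall>v. Ck_on k S (\<lambda>x. f' x v)"
    using Suc.prems(1) by auto
  obtain g' where g: "\<forall>x\<in>S. (g has_derivative g' x) (at x)" "\<forall>v. Ck_on k S (\<lambda>x. g' x v)"
    using Suc.prems(2) by auto
  have "Ck_on k S (\<lambda>x. f x *\<^sub>R g' x v + f' x v *\<^sub>R g x)" for v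
    using f g Suc.IH Ck_on_mono[OF Suc.prems(1)] Ck_on_mono[OF Suc.prems(2)]
    by (intro Ck_on_add) auto
  then show ?case
    using f(1) g(1)
    by (auto intro!: exI[of _ "\<lambda>x v. f x *\<^sub>R g' x v + f' x v *\<^sub>R g x"] has_derivative_scaleR)
qed

text \<open>
  The conformal factor of stereographic projection, up to the constant 2.
\<close>
definition stereo_factor :: "'a::real_inner \<Rightarrow> real" where
  "stereo_factor v = 1 / (1 + v \<bullet> v)"

lemma stereo_factor_pos: "0 < stereo_factor v" "(1 + v \<bullet> v) * stereo_factor v = 1"
proof -
  have "0 < 1 + v \<bullet> v" using inner_ge_zero[of v] by linarith
  then show "0 < stereo_factor v" "(1 + v \<bullet> v) * stereo_factor v = 1"
    by (simp_all add: stereo_factor_def)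
qed

lemma stereo_factor_has_derivative:
  "(stereo_factor has_derivative (\<lambda>u. - 2 * (v \<bullet> u) * stereo_factor v * stereo_factor v)) (at v)"
proof -
  have "1 + v \<bullet> v \<noteq> 0" using inner_ge_zero[of v] by linarith
  then have "((\<lambda>v. inverse (1 + v \<bullet> v)) has_derivative
      (\<lambda>u. - 2 * (v \<bullet> u) * stereo_factor v * stereo_factor v)) (at v)"
    by (auto intro!: derivative_eq_intros
        simp: stereo_factor_def inner_commute divide_inverse algebra_simps)
  moreover have "stereo_factor = (\<lambda>v::'a. inverse (1 + v \<bullet> v))"
    by (rule ext) (simp add: stereo_factor_def inverse_eq_divide)
  ultimately show ?thesis by simp
qed

text \<open>
  The directional derivatives are polynomials in v and the function itself, so smoothness propagates
  by induction on the order.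
\<close>
lemma Ck_on_stereo_factor: "Ck_on k UNIV (stereo_factor :: 'a::euclidean_space \<Rightarrow> real)"
proof (induction k)
  case 0
  have "continuous_on UNIV (stereo_factor :: 'a \<Rightarrow> real)"
    by (auto simp: continuous_on_eq_continuous_at
        intro: has_derivative_continuous stereo_factor_has_derivative)
  then show ?case by simp
next
  case (Suc k)
  have "Ck_on k UNIV (\<lambda>v::'a. ((v \<bullet> u) *\<^sub>R (- 2)) *\<^sub>R (stereo_factor v *\<^sub>R stereo_factor v))" for u
    by (intro Ck_on_scaleR Suc Ck_on_const Ck_on_linear bounded_linear_inner_left)
  then have "Ck_on k UNIV (\<lambda>v::'a. - 2 * (v \<bullet> u) * stereo_factor v * stereo_factor v)" for u
    by (simp add: mult_ac)
  then show ?case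
    unfolding Ck_on.simps(2) using stereo_factor_has_derivative
    by (intro exI[of _ "\<lambda>v u. - 2 * (v \<bullet> u) * stereo_factor v * stereo_factor v"]) blast
qed

text \<open>
  The chart is stereographic projection from the antipode of p onto the hyperplane orthogonal to p,
  followed by a linear isometry to the coordinate space. The distance of the inverse image of v from
  p increases with the norm of v, which gives the last property.
\<close>
lemma exists_stereographic_chart:
  fixes p :: "real^('n::finite option)"
  assumes p: "norm p = 1"
  defines "U \<equiv> sphere 0 1 - {- p}"
  obtains \<phi> \<psi> where "sphere_chart U \<phi> \<psi>" "\<phi> ` U = UNIV" "\<phi> p = (0 :: real^'n)" "\<psi> 0 = p"
    "\<And>q. q \<in> U \<Longrightarrow> \<psi> (\<phi> q) = q"
    "\<And>s v. 0 \<le> s \<Longrightarrow> s \<le> 1 \<Longrightarrow> norm (\<psi> (s *\<^sub>R v) - p) \<le> norm (\<psi> v - p)"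
proof -
  have pp: "p \<bullet> p = 1" using p by (simp add: norm_eq_1)
  define T where "T = {x. p \<bullet> x = 0}"
  have "dim T = DIM(real^('n option)) - 1"
    unfolding T_def using pp by (intro dim_hyperplane) auto
  then have "dim (UNIV :: (real^'n) set) = dim T" by simp
  moreover have "subspace T" unfolding T_def by (rule subspace_hyperplane)
  ultimately obtain L :: "real^'n \<Rightarrow> real^('n option)" and M where
    L: "linear L" and M: "linear M" and range_L: "L ` UNIV = T" and "M ` T = UNIV"
    and norm_L: "\<And>x. x \<in> UNIV \<Longrightarrow> norm (L x) = norm x"
    and norm_M: "\<And>y. y \<in> T \<Longrightarrow> norm (M y) = norm y"
    and inv_L: "\<And>x. x \<in> UNIV \<Longrightarrow> M (L x) = x"
    and inv_M: "\<And>y. y \<in> T \<Longrightarrow> L (M y) = y"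
    using isometries_subspaces[OF subspace_UNIV, of T] by metis
  have pL: "p \<bullet> L v = 0" for v using range_L by (auto simp: T_def)
  then have Lp: "L v \<bullet> p = 0" for v by (simp add: inner_commute)
  have LL: "L v \<bullet> L v = v \<bullet> v" for v using norm_L[of v] by (simp add: norm_eq_sqrt_inner)
  \<comment> \<open>The line through - p and L v meets the sphere again in this point.\<close>
  define \<psi> where "\<psi> v = (2 * stereo_factor v) *\<^sub>R (L v + p) - p" for v
  define \<phi> where "\<phi> q = M ((1 / (1 + p \<bullet> q)) *\<^sub>R (q + p) - p)" for q
  let ?r = "stereo_factor :: real^'n \<Rightarrow> real"
  have p\<psi>: "p \<bullet> \<psi> v = 2 * ?r v - 1" for v
    by (simp add: \<psi>_def inner_diff_right inner_add_right pL pp)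
  have n\<psi>: "norm (\<psi> v) = 1" for v
  proof -
    have "(\<psi> v + p) \<bullet> (\<psi> v + p) = (2 * ?r v)\<^sup>2 * (v \<bullet> v + 1)"
      by (simp add: \<psi>_def inner_add_left inner_add_right pL Lp pp LL
          power2_eq_square algebra_simps)
    also have "\<dots> = 4 * ?r v * ((1 + v \<bullet> v) * ?r v)" by (simp add: power2_eq_square)
    finally have "(\<psi> v + p) \<bullet> (\<psi> v + p) = 4 * ?r v" by (simp add: stereo_factor_pos)
    then have "\<psi> v \<bullet> \<psi> v = 1"
      using p\<psi>[of v] by (simp add: inner_add_left inner_add_right pp inner_commute)
    then show ?thesis by (simp add: norm_eq_1)
  qed
  have \<psi>U: "\<psi> v \<in> U" for v
  proof -
    have "\<psi> v \<noteq> - p"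
    proof
      assume "\<psi> v = - p"
      then have "p \<bullet> \<psi> v = - 1" by (simp add: pp)
      then show False using p\<psi>[of v] stereo_factor_pos(1)[of v] by simp
    qed
    then show ?thesis using n\<psi> by (simp add: U_def)
  qed
  have \<phi>\<psi>: "\<phi> (\<psi> v) = v" for v
  proof -
    have "(1 / (1 + p \<bullet> \<psi> v)) *\<^sub>R (\<psi> v + p) - p = L v"
      using stereo_factor_pos(1)[of v] unfolding p\<psi> by (simp add: \<psi>_def)
    then show ?thesis using inv_L by (simp add: \<phi>_def)
  qed
  have Upos: "0 < 1 + p \<bullet> q" if "q \<in> U" for q
  proof -
    have q: "q \<bullet> q = 1" "q + p \<noteq> 0" using that by (auto simp: U_def norm_eq_1 eq_neg_iff_add_eq_0)
    have "0 < (q + p) \<bullet> (q + p)" using q(2) by simp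
    then show ?thesis using q(1) pp by (simp add: inner_add_left inner_add_right inner_commute)
  qed
  have \<psi>\<phi>: "\<psi> (\<phi> q) = q" if q: "q \<in> U" for q
  proof -
    define c where "c = 1 + p \<bullet> q"
    have c: "0 < c" using Upos[OF q] by (simp add: c_def)
    have qq: "q \<bullet> q = 1" using q by (simp add: U_def norm_eq_1)
    define w where "w = (1 / c) *\<^sub>R (q + p) - p"
    have "p \<bullet> w = 0" using c by (simp add: w_def inner_diff_right inner_add_right pp c_def)
    then have "w \<in> T" by (simp add: T_def)
    have \<phi>q: "\<phi> q = M w" by (simp add: \<phi>_def w_def c_def)
    have "M w \<bullet> M w = w \<bullet> w" using norm_M[OF \<open>w \<in> T\<close>] by (simp add: norm_eq_sqrt_inner)
    also have "w \<bullet> w + 1 = (w + p) \<bullet> (w + p)"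
      using \<open>p \<bullet> w = 0\<close> by (simp add: inner_add_left inner_add_right pp inner_commute)
    also have "w + p = (1 / c) *\<^sub>R (q + p)" by (simp add: w_def)
    also have "((1 / c) *\<^sub>R (q + p)) \<bullet> ((1 / c) *\<^sub>R (q + p)) = (1 / c) * ((1 / c) * (2 * c))"
      by (simp add: inner_add_left inner_add_right pp qq inner_commute c_def)
    also have "\<dots> = 2 / c" using c by simp
    finally have "1 + M w \<bullet> M w = 2 / c" by simp
    then have "stereo_factor (M w) = c / 2" by (simp add: stereo_factor_def)
    then have "\<psi> (\<phi> q) = (2 * (c / 2)) *\<^sub>R (w + p) - p"
      by (simp only: \<phi>q \<psi>_def inv_M[OF \<open>w \<in> T\<close>])
    also have "\<dots> = q" using c by (simp add: w_def)
    finally show ?thesis .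
  qed
  have img: "\<phi> ` U = UNIV" using \<phi>\<psi> \<psi>U by (metis surjI image_eqI UNIV_eq_I)
  have smooth: "Ck_on k UNIV \<psi>" for k
  proof -
    have "bounded_linear L" using L by (simp add: linear_conv_bounded_linear)
    then have "Ck_on k UNIV (\<lambda>v. (?r v *\<^sub>R 2) *\<^sub>R (L v + p) + (- p))"
      by (intro Ck_on_add Ck_on_scaleR Ck_on_stereo_factor Ck_on_const Ck_on_linear)
    then show ?thesis unfolding \<psi>_def[abs_def] by (simp add: mult.commute)
  qed
  have \<phi>_cont: "continuous_on U \<phi>"
  proof -
    have "continuous_on UNIV M" using M by (simp add: linear_continuous_on linear_conv_bounded_linear)
    moreover have "continuous_on U (\<lambda>q. (1 / (1 + p \<bullet> q)) *\<^sub>R (q + p) - p)"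
      using Upos by (intro continuous_intros) force
    ultimately show ?thesis
      unfolding \<phi>_def[abs_def] using continuous_on_compose2[of UNIV M U] by auto
  qed
  have "continuous_on UNIV \<psi>" using smooth[of 0] by simp
  have "homeomorphism U (\<phi> ` U) \<phi> \<psi>"
  proof -
    have "U \<subseteq> range \<psi>" using \<psi>\<phi> by (metis rangeI subsetI)
    then have "range \<psi> = U" using \<psi>U by blast
    then show ?thesis
      unfolding homeomorphism_def img
      using \<phi>_cont \<open>continuous_on UNIV \<psi>\<close> \<psi>\<phi> \<phi>\<psi> by blast
  qed
  moreover have "openin (top_of_set (sphere 0 1)) U"
    unfolding U_def by (intro openin_diff) (auto simp: p)
  moreover have "inj (frechet_derivative \<psi> (at v))" for v
  proof -
    \<comment> \<open>The chart extends to a differentiable map near the sphere, which is a left inverse.\<close>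
    have "\<psi> differentiable (at v)"
      using smooth[of 1] unfolding One_nat_def Ck_on.simps(2) differentiable_def by blast
    then have d\<psi>: "(\<psi> has_derivative frechet_derivative \<psi> (at v)) (at v)"
      by (simp only: frechet_derivative_works)
    have "1 + p \<bullet> \<psi> v \<noteq> 0" using Upos[OF \<psi>U[of v]] by simp
    then have "(\<lambda>q. (1 / (1 + p \<bullet> q)) *\<^sub>R (q + p) - p) differentiable (at (\<psi> v))"
      by (intro derivative_intros) auto
    moreover have "M differentiable (at y)" for y
      using M linear_imp_differentiable by blast
    ultimately have "(M \<circ> (\<lambda>q. (1 / (1 + p \<bullet> q)) *\<^sub>R (q + p) - p)) differentiable (at (\<psi> v))"
      by (rule differentiable_chain_at)
    then have "\<phi> differentiable (at (\<psi> v))" by (simp add: \<phi>_def[abs_def] o_def)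
    then obtain \<phi>' where "(\<phi> has_derivative \<phi>') (at (\<psi> v))" unfolding differentiable_def by blast
    from has_derivative_compose[OF d\<psi> this]
    have "((\<lambda>v. v) has_derivative (\<lambda>u. \<phi>' (frechet_derivative \<psi> (at v) u))) (at v)"
      by (simp add: \<phi>\<psi>)
    then have "(\<lambda>u. \<phi>' (frechet_derivative \<psi> (at v) u)) = (\<lambda>u. u)"
      by (rule has_derivative_unique[OF _ has_derivative_ident])
    then show ?thesis by (metis injI)
  qed
  ultimately have chart: "sphere_chart U \<phi> \<psi>"
    unfolding sphere_chart_def img using smooth by auto
  have \<psi>0: "\<psi> 0 = p"
    using linear_0[OF L] by (simp add: \<psi>_def stereo_factor_def scaleR_2)
  have \<phi>p: "\<phi> p = 0" using \<phi>\<psi>[of 0] \<psi>0 by simp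
  have shrink: "norm (\<psi> (s *\<^sub>R v) - p) \<le> norm (\<psi> v - p)" if "0 \<le> s" "s \<le> 1" for s v
  proof (rule power2_le_imp_le)
    have *: "(norm (\<psi> u - p))\<^sup>2 = 4 - 4 * ?r u" for u
    proof -
      have "\<psi> u \<bullet> \<psi> u = 1" using n\<psi>[of u] by (simp add: norm_eq_1)
      then show ?thesis
        using p\<psi>[of u] by (simp add: power2_norm_eq_inner inner_diff_left inner_diff_right pp inner_commute)
    qed
    have "s * s \<le> 1" using that by (simp add: mult_le_one)
    then have "(s *\<^sub>R v) \<bullet> (s *\<^sub>R v) \<le> v \<bullet> v"
      using mult_right_mono[of "s * s" 1 "v \<bullet> v"] by (simp add: mult.assoc)
    moreover have "0 < 1 + (s *\<^sub>R v) \<bullet> (s *\<^sub>R v)" by (metis add_pos_nonneg inner_ge_zero zero_less_one)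
    ultimately have "?r v \<le> ?r (s *\<^sub>R v)"
      unfolding stereo_factor_def by (intro divide_left_mono mult_pos_pos) auto
    then show "(norm (\<psi> (s *\<^sub>R v) - p))\<^sup>2 \<le> (norm (\<psi> v - p))\<^sup>2" unfolding * by simp
  qed simp
  show ?thesis by (rule that[OF chart img \<phi>p \<psi>0 \<psi>\<phi> shrink])
qed

text \<open>
  On each interval the chart centred at its left data point is used. At the right end point
  the interpolant takes the value of the next data point, which is also where the next chart starts.
\<close>
lemma exists_chart_interpolant:
  fixes y :: "int \<Rightarrow> real^('n::finite option)"
  assumes unit: "\<And>i. norm (y i) = 1" and near: "\<And>i. norm (y (i + 1) - y i) < 2"
  shows "\<exists>g. chart_interpolant k y g \<and>
    (\<forall>t. norm (g t - y \<lfloor>2 ^ k * t\<rfloor>) \<le> norm (y (\<lfloor>2 ^ k * t\<rfloor> + 1) - y \<lfloor>2 ^ k * t\<rfloor>))"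
proof -
  have mem: "y i \<in> sphere 0 1 - {- y i}" "y (i + 1) \<in> sphere 0 1 - {- y i}" for i
  proof -
    have "y i \<noteq> 0" using unit[of i] by auto
    moreover have "y i = 0" if "y i = - y i"
      using that by (metis add.right_inverse scaleR_2 scaleR_eq_0_iff zero_neq_numeral)
    ultimately have "y i \<noteq> - y i" by blast
    then show "y i \<in> sphere 0 1 - {- y i}" using unit by simp
    have "y (i + 1) \<noteq> - y i"
    proof
      assume "y (i + 1) = - y i"
      then have "y (i + 1) - y i = - (2 *\<^sub>R y i)" by (simp add: scaleR_2)
      then have "norm (y (i + 1) - y i) = 2" using unit[of i] by simp
      then show False using near[of i] by simp
    qed
    then show "y (i + 1) \<in> sphere 0 1 - {- y i}" using unit by simp
  qed
  have "\<exists>\<phi> \<psi>. sphere_chart (sphere 0 1 - {- y i}) \<phi> \<psi> \<and> \<phi> ` (sphere 0 1 - {- y i}) = UNIV \<and>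
      \<phi> (y i) = (0 :: real^'n) \<and> \<psi> 0 = y i \<and> \<psi> (\<phi> (y (i + 1))) = y (i + 1) \<and>
      (\<forall>s v. 0 \<le> s \<longrightarrow> s \<le> 1 \<longrightarrow> norm (\<psi> (s *\<^sub>R v) - y i) \<le> norm (\<psi> v - y i))" for i
  proof -
    obtain \<phi> \<psi> where c: "sphere_chart (sphere 0 1 - {- y i}) \<phi> \<psi>"
      "\<phi> ` (sphere 0 1 - {- y i}) = UNIV" "\<phi> (y i) = (0 :: real^'n)" "\<psi> 0 = y i"
      "\<And>q. q \<in> sphere 0 1 - {- y i} \<Longrightarrow> \<psi> (\<phi> q) = q"
      "\<And>s v. 0 \<le> s \<Longrightarrow> s \<le> 1 \<Longrightarrow> norm (\<psi> (s *\<^sub>R v) - y i) \<le> norm (\<psi> v - y i)"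
      by (rule exists_stereographic_chart[OF unit[of i]]) (rule that)
    show ?thesis using c mem by blast
  qed
  then obtain \<phi> \<psi> where c: "\<And>i. sphere_chart (sphere 0 1 - {- y i}) (\<phi> i) (\<psi> i)"
      "\<And>i. \<phi> i ` (sphere 0 1 - {- y i}) = UNIV"
      "\<And>i. \<phi> i (y i) = (0 :: real^'n)" "\<And>i. \<psi> i 0 = y i" "\<And>i. \<psi> i (\<phi> i (y (i + 1))) = y (i + 1)"
      "\<And>i s v. 0 \<le> s \<Longrightarrow> s \<le> 1 \<Longrightarrow> norm (\<psi> i (s *\<^sub>R v) - y i) \<le> norm (\<psi> i v - y i)"
    by metis
  define g where "g t = (let i = \<lfloor>2 ^ k * t\<rfloor> in \<psi> i ((2 ^ k * t - of_int i) *\<^sub>R \<phi> i (y (i + 1))))" for t :: real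
  have g: "g ((of_int i + s) / 2 ^ k) = \<psi> i (s *\<^sub>R \<phi> i (y (i + 1)))" if "s \<in> {0..1}" for i s
  proof (cases "s = 1")
    case False
    then have "\<lfloor>of_int i + s\<rfloor> = i" using that by (intro floor_unique) auto
    then show ?thesis by (simp add: g_def)
  next
    case True
    then show ?thesis using c(4)[of "i + 1"] c(5)[of i] by (simp add: g_def)
  qed
  have "chart_interpolant k y g"
    unfolding chart_interpolant_def
  proof
    fix i
    show "\<exists>U \<phi> \<psi>. sphere_chart U \<phi> \<psi> \<and> y i \<in> U \<and> y (i + 1) \<in> U \<and>
        (\<forall>s\<in>{0..1}. (1 - s) *\<^sub>R \<phi> (y i) + s *\<^sub>R \<phi> (y (i + 1)) \<in> \<phi> ` U \<and>
           g ((of_int i + s) / 2 ^ k) = \<psi> ((1 - s) *\<^sub>R \<phi> (y i) + s *\<^sub>R \<phi> (y (i + 1))))"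
      using c(1,2,3)[of i] mem[of i] g[of _ i]
      by (intro exI[of _ "sphere 0 1 - {- y i}"] exI[of _ "\<phi> i"] exI[of _ "\<psi> i"]) simp
  qed
  moreover have "norm (g t - y \<lfloor>2 ^ k * t\<rfloor>) \<le> norm (y (\<lfloor>2 ^ k * t\<rfloor> + 1) - y \<lfloor>2 ^ k * t\<rfloor>)" for t
  proof -
    define r i where "r = 2 ^ k * t" and "i = \<lfloor>r\<rfloor>"
    have "0 \<le> r - of_int i" "r - of_int i \<le> 1" unfolding i_def by linarith+
    then have "norm (\<psi> i ((r - of_int i) *\<^sub>R \<phi> i (y (i + 1))) - y i) \<le> norm (y (i + 1) - y i)"
      using c(6)[of "r - of_int i" i "\<phi> i (y (i + 1))"] c(5)[of i] by simp
    then show ?thesis by (simp add: g_def Let_def r_def i_def)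
  qed
  ultimately show ?thesis by blast
qed

section \<open>Convergence and smoothness on the sphere\<close>

text \<open>
  The chord of an arc of length $\theta$ is $2\sin(\theta/2)$.
\<close>
lemma norm_diff_le_sdist:
  assumes "norm x = 1" "norm y = 1"
  shows "norm (x - y) \<le> sdist x y"
proof -
  have t: "\<bar>x \<bullet> y\<bar> \<le> 1" using abs_inner_unit_le assms by blast
  have nonneg: "0 \<le> sdist x y" using t by (simp add: sdist_def arccos_lbound abs_le_iff)
  have "(norm (x - y))\<^sup>2 = 2 - 2 * cos (sdist x y)"
    using assms t by (simp add: sdist_def norm_eq_1 power2_norm_eq_inner inner_diff_left
        inner_diff_right inner_commute)
  also have "\<dots> = (2 * sin (sdist x y / 2))\<^sup>2"
    using cos_double_sin[of "sdist x y / 2"] by (simp add: power_mult_distrib)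
  also have "\<dots> \<le> (2 * (sdist x y / 2))\<^sup>2"
  proof (rule power_mono)
    have "sdist x y \<le> pi" using t by (simp add: sdist_def abs_le_iff arccos_ubound)
    then have "sdist x y / 2 \<le> pi" using nonneg by linarith
    then show "0 \<le> 2 * sin (sdist x y / 2)" using nonneg by (simp add: sin_ge_zero)
    show "2 * sin (sdist x y / 2) \<le> 2 * (sdist x y / 2)"
      using nonneg sin_x_le_x[of "sdist x y / 2"] by simp
  qed
  also have "2 * (sdist x y / 2) = sdist x y" by simp
  finally show ?thesis using nonneg by (rule power2_le_imp_le)
qed

lemma near_chain_midpoint:
  assumes "near_chain x d"
  shows "norm (sgn (x i + x (i + 1)) - x i) \<le> d"
    and "norm (sgn (x i + x (i + 1)) - (1 / 2) *\<^sub>R (x i + x (i + 1))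
      - ((norm (x i - x (i + 1)))\<^sup>2 / 8) *\<^sub>R x i) \<le> d ^ 3"
    and "norm (sgn (x i + x (i + 1)) - (1 / 2) *\<^sub>R (x i + x (i + 1))
      - ((norm (x i - x (i + 1)))\<^sup>2 / 8) *\<^sub>R x (i + 1)) \<le> d ^ 3"
proof -
  note D = near_chainD[OF assms]
  have c: "norm (x i - x (i + 1)) \<le> d" "norm (x (i + 1) - x i) \<le> d"
    using D(2)[of i] by (simp_all add: norm_minus_commute)
  show "norm (sgn (x i + x (i + 1)) - x i) \<le> d"
    and "norm (sgn (x i + x (i + 1)) - (1 / 2) *\<^sub>R (x i + x (i + 1))
      - ((norm (x i - x (i + 1)))\<^sup>2 / 8) *\<^sub>R x i) \<le> d ^ 3"
    using sgn_midpoint_defect[OF D(1) D(1) c(1) D(3)] by auto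
  show "norm (sgn (x i + x (i + 1)) - (1 / 2) *\<^sub>R (x i + x (i + 1))
      - ((norm (x i - x (i + 1)))\<^sup>2 / 8) *\<^sub>R x (i + 1)) \<le> d ^ 3"
    using sgn_midpoint_defect(2)[OF D(1) D(1) c(2) D(3)]
    by (simp add: add.commute norm_minus_commute)
qed

context
  fixes x :: "int \<Rightarrow> 'a::euclidean_space" and d :: real and T :: "int \<Rightarrow> 'a"
  assumes chain: "near_chain x d"
  defines "T \<equiv> riem_analogue cubic_mask x"
begin

lemma riem_defined_cubic: "riem_defined cubic_mask x"
  unfolding riem_defined_def
proof
  fix m
  show "\<exists>y. riem_value cubic_mask x m y"
    using riem_analogue_cubic_even(1)[OF chain] riem_analogue_cubic_odd(1)[OF chain]
    by (cases m rule: int_cases_parity) blast+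
qed

lemma riem_cubic_odd: "T (2 * i + 1) = sgn (x i + x (i + 1))"
  unfolding T_def by (rule riem_analogue_cubic_odd[OF chain])

lemma riem_cubic_even:
  "\<exists>b c. 0 \<le> b \<and> b \<le> 1 / 4 \<and> 0 \<le> c \<and> c \<le> 1 / 4 \<and>
     \<bar>b - 1 / 8\<bar> \<le> 2 * d\<^sup>2 \<and> \<bar>c - 1 / 8\<bar> \<le> 2 * d\<^sup>2 \<and>
     T (2 * i) = sgn (comb3 b c (x (i - 1)) (x i) (x (i + 1)))"
  unfolding T_def by (rule riem_analogue_cubic_even[OF chain])

lemma riem_cubic_near_data: "norm (T (2 * i) - x i) \<le> d" "norm (T (2 * i + 1) - x i) \<le> d"
proof -
  interpret unit_triple "x (i - 1)" "x i" "x (i + 1)" d by (rule near_chain_triple[OF chain])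
  show "norm (T (2 * i) - x i) \<le> d"
    using riem_cubic_even[of i] sgn_comb3_near(2) by auto
  show "norm (T (2 * i + 1) - x i) \<le> d"
    unfolding riem_cubic_odd by (rule near_chain_midpoint[OF chain])
qed

text \<open>
  For odd m the triple is read backwards.
\<close>
lemma riem_cubic_contraction: "norm (fdiff T m) \<le> 5 / 6 * d"
proof (cases m rule: int_cases_parity)
  case (1 i)
  interpret unit_triple "x (i - 1)" "x i" "x (i + 1)" d by (rule near_chain_triple[OF chain])
  obtain b c where bc: "0 \<le> b" "b \<le> 1 / 4" "0 \<le> c" "c \<le> 1 / 4"
    and T: "T (2 * i) = sgn (comb3 b c (x (i - 1)) (x i) (x (i + 1)))"
    using riem_cubic_even[of i] by blast
  show ?thesis
    using sgn_comb3_midpoint_contraction[OF bc] unfolding 1 fdiff_def riem_cubic_odd T .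
next
  case (2 i)
  have "unit_triple (x i) (x (i + 1)) (x (i + 1 + 1)) d"
    using near_chain_triple[OF chain, of "i + 1"] by simp
  then interpret unit_triple "x (i + 1 + 1)" "x (i + 1)" "x i" d by (rule unit_triple.swap)
  obtain b c where bc: "0 \<le> b" "b \<le> 1 / 4" "0 \<le> c" "c \<le> 1 / 4"
    and T: "T (2 * (i + 1)) = sgn (comb3 b c (x (i + 1 - 1)) (x (i + 1)) (x (i + 1 + 1)))"
    using riem_cubic_even[of "i + 1"] by blast
  have "fdiff T m = T (2 * (i + 1)) - T (2 * i + 1)" by (simp only: 2 fdiff_def next_even)
  also have "\<dots> = - (sgn (x (i + 1) + x i) - sgn (comb3 c b (x (i + 1 + 1)) (x (i + 1)) (x i)))"
    unfolding T riem_cubic_odd by (simp add: comb3_commute[of b c] add.commute[of "x i"])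
  finally have "norm (fdiff T m)
      = norm (sgn (x (i + 1) + x i) - sgn (comb3 c b (x (i + 1 + 1)) (x (i + 1)) (x i)))"
    by (simp only: norm_minus_cancel)
  then show ?thesis using sgn_comb3_midpoint_contraction[OF bc(3,4,1,2)] by simp
qed

lemma riem_cubic_unit: "norm (T m) = 1"
proof -
  note D = near_chainD[OF chain]
  have "\<exists>z. T m = sgn z"
  proof (cases m rule: int_cases_parity)
    case (1 i)
    then show ?thesis using riem_cubic_even[of i] by blast
  qed (auto simp: riem_cubic_odd)
  then obtain z where z: "T m = sgn z" by blast
  have "T m \<noteq> 0"
  proof
    assume 0: "T m = 0"
    obtain i where "norm (T m - x i) \<le> d"
      using riem_cubic_near_data by (cases m rule: int_cases_parity) blast+
    then show False using 0 D(1)[of i] D(3) by simp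
  qed
  then show ?thesis using z by (auto simp: norm_sgn)
qed

text \<open>
  The defects at the two new points next to the edge from $x_i$ to $x_{i+1}$ have the same leading
  term $|\Delta x_i|^2/8$ times a common end point of the edge. Which end point is used depends on
  the parity.
\<close>
lemma riem_cubic_proximity:
  assumes s: "\<And>i. norm (fdiff (fdiff x) i) \<le> s"
  shows "norm (fdiff (\<lambda>j. T j - cubic x j) m) \<le> 8 * d * (d\<^sup>2 + s)"
proof -
  note D = near_chainD[OF chain]
  have s0: "0 \<le> s" using order_trans[OF norm_ge_zero s] .
  have bound: "7 * d ^ 3 + d * s + d ^ 3 \<le> 8 * d * (d\<^sup>2 + s)"
  proof -
    have "0 \<le> d * s" using D(4) s0 by simp
    moreover have "8 * d * (d\<^sup>2 + s) = 8 * d ^ 3 + 8 * (d * s)"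
      by (simp add: power2_eq_square power3_eq_cube algebra_simps)
    ultimately show ?thesis by simp
  qed
  have even: "norm (T (2 * i) - cubic x (2 * i) - ((norm (x i - x (i + 1)))\<^sup>2 / 8) *\<^sub>R x i) \<le> 7 * d ^ 3 + d * s"
    "norm (T (2 * i) - cubic x (2 * i) - ((norm (x i - x (i - 1)))\<^sup>2 / 8) *\<^sub>R x i) \<le> 7 * d ^ 3 + d * s" for i
  proof -
    interpret unit_triple "x (i - 1)" "x i" "x (i + 1)" d by (rule near_chain_triple[OF chain])
    interpret sw: unit_triple "x (i + 1)" "x i" "x (i - 1)" d by (rule swap)
    obtain b c where bc: "0 \<le> b" "b \<le> 1 / 4" "0 \<le> c" "c \<le> 1 / 4"
      "\<bar>b - 1 / 8\<bar> \<le> 2 * d\<^sup>2" "\<bar>c - 1 / 8\<bar> \<le> 2 * d\<^sup>2"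
      and T: "T (2 * i) = sgn (comb3 b c (x (i - 1)) (x i) (x (i + 1)))"
      using riem_cubic_even[of i] by blast
    have S: "cubic x (2 * i) = comb3 (1 / 8) (1 / 8) (x (i - 1)) (x i) (x (i + 1))"
      by (simp add: cubic_simps comb3_def)
    have s1: "norm (x (i - 1) - 2 *\<^sub>R x i + x (i + 1)) \<le> s"
      using s[of "i - 1"] by (simp add: fdiff_def scaleR_2 algebra_simps)
    then have s2: "norm (x (i + 1) - 2 *\<^sub>R x i + x (i - 1)) \<le> s"
      by (simp add: algebra_simps)
    show "norm (T (2 * i) - cubic x (2 * i) - ((norm (x i - x (i + 1)))\<^sup>2 / 8) *\<^sub>R x i) \<le> 7 * d ^ 3 + d * s"
      unfolding T S by (rule sgn_comb3_defect[OF bc s1])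
    show "norm (T (2 * i) - cubic x (2 * i) - ((norm (x i - x (i - 1)))\<^sup>2 / 8) *\<^sub>R x i) \<le> 7 * d ^ 3 + d * s"
      unfolding T S comb3_commute[of _ _ "x (i - 1)"] by (rule sw.sgn_comb3_defect[OF bc(3,4,1,2,6,5) s2])
  qed
  have odd: "norm (T (2 * i + 1) - cubic x (2 * i + 1) - ((norm (x i - x (i + 1)))\<^sup>2 / 8) *\<^sub>R x i) \<le> d ^ 3"
    "norm (T (2 * i + 1) - cubic x (2 * i + 1) - ((norm (x i - x (i + 1)))\<^sup>2 / 8) *\<^sub>R x (i + 1)) \<le> d ^ 3" for i
    using near_chain_midpoint(2,3)[OF chain, of i]
    by (simp_all add: riem_cubic_odd cubic_simps scaleR_add_right)
  have diff: "norm (a - b) \<le> 8 * d * (d\<^sup>2 + s)"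
    if "norm (a - y) \<le> 7 * d ^ 3 + d * s" "norm (b - y) \<le> d ^ 3" for a b y :: 'a
    using norm_triangle_ineq4[of "a - y" "b - y"] that bound by simp
  show ?thesis
  proof (cases m rule: int_cases_parity)
    case (1 i)
    then show ?thesis
      using diff[OF even(1) odd(1), of i] by (simp add: fdiff_def norm_minus_commute)
  next
    case (2 i)
    have "norm (T (2 * (i + 1)) - cubic x (2 * (i + 1)) - ((norm (x i - x (i + 1)))\<^sup>2 / 8) *\<^sub>R x (i + 1))
        \<le> 7 * d ^ 3 + d * s"
      using even(2)[of "i + 1"] by (simp add: norm_minus_commute)
    from diff[OF this odd(2)] show ?thesis unfolding 2 fdiff_def next_even .
  qed
qed

end

lemma near_chain_riem_analogue:
  fixes x :: "int \<Rightarrow> 'a::euclidean_space"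
  assumes "near_chain x d"
  shows "near_chain (riem_analogue cubic_mask x) d"
proof -
  have "norm (fdiff (riem_analogue cubic_mask x) i) \<le> d" for i
    using riem_cubic_contraction[OF assms, of i] near_chainD(4)[OF assms] by linarith
  then show ?thesis
    using riem_cubic_unit[OF assms] near_chainD(3)[OF assms] by (simp add: near_chain_def fdiff_def)
qed

theorem corollary11:
  fixes x :: "int \<Rightarrow> real^('n::finite option)"
  assumes "CARD('n) \<ge> 2"
    and "\<forall>l. x l \<in> sphere 0 1"
    and "(SUP l. sdist (x l) (x (l + 1))) < 0.6"
  shows "\<exists>f. converges_to cubic_mask x f \<and> Ck_on 2 UNIV f"
proof -
  have unit: "norm (x l) = 1" for l using assms(2) by simp
  have "sdist (x l) (x (l + 1)) \<le> (SUP l. sdist (x l) (x (l + 1)))" for l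
  proof (rule cSUP_upper)
    show "bdd_above (range (\<lambda>l. sdist (x l) (x (l + 1))))"
      using abs_inner_unit_le[OF unit unit]
      by (intro bdd_aboveI[of _ pi]) (auto simp: sdist_def abs_le_iff intro!: arccos_ubound)
  qed simp
  then have "norm (x (l + 1) - x l) \<le> 0.6" for l
    using norm_diff_le_sdist[OF unit[of l] unit[of "l + 1"]] assms(3)
    by (smt (verit, best) norm_minus_commute)
  then have "near_chain x 0.6" by (simp add: near_chain_def unit)
  define p where "p k = (riem_analogue cubic_mask ^^ k) x" for k
  have p_Suc: "p (Suc k) = riem_analogue cubic_mask (p k)" for k by (simp add: p_def)
  have chain0: "near_chain (p k) 0.6" for k
  proof (induction k)
    case 0
    show ?case using \<open>near_chain x 0.6\<close> by (simp add: p_def)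
  next
    case (Suc k)
    then show ?case unfolding p_Suc by (rule near_chain_riem_analogue)
  qed
  have step: "norm (fdiff (p k) i) \<le> 0.6" for k i
    using near_chainD(2)[OF chain0] by (simp add: fdiff_def)
  have chain: "near_chain (p k) (supnorm (fdiff (p k)))" for k
  proof -
    have "norm (fdiff (p k) i) \<le> supnorm (fdiff (p k))" for i
      using step[of k] by (rule norm_le_supnorm)
    moreover have "supnorm (fdiff (p k)) \<le> 0.6" using step[of k] by (rule supnorm_least)
    ultimately show ?thesis
      using near_chainD(1)[OF chain0[of k]] by (simp add: near_chain_def fdiff_def)
  qed
  have step2: "norm (fdiff (fdiff (p k)) i) \<le> 2 * 0.6" for k i
    by (rule norm_fdiff_le) (rule step)
  interpret perturbed_cubic p 8
  proof
    fix k i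
    show "norm (fdiff (p k) i) \<le> 1" using step[of k i] by simp
    show "supnorm (fdiff (p (Suc k))) \<le> 5 / 6 * supnorm (fdiff (p k))"
      unfolding p_Suc by (rule supnorm_least, rule riem_cubic_contraction[OF chain])
    show "norm (p (Suc k) (2 * i) - p k i) \<le> supnorm (fdiff (p k))"
      "norm (p (Suc k) (2 * i + 1) - p k i) \<le> supnorm (fdiff (p k))"
      unfolding p_Suc by (rule riem_cubic_near_data[OF chain])+
    have "norm (fdiff (fdiff (p k)) i) \<le> supnorm (fdiff (fdiff (p k)))" for i
      using step2[of k] by (rule norm_le_supnorm)
    then show "norm (fdiff (\<lambda>j. p (Suc k) j - cubic (p k) j) i)
      \<le> 8 * supnorm (fdiff (p k)) * ((supnorm (fdiff (p k)))\<^sup>2 + supnorm (fdiff (fdiff (p k))))"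
      unfolding p_Suc by (rule riem_cubic_proximity[OF chain])
  qed simp
  obtain f D G where f: "grid_limit p f"
    and D: "\<And>t. (f has_vector_derivative D t) (at t)"
    and G: "\<And>t. (D has_vector_derivative G t) (at t)" "continuous_on UNIV G"
    by (rule C2_limit) (rule that)
  have "Ck_on 2 UNIV f"
  proof -
    have c: "Ck_on 0 UNIV (\<lambda>t. v *\<^sub>R G t)" for v by (simp add: G(2) continuous_on_scaleR)
    have "((\<lambda>t. v *\<^sub>R D t) has_derivative (\<lambda>u. v *\<^sub>R (u *\<^sub>R G t))) (at t)" for v t
      using G(1)[of t] unfolding has_vector_derivative_def by (rule has_derivative_scaleR_right)
    moreover have "Ck_on 0 UNIV (\<lambda>t. v *\<^sub>R (u *\<^sub>R G t))" for u v using c[of "v * u"] by simp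
    ultimately have "Ck_on (Suc 0) UNIV (\<lambda>t. v *\<^sub>R D t)" for v
      unfolding Ck_on.simps(2) by (intro exI[of _ "\<lambda>t u. v *\<^sub>R (u *\<^sub>R G t)"]) blast
    then show ?thesis
      using D unfolding numeral_2_eq_2 Ck_on.simps(2)[of "Suc 0"] has_vector_derivative_def
      by (intro exI[of _ "\<lambda>t u. u *\<^sub>R D t"]) blast
  qed
  moreover have "converges_to cubic_mask x f"
  proof -
    have "norm (f t) = 1" for t
      using tendsto_norm[OF grid_limit_tendsto[OF f, of t]] near_chainD(1)[OF chain0]
      by (simp add: LIMSEQ_const_iff)
    then have "range f \<subseteq> sphere 0 1" by auto
    moreover have "continuous_on UNIV f"
      using D by (auto simp: continuous_on_eq_continuous_at intro: has_vector_derivative_continuous)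
    moreover have "riem_defined cubic_mask (p k)" for k by (rule riem_defined_cubic[OF chain])
    moreover have "\<exists>F. (\<forall>k. chart_interpolant k (p k) (F k)) \<and>
        (\<forall>K. compact K \<longrightarrow> uniform_limit K F f sequentially)"
    proof -
      have "\<exists>g. chart_interpolant k (p k) g \<and>
          (\<forall>t. norm (g t - p k \<lfloor>2 ^ k * t\<rfloor>) \<le> norm (p k (\<lfloor>2 ^ k * t\<rfloor> + 1) - p k \<lfloor>2 ^ k * t\<rfloor>))" for k
      proof (rule exists_chart_interpolant)
        show "norm (p k i) = 1" for i by (rule near_chainD(1)[OF chain0])
        show "norm (p k (i + 1) - p k i) < 2" for i using near_chainD(2)[OF chain0, of k i] by simp
      qed
      then obtain F where F: "\<And>k. chart_interpolant k (p k) (F k)"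
        "\<And>k t. norm (F k t - p k \<lfloor>2 ^ k * t\<rfloor>) \<le> norm (p k (\<lfloor>2 ^ k * t\<rfloor> + 1) - p k \<lfloor>2 ^ k * t\<rfloor>)"
        by metis
      obtain \<eta> where \<eta>: "\<eta> \<longlonglongrightarrow> 0" "\<And>k t. norm (p k \<lfloor>2 ^ k * t\<rfloor> - f t) \<le> \<eta> k"
        using f by (rule grid_limitE) (rule that)
      have close: "norm (F k t - f t) \<le> \<delta> k + \<eta> k" for k t
      proof -
        have "norm (F k t - p k \<lfloor>2 ^ k * t\<rfloor>) \<le> \<delta> k"
          using F(2)[of k t] norm_fdiff_le_sup(1)[of k "\<lfloor>2 ^ k * t\<rfloor>"] unfolding fdiff_def by (rule order_trans)
        from norm_triangle_mono[OF this \<eta>(2)[of k t]] show ?thesis by simp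
      qed
      have "(\<lambda>k. \<delta> k + \<eta> k) \<longlonglongrightarrow> 0"
        using tendsto_add[OF summable_LIMSEQ_zero[OF summable_\<delta>] \<eta>(1)] by simp
      have "uniform_limit K F f sequentially" for K
      proof (rule uniform_limitI)
        fix e :: real assume "0 < e"
        with \<open>(\<lambda>k. \<delta> k + \<eta> k) \<longlonglongrightarrow> 0\<close> have "\<forall>\<^sub>F k in sequentially. \<delta> k + \<eta> k < e"
          by (rule order_tendstoD)
        then show "\<forall>\<^sub>F k in sequentially. \<forall>t\<in>K. dist (F k t) (f t) < e"
          by eventually_elim (use close in \<open>auto simp: dist_norm intro: le_less_trans\<close>)
      qed
      then show ?thesis using F(1) by blast
    qed
    ultimately show ?thesis unfolding converges_to_def p_def by blast
  qed
  ultimately show ?thesis by blast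
qed

end
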